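(* Let $\mathcal{H}_1=L^2(X,\mu)$, $\mathcal{H}_2=L^2(Y,\nu)$ and let $\mathcal{U}\subseteq\mathcal{B}(\mathcal{H}_1,\mathcal{H}_2)$ be a w*-closed normalizing space which is a bimodule over the multiplication masas $\mathcal{D}_i\subseteq\mathcal{B}(\mathcal{H}_i)$ $(i=1,2)$, i.e. $\mathcal{D}_2\mathcal{U}\mathcal{D}_1\subseteq\mathcal{U}$. If the algebra $[\mathcal{U}\mathcal{U}^*]$ is abelian, then there are a Borel subset $X_o\subseteq X$ and a Borel function $f:X_o\to Y$ such that the $\omega$-support of $\mathcal{U}$ is the graph $\{(x,y)\in X_o\times Y:f(x)=y\}$ of $f$. If the algebra $[\mathcal{U}^*\mathcal{U}]$ is abelian, then there are a Borel subset $Y_o\subseteq Y$ and a Borel function $g:Y_o\to X$ such that the $\omega$-support of $\mathcal{U}$ is the "reverse graph" $\{(x,y)\in X\times Y_o:x=g(y)\}$ of $g$.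
   Context: $(X,\mu)$ and $(Y,\nu)$ are standard Borel spaces with $\sigma$-finite Borel measures; the Hilbert spaces $L^2(X,\mu),L^2(Y,\nu)$ are separable. $\mathcal{D}_1,\mathcal{D}_2$ are the algebras of multiplication operators by $L^\infty(X,\mu)$, $L^\infty(Y,\nu)$; masa = maximal abelian selfadjoint algebra. For Borel $\alpha\subseteq X$, $\beta\subseteq Y$, $E(\alpha)\in\mathcal{D}_1$ and $F(\beta)\in\mathcal{D}_2$ are the multiplication projections by the characteristic functions. A linear subspace $\mathcal{U}$ is normalizing if $AB^*C\in\mathcal{U}$ for all $A,B,C\in\mathcal{U}$. $[\mathcal{U}\mathcal{U}^*]$ and $[\mathcal{U}^*\mathcal{U}]$ are the linear spans of $\{ST^*:S,T\in\mathcal{U}\}$ and $\{S^*T:S,T\in\mathcal{U}\}$ (these are *-algebras since $\mathcal{U}$ is normalizing). An operator $T:\mathcal{H}_1\to\mathcal{H}_2$ is supported by $\kappa\subseteq X\times Y$ if $F(\beta)TE(\alpha)=0$ whenever $\alpha\subseteq X,\beta\subseteq Y$ are Borel with $(\alpha\times\beta)\cap\kappa=\emptyset$. Two subsets of $X\times Y$ are marginally equivalent if their symmetric difference is contained in $(M\times Y)\cup(X\times N)$ with $\mu(M)=\nu(N)=0$. For a reflexive $\mathcal{D}_2,\mathcal{D}_1$-bimodule $\mathcal{U}$ (reflexive: $T\in\mathcal{U}$ whenever $Tx\in\overline{\mathcal{U}x}$ for all $x$; w*-closed normalizing spaces are reflexive), the $\omega$-support of $\mathcal{U}$ is the set $\kappa$,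 unique up to marginal equivalence, whose complement is marginally equivalent to a countable union of Borel rectangles and such that $\mathcal{U}$ consists of all operators supported by $\kappa$. *)

theory Defs
  imports "HOL-Analysis.Analysis"
begin

definition polish_topology :: "'a topology \<Rightarrow> bool" where
  "polish_topology \<T> \<longleftrightarrow> completely_metrizable_space \<T> \<and> second_countable \<T>"

definition standard_borel_space :: "'a measure \<Rightarrow> bool" where
  "standard_borel_space M \<longleftrightarrow>
     (\<exists>\<T>. polish_topology \<T> \<and> topspace \<T> = space M \<and>
        sets M = sigma_sets (space M) {V. openin \<T> V})"

definition sq_integrable :: "'a measure \<Rightarrow> ('a \<Rightarrow> complex) set" where
  "sq_integrable M =
     {f. f \<in> borel_measurable M \<and> integrable M (\<lambda>x. (cmod (f x))\<^sup>2)}"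

text \<open>Vectors are classes of measurable functions modulo equality almost everywhere, so that
  equality of vectors, and hence of operators, is equality in HOL.\<close>

type_synonym 'a l2vec = "('a \<Rightarrow> complex) set"

definition ae_class :: "'a measure \<Rightarrow> ('a \<Rightarrow> complex) \<Rightarrow> 'a l2vec" where
  "ae_class M f = {g \<in> borel_measurable M. AE x in M. g x = f x}"

definition L2 :: "'a measure \<Rightarrow> 'a l2vec set" where
  "L2 M = ae_class M ` sq_integrable M"

definition l2_rep :: "'a l2vec \<Rightarrow> 'a \<Rightarrow> complex" where
  "l2_rep u = (SOME f. f \<in> u)"

definition l2_zero :: "'a measure \<Rightarrow> 'a l2vec" where
  "l2_zero M = ae_class M (\<lambda>_. 0)"

definition l2_add :: "'a measure \<Rightarrow> 'a l2vec \<Rightarrow> 'a l2vec \<Rightarrow> 'a l2vec" where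
  "l2_add M u v = ae_class M (\<lambda>x. l2_rep u x + l2_rep v x)"

definition l2_scale :: "'a measure \<Rightarrow> complex \<Rightarrow> 'a l2vec \<Rightarrow> 'a l2vec" where
  "l2_scale M c u = ae_class M (\<lambda>x. c * l2_rep u x)"

definition l2_inner :: "'a measure \<Rightarrow> 'a l2vec \<Rightarrow> 'a l2vec \<Rightarrow> complex" where
  "l2_inner M u v = (\<integral>x. l2_rep u x * cnj (l2_rep v x) \<partial>M)"

definition l2_norm :: "'a measure \<Rightarrow> 'a l2vec \<Rightarrow> real" where
  "l2_norm M u = sqrt (\<integral>x. (cmod (l2_rep u x))\<^sup>2 \<partial>M)"

type_synonym ('a, 'b) l2op = "'a l2vec \<Rightarrow> 'b l2vec"

definition bounded_ops :: "'a measure \<Rightarrow> 'b measure \<Rightarrow> ('a, 'b) l2op set" where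
  "bounded_ops M N =
     {T \<in> L2 M \<rightarrow>\<^sub>E L2 N.
        (\<forall>u\<in>L2 M. \<forall>v\<in>L2 M. T (l2_add M u v) = l2_add N (T u) (T v)) \<and>
        (\<forall>c. \<forall>u\<in>L2 M. T (l2_scale M c u) = l2_scale N c (T u)) \<and>
        (\<exists>C. \<forall>u\<in>L2 M. l2_norm N (T u) \<le> C * l2_norm M u)}"

definition op_zero :: "'a measure \<Rightarrow> 'b measure \<Rightarrow> ('a, 'b) l2op" where
  "op_zero M N = (\<lambda>u\<in>L2 M. l2_zero N)"

definition op_add ::
  "'a measure \<Rightarrow> 'b measure \<Rightarrow> ('a, 'b) l2op \<Rightarrow> ('a, 'b) l2op \<Rightarrow> ('a, 'b) l2op" where
  "op_add M N S T = (\<lambda>u\<in>L2 M. l2_add N (S u) (T u))"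

definition op_scale ::
  "'a measure \<Rightarrow> 'b measure \<Rightarrow> complex \<Rightarrow> ('a, 'b) l2op \<Rightarrow> ('a, 'b) l2op" where
  "op_scale M N c T = (\<lambda>u\<in>L2 M. l2_scale N c (T u))"

text \<open>In \<open>op_comp M S T\<close> the measure \<open>M\<close> is the one underlying the domain of \<open>T\<close>.\<close>

definition op_comp ::
  "'a measure \<Rightarrow> ('b, 'c) l2op \<Rightarrow> ('a, 'b) l2op \<Rightarrow> ('a, 'c) l2op" where
  "op_comp M S T = compose (L2 M) S T"

definition op_adjoint :: "'a measure \<Rightarrow> 'b measure \<Rightarrow> ('a, 'b) l2op \<Rightarrow> ('b, 'a) l2op" where
  "op_adjoint M N T =
     (THE S. S \<in> bounded_ops N M \<and>
        (\<forall>u\<in>L2 M. \<forall>v\<in>L2 N. l2_inner N (T u) v = l2_inner M u (S v)))"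

definition op_subspace :: "'a measure \<Rightarrow> 'b measure \<Rightarrow> ('a, 'b) l2op set \<Rightarrow> bool" where
  "op_subspace M N \<U> \<longleftrightarrow>
     \<U> \<subseteq> bounded_ops M N \<and> op_zero M N \<in> \<U> \<and>
     (\<forall>S\<in>\<U>. \<forall>T\<in>\<U>. op_add M N S T \<in> \<U>) \<and>
     (\<forall>c. \<forall>T\<in>\<U>. op_scale M N c T \<in> \<U>)"

definition op_span ::
  "'a measure \<Rightarrow> 'b measure \<Rightarrow> ('a, 'b) l2op set \<Rightarrow> ('a, 'b) l2op set" where
  "op_span M N \<S> = op_subspace M N hull \<S>"

text \<open>The w*-topology comes from the duality with the trace class operators, under which
  the w*-continuous functionals are \<open>T \<mapsto> (\<Sum>n. \<langle>T (\<xi> n), \<eta> n\<rangle>)\<close> with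
  \<open>\<xi>\<close>, \<open>\<eta>\<close> square summable in norm.\<close>

definition l2_sq_summable :: "'a measure \<Rightarrow> (nat \<Rightarrow> 'a l2vec) \<Rightarrow> bool" where
  "l2_sq_summable M \<xi> \<longleftrightarrow> (\<forall>n. \<xi> n \<in> L2 M) \<and> summable (\<lambda>n. (l2_norm M (\<xi> n))\<^sup>2)"

definition weak_star_topology :: "'a measure \<Rightarrow> 'b measure \<Rightarrow> ('a, 'b) l2op topology" where
  "weak_star_topology M N = topology_generated_by
     {{T \<in> bounded_ops M N. (\<Sum>n. l2_inner N (T (\<xi> n)) (\<eta> n)) \<in> V} | \<xi> \<eta> V.
        l2_sq_summable M \<xi> \<and> l2_sq_summable N \<eta> \<and> open V}"

definition ess_bounded :: "'a measure \<Rightarrow> ('a \<Rightarrow> complex) set" where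
  "ess_bounded M = {\<phi>. \<phi> \<in> borel_measurable M \<and> (\<exists>C. AE x in M. cmod (\<phi> x) \<le> C)}"

definition mult_op :: "'a measure \<Rightarrow> ('a \<Rightarrow> complex) \<Rightarrow> ('a, 'a) l2op" where
  "mult_op M \<phi> = (\<lambda>u\<in>L2 M. ae_class M (\<lambda>x. \<phi> x * l2_rep u x))"

definition mult_masa :: "'a measure \<Rightarrow> ('a, 'a) l2op set" where
  "mult_masa M = mult_op M ` ess_bounded M"

definition set_proj :: "'a measure \<Rightarrow> 'a set \<Rightarrow> ('a, 'a) l2op" where
  "set_proj M \<alpha> = mult_op M (indicator \<alpha>)"

definition masa_bimodule :: "'a measure \<Rightarrow> 'b measure \<Rightarrow> ('a, 'b) l2op set \<Rightarrow> bool" where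
  "masa_bimodule M N \<U> \<longleftrightarrow>
     (\<forall>B\<in>mult_masa N. \<forall>T\<in>\<U>. \<forall>A\<in>mult_masa M. op_comp M B (op_comp M T A) \<in> \<U>)"

definition normalizing :: "'a measure \<Rightarrow> 'b measure \<Rightarrow> ('a, 'b) l2op set \<Rightarrow> bool" where
  "normalizing M N \<U> \<longleftrightarrow>
     op_subspace M N \<U> \<and>
     (\<forall>A\<in>\<U>. \<forall>B\<in>\<U>. \<forall>C\<in>\<U>. op_comp M A (op_comp M (op_adjoint M N B) C) \<in> \<U>)"

text \<open>\<open>left_algebra\<close> is \<open>[\<U>\<U>*]\<close>, acting on \<open>L2 N\<close>, and \<open>right_algebra\<close> is
  \<open>[\<U>*\<U>]\<close>, acting on \<open>L2 M\<close>.\<close>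

definition left_algebra ::
  "'a measure \<Rightarrow> 'b measure \<Rightarrow> ('a, 'b) l2op set \<Rightarrow> ('b, 'b) l2op set" where
  "left_algebra M N \<U> =
     op_span N N {op_comp N S (op_adjoint M N T) | S T. S \<in> \<U> \<and> T \<in> \<U>}"

definition right_algebra ::
  "'a measure \<Rightarrow> 'b measure \<Rightarrow> ('a, 'b) l2op set \<Rightarrow> ('a, 'a) l2op set" where
  "right_algebra M N \<U> =
     op_span M M {op_comp M (op_adjoint M N S) T | S T. S \<in> \<U> \<and> T \<in> \<U>}"

definition abelian_ops :: "'a measure \<Rightarrow> ('a, 'a) l2op set \<Rightarrow> bool" where
  "abelian_ops M \<A> \<longleftrightarrow> (\<forall>S\<in>\<A>. \<forall>T\<in>\<A>. op_comp M S T = op_comp M T S)"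

definition supported_by ::
  "'a measure \<Rightarrow> 'b measure \<Rightarrow> ('a, 'b) l2op \<Rightarrow> ('a \<times> 'b) set \<Rightarrow> bool" where
  "supported_by M N T \<kappa> \<longleftrightarrow>
     (\<forall>\<alpha>\<in>sets M. \<forall>\<beta>\<in>sets N. (\<alpha> \<times> \<beta>) \<inter> \<kappa> = {} \<longrightarrow>
        op_comp M (set_proj N \<beta>) (op_comp M T (set_proj M \<alpha>)) = op_zero M N)"

definition marginally_equivalent ::
  "'a measure \<Rightarrow> 'b measure \<Rightarrow> ('a \<times> 'b) set \<Rightarrow> ('a \<times> 'b) set \<Rightarrow> bool" where
  "marginally_equivalent M N \<kappa> \<kappa>' \<longleftrightarrow>
     (\<exists>A\<in>null_sets M. \<exists>B\<in>null_sets N.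
        (\<kappa> - \<kappa>') \<union> (\<kappa>' - \<kappa>) \<subseteq> (A \<times> space N) \<union> (space M \<times> B))"

text \<open>The \<open>\<omega>\<close>-support is determined only up to marginal equivalence, hence a predicate.
  A set \<open>\<kappa>\<close> with these properties makes \<open>\<U>\<close> reflexive, so reflexivity is not demanded.\<close>

definition is_omega_support ::
  "'a measure \<Rightarrow> 'b measure \<Rightarrow> ('a, 'b) l2op set \<Rightarrow> ('a \<times> 'b) set \<Rightarrow> bool" where
  "is_omega_support M N \<U> \<kappa> \<longleftrightarrow>
     \<kappa> \<subseteq> space M \<times> space N \<and>
     (\<exists>A B. (\<forall>n::nat. A n \<in> sets M \<and> B n \<in> sets N) \<and>
        marginally_equivalent M N (space M \<times> space N - \<kappa>) (\<Union>n. A n \<times> B n)) \<and>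
     \<U> = {T \<in> bounded_ops M N. supported_by M N T \<kappa>}"

end

theory Submission
  imports Defs
begin

text \<open>
  Suppose that \<open>[\<U>\<U>*]\<close> is abelian. For \<open>S, T\<close> in \<open>\<U>\<close> and \<open>P\<close> in the masa of \<open>L2 N\<close> the operator \<open>S T* P = S (P* T)*\<close> is
  again in \<open>[\<U>\<U>*]\<close>, and the commutation of all these products forces every \<open>S T*\<close> to commute with the masa
  (\<open>range_commutes_with_mult\<close>). Hence \<open>F(B) \<U>\<U>* F(C) = 0\<close> for disjoint \<open>B\<close> and \<open>C\<close>, that is, the ranges of
  \<open>\<U>* F(B)\<close> and of \<open>\<U>* F(C)\<close> are orthogonal; being invariant under the masa of \<open>L2 M\<close>, they consist of functions
  with disjoint supports (\<open>annihilated_vector_support\<close>). So the support \<open>\<Phi>(B)\<close> of \<open>\<U>* F(B)\<close> depends on \<open>B\<close> as a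
  \<open>\<sigma>\<close>-homomorphism from the Borel sets to measurable sets modulo null sets. As the space of \<open>N\<close> is Polish, such
  a homomorphism is \<open>B \<mapsto> f\<^sup>-\<^sup>1(B)\<close> for a Borel function \<open>f\<close> (\<open>point_realization\<close>), and all operators in \<open>\<U>\<close> are
  supported by the graph of \<open>f\<close> (\<open>support_map\<close>).

  It remains to see that every operator \<open>T\<close> supported by the graph belongs to \<open>\<U>\<close> (\<open>on_graph_imp_mem\<close>). Adjoints of
  such operators satisfy \<open>T* F(B) = E(f\<^sup>-\<^sup>1(B)) T*\<close> (\<open>intertwine\<close>), so they are determined by their value at one
  positive function \<open>W\<close>. The vector \<open>T* W\<close> is a limit of vectors \<open>A* W\<close> with \<open>A\<close> in \<open>\<U>\<close>
  (\<open>approximable_at_weight\<close>). The operators \<open>A\<close> in this approximation need not be bounded uniformly, but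
  \<open>A A*\<close> is a multiplication operator, and cutting off the part of \<open>A\<close> over the set where it is large does not
  destroy the approximation (\<open>truncation\<close>). The truncated adjoints are bounded and converge to \<open>T*\<close> at \<open>W\<close>, hence at
  all \<open>F(B) W\<close>, hence strongly. So \<open>T\<close> is a w*-limit of a sequence in \<open>\<U>\<close>.

  If \<open>[\<U>*\<U>]\<close> is abelian, the same argument applies to the space of adjoints of the operators in \<open>\<U>\<close>.

  Vectors being classes of functions, the geometry of \<open>L2\<close> is developed on these classes: completeness,
  and a form of the Riesz representation theorem relative to a subspace (\<open>riesz_on_subspace\<close>), which yields both
  the existence of adjoints and the approximation of vectors by subspaces.
\<close>

section \<open>Square integrable functions and their classes\<close>

lemma mult_le_sum_squares: "a * b \<le> a\<^sup>2 + (b::real)\<^sup>2"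
proof -
  have "0 \<le> (a - b)\<^sup>2 + a\<^sup>2 + b\<^sup>2" by (intro add_nonneg_nonneg) simp_all
  then show ?thesis by (simp add: power2_eq_square algebra_simps)
qed

lemma borel_measurable_cnj [measurable (raw)]:
  fixes f :: "'a \<Rightarrow> complex"
  shows "f \<in> borel_measurable M \<Longrightarrow> (\<lambda>x. cnj (f x)) \<in> borel_measurable M"
  by (intro borel_measurable_continuous_on[OF continuous_on_cnj]) auto

lemma sq_integrable_measurable:
  "f \<in> sq_integrable M \<Longrightarrow> f \<in> borel_measurable M"
  by (simp add: sq_integrable_def)

lemma sq_integrable_dominated:
  assumes "f \<in> sq_integrable M" "g \<in> borel_measurable M" "AE x in M. cmod (g x) \<le> C * cmod (f x)"
  shows "g \<in> sq_integrable M"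
proof -
  have "integrable M (\<lambda>x. C\<^sup>2 * (cmod (f x))\<^sup>2)"
    using assms(1) by (simp add: sq_integrable_def)
  moreover have "AE x in M. norm ((cmod (g x))\<^sup>2) \<le> norm (C\<^sup>2 * (cmod (f x))\<^sup>2)"
    using assms(3)
  proof eventually_elim
    case (elim x)
    then have "(cmod (g x))\<^sup>2 \<le> (C * cmod (f x))\<^sup>2" by (intro power_mono) auto
    then show ?case by (simp add: power_mult_distrib)
  qed
  ultimately have "integrable M (\<lambda>x. (cmod (g x))\<^sup>2)"
    using assms(2) by (elim Bochner_Integration.integrable_bound) measurable
  then show ?thesis using assms(2) by (simp add: sq_integrable_def)
qed

lemma sq_integrable_add:
  assumes "f \<in> sq_integrable M" "g \<in> sq_integrable M"
  shows "(\<lambda>x. f x + g x) \<in> sq_integrable M"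
proof -
  have [measurable]: "f \<in> borel_measurable M" "g \<in> borel_measurable M"
    using assms by (auto simp: sq_integrable_def)
  have "integrable M (\<lambda>x. 2 * (cmod (f x))\<^sup>2 + 2 * (cmod (g x))\<^sup>2)"
    using assms by (simp add: sq_integrable_def)
  then have "integrable M (\<lambda>x. (cmod (f x + g x))\<^sup>2)"
  proof (rule Bochner_Integration.integrable_bound)
    have "(cmod (f x + g x))\<^sup>2 \<le> 2 * (cmod (f x))\<^sup>2 + 2 * (cmod (g x))\<^sup>2" for x
    proof -
      have "(cmod (f x + g x))\<^sup>2 \<le> (cmod (f x) + cmod (g x))\<^sup>2"
        by (intro power_mono norm_triangle_ineq) auto
      also have "\<dots> \<le> 2 * (cmod (f x))\<^sup>2 + 2 * (cmod (g x))\<^sup>2"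
        using zero_le_power2[of "cmod (f x) - cmod (g x)"]
        by (simp add: power2_eq_square algebra_simps)
      finally show ?thesis .
    qed
    then show "AE x in M. norm ((cmod (f x + g x))\<^sup>2)
                 \<le> norm (2 * (cmod (f x))\<^sup>2 + 2 * (cmod (g x))\<^sup>2)"
      by (simp add: abs_of_nonneg)
  qed measurable
  then show ?thesis by (simp add: sq_integrable_def)
qed

lemma sq_integrable_mult:
  assumes "\<phi> \<in> ess_bounded M" "f \<in> sq_integrable M"
  shows "(\<lambda>x. \<phi> x * f x) \<in> sq_integrable M"
proof -
  obtain C where C: "AE x in M. cmod (\<phi> x) \<le> C" and [measurable]: "\<phi> \<in> borel_measurable M"
    using assms by (auto simp: ess_bounded_def)
  have [measurable]: "f \<in> borel_measurable M" using assms by (simp add: sq_integrable_def)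
  have "AE x in M. cmod (\<phi> x * f x) \<le> C * cmod (f x)"
    using C by eventually_elim (simp add: norm_mult mult_right_mono)
  then show ?thesis using sq_integrable_dominated[OF assms(2)] by simp
qed

lemma ess_bounded_const [simp]: "(\<lambda>_. c) \<in> ess_bounded M"
  unfolding ess_bounded_def by auto

lemma ess_bounded_indicator [simp]: "A \<in> sets M \<Longrightarrow> indicator A \<in> ess_bounded M"
  unfolding ess_bounded_def by (auto intro!: exI[of _ 1] simp: indicator_def)

lemma ess_bounded_cnj: "\<phi> \<in> ess_bounded M \<Longrightarrow> (\<lambda>x. cnj (\<phi> x)) \<in> ess_bounded M"
  by (auto simp: ess_bounded_def intro: borel_measurable_cnj)

lemma ess_bounded_mult:
  assumes "\<phi> \<in> ess_bounded M" "\<psi> \<in> ess_bounded M"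
  shows "(\<lambda>x. \<phi> x * \<psi> x) \<in> ess_bounded M"
proof -
  obtain C D where C: "AE x in M. cmod (\<phi> x) \<le> C" and D: "AE x in M. cmod (\<psi> x) \<le> D"
    using assms by (auto simp: ess_bounded_def)
  have "AE x in M. cmod (\<phi> x * \<psi> x) \<le> C * D"
    using C D by eventually_elim (auto simp: norm_mult intro!: mult_mono intro: order_trans[OF norm_ge_zero])
  then show ?thesis using assms by (auto simp: ess_bounded_def)
qed

lemma ess_bounded_add:
  assumes "\<phi> \<in> ess_bounded M" "\<psi> \<in> ess_bounded M"
  shows "(\<lambda>x. \<phi> x + \<psi> x) \<in> ess_bounded M"
proof -
  obtain C D where C: "AE x in M. cmod (\<phi> x) \<le> C" and D: "AE x in M. cmod (\<psi> x) \<le> D"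
    using assms by (auto simp: ess_bounded_def)
  have "AE x in M. cmod (\<phi> x + \<psi> x) \<le> C + D"
    using C D by eventually_elim (intro norm_triangle_mono)
  then show ?thesis using assms by (auto simp: ess_bounded_def)
qed

lemma integrable_mult_cnj:
  assumes "f \<in> sq_integrable M" "g \<in> sq_integrable M"
  shows "integrable M (\<lambda>x. f x * cnj (g x))"
proof -
  have [measurable]: "f \<in> borel_measurable M" "g \<in> borel_measurable M"
    using assms by (auto simp: sq_integrable_def)
  have "integrable M (\<lambda>x. (cmod (f x))\<^sup>2 + (cmod (g x))\<^sup>2)"
    using assms by (simp add: sq_integrable_def)
  then show ?thesis
  proof (rule Bochner_Integration.integrable_bound)
    show "AE x in M. norm (f x * cnj (g x)) \<le> norm ((cmod (f x))\<^sup>2 + (cmod (g x))\<^sup>2)"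
      by (simp add: norm_mult mult_le_sum_squares abs_of_nonneg)
  qed measurable
qed

lemma ae_class_self: "f \<in> borel_measurable M \<Longrightarrow> f \<in> ae_class M f"
  by (simp add: ae_class_def)

lemma ae_class_eqI:
  assumes "AE x in M. f x = g x"
  shows "ae_class M f = ae_class M g"
proof -
  have "(AE x in M. h x = f x) \<longleftrightarrow> (AE x in M. h x = g x)" for h
    using assms by (auto elim: AE_mp)
  then show ?thesis by (simp add: ae_class_def)
qed

lemma rep_ae_class:
  assumes "f \<in> borel_measurable M"
  shows "l2_rep (ae_class M f) \<in> borel_measurable M" "AE x in M. l2_rep (ae_class M f) x = f x"
proof -
  have "l2_rep (ae_class M f) \<in> ae_class M f"
    unfolding l2_rep_def using someI[of "\<lambda>g. g \<in> ae_class M f", OF ae_class_self[OF assms]] by simp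
  then show "l2_rep (ae_class M f) \<in> borel_measurable M" "AE x in M. l2_rep (ae_class M f) x = f x"
    by (auto simp: ae_class_def)
qed

lemma ae_class_L2: "f \<in> sq_integrable M \<Longrightarrow> ae_class M f \<in> L2 M"
  by (simp add: L2_def)

lemma rep_sq_integrable:
  assumes "u \<in> L2 M"
  shows "l2_rep u \<in> sq_integrable M"
proof -
  obtain f where f: "f \<in> sq_integrable M" and u: "u = ae_class M f"
    using assms by (auto simp: L2_def)
  have fm: "f \<in> borel_measurable M" using f by (simp add: sq_integrable_def)
  have "AE x in M. cmod (l2_rep u x) \<le> 1 * cmod (f x)"
    using rep_ae_class(2)[OF fm] unfolding u by eventually_elim simp
  then show ?thesis
    using sq_integrable_dominated[OF f] rep_ae_class(1)[OF fm] unfolding u by blast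
qed

lemma rep_measurable: "u \<in> L2 M \<Longrightarrow> l2_rep u \<in> borel_measurable M"
  using rep_sq_integrable by (auto simp: sq_integrable_def)

lemma rep_class_id:
  assumes "u \<in> L2 M"
  shows "ae_class M (l2_rep u) = u"
proof -
  obtain f where f: "f \<in> sq_integrable M" and u: "u = ae_class M f"
    using assms by (auto simp: L2_def)
  then show ?thesis
    unfolding u by (intro ae_class_eqI rep_ae_class) (simp add: sq_integrable_def)
qed

lemma L2_eqI:
  assumes "u \<in> L2 M" "v \<in> L2 M" "AE x in M. l2_rep u x = l2_rep v x"
  shows "u = v"
  using ae_class_eqI[OF assms(3)] by (simp add: rep_class_id assms)

lemma zero_L2 [simp]: "l2_zero M \<in> L2 M"
  by (auto simp: l2_zero_def sq_integrable_def intro!: ae_class_L2)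

lemma add_L2 [simp]: "u \<in> L2 M \<Longrightarrow> v \<in> L2 M \<Longrightarrow> l2_add M u v \<in> L2 M"
  unfolding l2_add_def by (intro ae_class_L2 sq_integrable_add rep_sq_integrable)

lemma scale_L2 [simp]: "u \<in> L2 M \<Longrightarrow> l2_scale M c u \<in> L2 M"
  unfolding l2_scale_def by (intro ae_class_L2 sq_integrable_mult rep_sq_integrable) auto

lemma rep_zero: "AE x in M. l2_rep (l2_zero M) x = 0"
  unfolding l2_zero_def by (rule rep_ae_class) simp

lemma rep_add:
  assumes "u \<in> L2 M" "v \<in> L2 M"
  shows "AE x in M. l2_rep (l2_add M u v) x = l2_rep u x + l2_rep v x"
  unfolding l2_add_def using assms[THEN rep_measurable] by (intro rep_ae_class) measurable

lemma rep_scale: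
  assumes "u \<in> L2 M"
  shows "AE x in M. l2_rep (l2_scale M c u) x = c * l2_rep u x"
  unfolding l2_scale_def using assms[THEN rep_measurable] by (intro rep_ae_class) measurable

lemma mult_op_L2 [simp]: "\<phi> \<in> ess_bounded M \<Longrightarrow> u \<in> L2 M \<Longrightarrow> mult_op M \<phi> u \<in> L2 M"
  unfolding mult_op_def by (simp add: ae_class_L2 sq_integrable_mult rep_sq_integrable)

lemma rep_mult_op:
  assumes "\<phi> \<in> borel_measurable M" "u \<in> L2 M"
  shows "AE x in M. l2_rep (mult_op M \<phi> u) x = \<phi> x * l2_rep u x"
proof -
  have "(\<lambda>x. \<phi> x * l2_rep u x) \<in> borel_measurable M"
    using assms(1) assms(2)[THEN rep_measurable] by measurable
  then show ?thesis unfolding mult_op_def using assms(2) by (simp add: rep_ae_class)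
qed

lemma inner_integrable:
  "u \<in> L2 M \<Longrightarrow> v \<in> L2 M \<Longrightarrow> integrable M (\<lambda>x. l2_rep u x * cnj (l2_rep v x))"
  by (intro integrable_mult_cnj rep_sq_integrable)

lemma inner_cong:
  assumes "u \<in> L2 M" "v \<in> L2 M" "integrable M h" "AE x in M. l2_rep u x * cnj (l2_rep v x) = h x"
  shows "l2_inner M u v = (\<integral>x. h x \<partial>M)"
  unfolding l2_inner_def
  using assms inner_integrable[OF assms(1,2)] by (intro integral_cong_AE) auto

lemma inner_add_left:
  assumes "u \<in> L2 M" "v \<in> L2 M" "w \<in> L2 M"
  shows "l2_inner M (l2_add M u v) w = l2_inner M u w + l2_inner M v w"
proof -
  have "l2_inner M (l2_add M u v) w
      = (\<integral>x. l2_rep u x * cnj (l2_rep w x) + l2_rep v x * cnj (l2_rep w x) \<partial>M)"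
    using rep_add[OF assms(1,2)]
    by (intro inner_cong) (auto simp: assms inner_integrable ring_distribs elim!: AE_mp)
  also have "\<dots> = l2_inner M u w + l2_inner M v w"
    unfolding l2_inner_def by (intro Bochner_Integration.integral_add inner_integrable assms)
  finally show ?thesis .
qed

lemma inner_scale_left:
  assumes "u \<in> L2 M" "w \<in> L2 M"
  shows "l2_inner M (l2_scale M c u) w = c * l2_inner M u w"
proof -
  have "l2_inner M (l2_scale M c u) w = (\<integral>x. c * (l2_rep u x * cnj (l2_rep w x)) \<partial>M)"
    using rep_scale[OF assms(1), of c]
    by (intro inner_cong) (auto simp: assms inner_integrable elim!: AE_mp)
  then show ?thesis by (simp add: l2_inner_def)
qed

lemma inner_cnj: "cnj (l2_inner M u v) = l2_inner M v u"
proof -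
  have "cnj (l2_inner M u v) = (\<integral>x. cnj (l2_rep u x * cnj (l2_rep v x)) \<partial>M)"
    unfolding l2_inner_def by (simp only: Bochner_Integration.integral_cnj)
  then show ?thesis by (simp add: l2_inner_def mult.commute)
qed

lemma inner_add_right:
  assumes "u \<in> L2 M" "v \<in> L2 M" "w \<in> L2 M"
  shows "l2_inner M w (l2_add M u v) = l2_inner M w u + l2_inner M w v"
  using inner_add_left[OF assms] by (metis complex_cnj_add inner_cnj)

lemma inner_scale_right:
  assumes "u \<in> L2 M" "w \<in> L2 M"
  shows "l2_inner M w (l2_scale M c u) = cnj c * l2_inner M w u"
  using inner_scale_left[OF assms] by (metis complex_cnj_mult inner_cnj)

lemma norm_nonneg [simp]: "0 \<le> l2_norm M u"
  by (simp add: l2_norm_def)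

lemma inner_self: "l2_inner M u u = complex_of_real ((l2_norm M u)\<^sup>2)"
proof -
  have "l2_inner M u u = (\<integral>x. complex_of_real ((cmod (l2_rep u x))\<^sup>2) \<partial>M)"
    unfolding l2_inner_def by (intro Bochner_Integration.integral_cong) (auto simp: complex_norm_square simp del: of_real_power)
  then show ?thesis
    by (simp only: integral_complex_of_real) (simp add: l2_norm_def)
qed

lemma norm_sq: "(l2_norm M u)\<^sup>2 = Re (l2_inner M u u)"
  by (simp add: inner_self)

lemma norm_scale:
  assumes "u \<in> L2 M"
  shows "l2_norm M (l2_scale M c u) = cmod c * l2_norm M u"
proof -
  have "l2_inner M (l2_scale M c u) (l2_scale M c u) = (c * cnj c) * l2_inner M u u"
    by (simp add: inner_scale_left inner_scale_right assms)
  also have "\<dots> = complex_of_real ((cmod c * l2_norm M u)\<^sup>2)"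
    by (simp only: inner_self power_mult_distrib of_real_mult complex_norm_square)
  finally have "(l2_norm M (l2_scale M c u))\<^sup>2 = (cmod c * l2_norm M u)\<^sup>2"
    by (simp only: norm_sq Re_complex_of_real)
  then show ?thesis by (simp add: power2_eq_iff_nonneg)
qed

lemma norm_zero_iff:
  assumes "u \<in> L2 M"
  shows "l2_norm M u = 0 \<longleftrightarrow> (AE x in M. l2_rep u x = 0)"
  using integral_nonneg_eq_0_iff_AE[of M "\<lambda>x. (cmod (l2_rep u x))\<^sup>2"] rep_sq_integrable[OF assms]
  by (simp add: l2_norm_def sq_integrable_def)

lemma cauchy_schwarz:
  assumes "u \<in> L2 M" "v \<in> L2 M"
  shows "cmod (l2_inner M u v) \<le> l2_norm M u * l2_norm M v"
proof (cases "l2_norm M v = 0")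
  case True
  then have "AE x in M. l2_rep u x * cnj (l2_rep v x) = 0"
    using norm_zero_iff[OF assms(2)] by auto
  then have "l2_inner M u v = 0"
    using inner_cong[OF assms, of "\<lambda>_. 0"] by simp
  then show ?thesis using True by simp
next
  case False
  define a where "a = complex_of_real ((l2_norm M v)\<^sup>2)"
  define b where "b = l2_inner M u v"
  have gram: "l2_inner M u v = b" "l2_inner M v u = cnj b" "l2_inner M v v = a"
    by (simp_all add: a_def b_def inner_self inner_cnj)
  let ?w = "l2_add M (l2_scale M a u) (l2_scale M (-b) v)"
  have "0 \<le> Re (l2_inner M ?w ?w)" by (simp add: inner_self)
  also have "l2_inner M ?w ?w = a * cnj a * l2_inner M u u - a * cnj b * b - b * cnj a * cnj b
      + b * cnj b * a"
    using assms by (simp add: inner_add_left inner_add_right inner_scale_left inner_scale_right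
        gram algebra_simps)
  also have "\<dots> = complex_of_real ((l2_norm M v)\<^sup>2 * ((l2_norm M v)\<^sup>2 * (l2_norm M u)\<^sup>2 - (cmod b)\<^sup>2))"
    using complex_norm_square[of b] by (simp add: a_def inner_self algebra_simps)
  finally have "0 \<le> (l2_norm M v)\<^sup>2 * ((l2_norm M v)\<^sup>2 * (l2_norm M u)\<^sup>2 - (cmod b)\<^sup>2)" by simp
  moreover have "0 < (l2_norm M v)\<^sup>2" using False by simp
  ultimately have "(cmod b)\<^sup>2 \<le> (l2_norm M v)\<^sup>2 * (l2_norm M u)\<^sup>2"
    by (simp add: zero_le_mult_iff)
  then have "(cmod b)\<^sup>2 \<le> (l2_norm M u * l2_norm M v)\<^sup>2"
    by (simp add: power_mult_distrib mult.commute)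
  then show ?thesis unfolding b_def by (rule power2_le_imp_le) simp
qed

lemma norm_add_sq:
  assumes "u \<in> L2 M" "v \<in> L2 M"
  shows "(l2_norm M (l2_add M u v))\<^sup>2 = (l2_norm M u)\<^sup>2 + (l2_norm M v)\<^sup>2 + 2 * Re (l2_inner M u v)"
proof -
  have "Re (l2_inner M v u) = Re (l2_inner M u v)" using arg_cong[OF inner_cnj[of M u v], of Re] by simp
  then show ?thesis by (simp add: norm_sq inner_add_left inner_add_right assms)
qed

lemma norm_triangle:
  assumes "u \<in> L2 M" "v \<in> L2 M"
  shows "l2_norm M (l2_add M u v) \<le> l2_norm M u + l2_norm M v"
proof (rule power2_le_imp_le)
  have "Re (l2_inner M u v) \<le> l2_norm M u * l2_norm M v"
    using cauchy_schwarz[OF assms] complex_Re_le_cmod order_trans by blast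
  then show "(l2_norm M (l2_add M u v))\<^sup>2 \<le> (l2_norm M u + l2_norm M v)\<^sup>2"
    by (simp add: norm_add_sq assms power2_sum)
qed simp

definition l2_diff :: "'a measure \<Rightarrow> 'a l2vec \<Rightarrow> 'a l2vec \<Rightarrow> 'a l2vec" where
  "l2_diff M u v = l2_add M u (l2_scale M (-1) v)"

lemma diff_L2 [simp]: "u \<in> L2 M \<Longrightarrow> v \<in> L2 M \<Longrightarrow> l2_diff M u v \<in> L2 M"
  by (simp add: l2_diff_def)

lemma inner_diff_left:
  "u \<in> L2 M \<Longrightarrow> v \<in> L2 M \<Longrightarrow> w \<in> L2 M \<Longrightarrow>
    l2_inner M (l2_diff M u v) w = l2_inner M u w - l2_inner M v w"
  by (simp add: l2_diff_def inner_add_left inner_scale_left)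

lemma inner_diff_right:
  "u \<in> L2 M \<Longrightarrow> v \<in> L2 M \<Longrightarrow> w \<in> L2 M \<Longrightarrow>
    l2_inner M w (l2_diff M u v) = l2_inner M w u - l2_inner M w v"
  by (simp add: l2_diff_def inner_add_right inner_scale_right)

lemma rep_diff:
  assumes "u \<in> L2 M" "v \<in> L2 M"
  shows "AE x in M. l2_rep (l2_diff M u v) x = l2_rep u x - l2_rep v x"
  using rep_add[OF assms(1) scale_L2[OF assms(2)], of "-1"] rep_scale[OF assms(2), of "-1"]
  unfolding l2_diff_def by eventually_elim simp

lemma norm_diff_zero_imp_eq:
  assumes "u \<in> L2 M" "v \<in> L2 M" "l2_norm M (l2_diff M u v) = 0"
  shows "u = v"
proof (rule L2_eqI[OF assms(1,2)])
  have "AE x in M. l2_rep (l2_diff M u v) x = 0"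
    using assms norm_zero_iff[of "l2_diff M u v" M] by simp
  then show "AE x in M. l2_rep u x = l2_rep v x"
    using rep_diff[OF assms(1,2)] by eventually_elim simp
qed

lemma norm_diff_commute:
  assumes "u \<in> L2 M" "v \<in> L2 M"
  shows "l2_norm M (l2_diff M u v) = l2_norm M (l2_diff M v u)"
proof -
  have "(l2_norm M (l2_diff M u v))\<^sup>2 = (l2_norm M (l2_diff M v u))\<^sup>2"
    by (simp add: norm_sq inner_diff_left inner_diff_right assms)
  then show ?thesis by (simp add: power2_eq_iff_nonneg)
qed

lemma norm_diff_triangle:
  assumes "u \<in> L2 M" "v \<in> L2 M" "w \<in> L2 M"
  shows "l2_norm M (l2_diff M u w) \<le> l2_norm M (l2_diff M u v) + l2_norm M (l2_diff M v w)"
proof -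
  have "l2_diff M u w = l2_add M (l2_diff M u v) (l2_diff M v w)"
  proof (rule L2_eqI)
    show "AE x in M. l2_rep (l2_diff M u w) x = l2_rep (l2_add M (l2_diff M u v) (l2_diff M v w)) x"
      using rep_diff[OF assms(1,3)] rep_add[OF diff_L2[OF assms(1,2)] diff_L2[OF assms(2,3)]]
        rep_diff[OF assms(1,2)] rep_diff[OF assms(2,3)]
      by eventually_elim simp
  qed (use assms in auto)
  then show ?thesis using norm_triangle[of "l2_diff M u v" M "l2_diff M v w"] assms by simp
qed

lemma norm_le_diff:
  assumes "u \<in> L2 M" "v \<in> L2 M"
  shows "l2_norm M u \<le> l2_norm M (l2_diff M u v) + l2_norm M v"
proof -
  have "u = l2_add M (l2_diff M u v) v"
  proof (rule L2_eqI)
    show "AE x in M. l2_rep u x = l2_rep (l2_add M (l2_diff M u v) v) x"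
      using rep_diff[OF assms] rep_add[OF diff_L2[OF assms] assms(2)] by eventually_elim simp
  qed (use assms in auto)
  then show ?thesis using norm_triangle[of "l2_diff M u v" M v] assms by simp
qed

text \<open>The hypotheses say that \<open>p - q\<close> is orthogonal to \<open>p\<close> and to \<open>q\<close>, hence to itself.\<close>

lemma eq_if_inner_eq:
  assumes "p \<in> L2 M" "q \<in> L2 M" "l2_inner M p p = l2_inner M p q" "l2_inner M q p = l2_inner M q q"
  shows "p = q"
proof (rule norm_diff_zero_imp_eq[OF assms(1,2)])
  have "(l2_norm M (l2_diff M p q))\<^sup>2 = 0"
    using assms by (simp add: norm_sq inner_diff_left inner_diff_right)
  then show "l2_norm M (l2_diff M p q) = 0" by simp
qed

lemma eqI_inner:
  assumes "p \<in> L2 M" "q \<in> L2 M" "\<And>w. w \<in> L2 M \<Longrightarrow> l2_inner M p w = l2_inner M q w"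
  shows "p = q"
proof (rule eq_if_inner_eq[OF assms(1,2)])
  show "l2_inner M p p = l2_inner M p q"
    using assms(3)[OF assms(1)] assms(3)[OF assms(2)] by (metis inner_cnj)
  show "l2_inner M q p = l2_inner M q q"
    using assms(3)[OF assms(1)] assms(3)[OF assms(2)] by (metis inner_cnj)
qed

lemma mult_op_inner:
  assumes "\<phi> \<in> ess_bounded M" "u \<in> L2 M" "v \<in> L2 M"
  shows "l2_inner M (mult_op M \<phi> u) v = (\<integral>x. \<phi> x * l2_rep u x * cnj (l2_rep v x) \<partial>M)"
    "l2_inner M (mult_op M \<phi> u) v = l2_inner M u (mult_op M (\<lambda>x. cnj (\<phi> x)) v)"
    "integrable M (\<lambda>x. \<phi> x * l2_rep u x * cnj (l2_rep v x))"
proof -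
  have \<phi>: "\<phi> \<in> borel_measurable M" "(\<lambda>x. cnj (\<phi> x)) \<in> borel_measurable M"
    using assms(1) ess_bounded_cnj[OF assms(1)] by (auto simp: ess_bounded_def)
  show i: "integrable M (\<lambda>x. \<phi> x * l2_rep u x * cnj (l2_rep v x))"
    by (intro integrable_mult_cnj sq_integrable_mult rep_sq_integrable assms)
  show 1: "l2_inner M (mult_op M \<phi> u) v = (\<integral>x. \<phi> x * l2_rep u x * cnj (l2_rep v x) \<partial>M)"
    using rep_mult_op[OF \<phi>(1) assms(2)] by (intro inner_cong i) (auto simp: assms elim!: AE_mp)
  have "l2_inner M u (mult_op M (\<lambda>x. cnj (\<phi> x)) v) = (\<integral>x. \<phi> x * l2_rep u x * cnj (l2_rep v x) \<partial>M)"
    using rep_mult_op[OF \<phi>(2) assms(3)]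
    by (intro inner_cong i) (auto simp: assms ess_bounded_cnj elim!: AE_mp)
  then show "l2_inner M (mult_op M \<phi> u) v = l2_inner M u (mult_op M (\<lambda>x. cnj (\<phi> x)) v)"
    using 1 by simp
qed

lemma inner_zero_AE:
  assumes "u \<in> L2 M" "v \<in> L2 M" "AE x in M. l2_rep u x = 0 \<or> l2_rep v x = 0"
  shows "l2_inner M u v = 0"
proof -
  have "l2_inner M u v = (\<integral>x. 0 \<partial>M)"
    using assms(3) by (intro inner_cong assms) (auto elim!: AE_mp)
  then show ?thesis by simp
qed

section \<open>Completeness and the Riesz representation theorem\<close>

lemma positive_sq_integrable:
  assumes "sigma_finite_measure M"
  obtains w :: "'a \<Rightarrow> real" where "w \<in> borel_measurable M" "\<And>x. 0 < w x"
    "(\<lambda>x. complex_of_real (w x)) \<in> sq_integrable M"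
proof -
  interpret sigma_finite_measure M by fact
  obtain f :: "'a \<Rightarrow> real" where f [measurable]: "f \<in> borel_measurable M"
    and pos: "\<And>x. f x > 0" and le: "\<And>x. f x \<le> 1" and int: "integrable M f"
    using obtain_positive_integrable_function by blast
  have "(f x)\<^sup>2 \<le> f x" for x
    using mult_left_mono[OF le[of x], of "f x"] pos[of x] by (simp add: power2_eq_square)
  then have "integrable M (\<lambda>x. (f x)\<^sup>2)"
    using pos by (intro Bochner_Integration.integrable_bound[OF int]) (auto simp: less_imp_le)
  then have "(\<lambda>x. complex_of_real (f x)) \<in> sq_integrable M"
    by (simp add: sq_integrable_def)
  with f pos show thesis by (rule that)
qed

lemma L1_weight_le:
  assumes "d \<in> L2 M" "(\<lambda>x. complex_of_real (w x)) \<in> sq_integrable M" "\<And>x. 0 < w x"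
  shows "(\<integral>x. cmod (l2_rep d x) * w x \<partial>M)
    \<le> l2_norm M d * l2_norm M (ae_class M (\<lambda>x. complex_of_real (w x)))"
proof -
  let ?W = "ae_class M (\<lambda>x. complex_of_real (w x))"
  define a where "a = (\<lambda>x. complex_of_real (cmod (l2_rep d x)))"
  have am: "a \<in> borel_measurable M"
    using rep_measurable[OF assms(1)] unfolding a_def by measurable
  have a: "a \<in> sq_integrable M"
    by (rule sq_integrable_dominated[OF rep_sq_integrable[OF assms(1)] am, of 1]) (simp add: a_def)
  have wm: "(\<lambda>x. complex_of_real (w x)) \<in> borel_measurable M"
    using assms(2) by (rule sq_integrable_measurable)
  have nm: "l2_norm M (ae_class M a) = l2_norm M d"
  proof -
    have "(\<integral>x. (cmod (l2_rep (ae_class M a) x))\<^sup>2 \<partial>M) = (\<integral>x. (cmod (l2_rep d x))\<^sup>2 \<partial>M)"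
      using rep_ae_class[OF am] rep_measurable[OF assms(1)]
      by (intro integral_cong_AE) (auto simp: a_def elim!: AE_mp)
    then show ?thesis by (simp add: l2_norm_def)
  qed
  have "l2_inner M (ae_class M a) ?W = (\<integral>x. a x * cnj (complex_of_real (w x)) \<partial>M)"
  proof (intro inner_cong integrable_mult_cnj ae_class_L2 a assms)
    show "AE x in M. l2_rep (ae_class M a) x * cnj (l2_rep ?W x) = a x * cnj (complex_of_real (w x))"
      using rep_ae_class(2)[OF am] rep_ae_class(2)[OF wm] by eventually_elim simp
  qed
  also have "\<dots> = complex_of_real (\<integral>x. cmod (l2_rep d x) * w x \<partial>M)"
    by (simp add: a_def flip: integral_complex_of_real)
  finally have "(\<integral>x. cmod (l2_rep d x) * w x \<partial>M) = Re (l2_inner M (ae_class M a) ?W)"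
    by simp
  also have "\<dots> \<le> cmod (l2_inner M (ae_class M a) ?W)" by (rule complex_Re_le_cmod)
  also have "\<dots> \<le> l2_norm M d * l2_norm M ?W"
    using cauchy_schwarz[OF ae_class_L2[OF a] ae_class_L2[OF assms(2)]] by (simp add: nm)
  finally show ?thesis .
qed

lemma nn_integral_norm_diff:
  assumes "u \<in> L2 M" "v \<in> L2 M"
  shows "(\<integral>\<^sup>+x. ennreal ((cmod (l2_rep u x - l2_rep v x))\<^sup>2) \<partial>M)
    = ennreal ((l2_norm M (l2_diff M u v))\<^sup>2)"
proof -
  have "(\<integral>\<^sup>+x. ennreal ((cmod (l2_rep u x - l2_rep v x))\<^sup>2) \<partial>M)
      = (\<integral>\<^sup>+x. ennreal ((cmod (l2_rep (l2_diff M u v) x))\<^sup>2) \<partial>M)"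
    using rep_diff[OF assms] by (intro nn_integral_cong_AE) (auto elim!: AE_mp)
  also have "\<dots> = ennreal (\<integral>x. (cmod (l2_rep (l2_diff M u v) x))\<^sup>2 \<partial>M)"
    using rep_sq_integrable[OF diff_L2[OF assms]]
    by (intro nn_integral_eq_integral) (auto simp: sq_integrable_def)
  finally show ?thesis by (simp add: l2_norm_def)
qed

text \<open>Multiplying by a positive square integrable weight turns a Cauchy sequence in \<open>L2\<close> into
  one in \<open>L1\<close>, so that a subsequence converges almost everywhere; Fatou's lemma shows that the
  pointwise limit is also the limit in \<open>L2\<close>.\<close>

lemma L2_complete:
  assumes sf: "sigma_finite_measure M" and u: "\<And>n. u n \<in> L2 M"
    and cauchy: "\<And>e. 0 < e \<Longrightarrow> \<exists>K. \<forall>m\<ge>K. \<forall>n\<ge>K. l2_norm M (l2_diff M (u m) (u n)) < e"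
  shows "\<exists>p\<in>L2 M. (\<lambda>n. l2_norm M (l2_diff M (u n) p)) \<longlonglongrightarrow> 0"
proof -
  obtain w :: "'a \<Rightarrow> real" where wm [measurable]: "w \<in> borel_measurable M"
    and wpos: "\<And>x. 0 < w x" and wsq: "(\<lambda>x. complex_of_real (w x)) \<in> sq_integrable M"
    using positive_sq_integrable[OF sf] by blast
  define W where "W = ae_class M (\<lambda>x. complex_of_real (w x))"
  define f where "f = (\<lambda>n. l2_rep (u n))"
  have fm [measurable]: "f n \<in> borel_measurable M" for n
    unfolding f_def using u by (rule rep_measurable)
  define s where "s = (\<lambda>n x. f n x * complex_of_real (w x))"
  have s_int: "integrable M (s n)" for n
    using integrable_mult_cnj[OF rep_sq_integrable[OF u] wsq, of n] by (simp add: s_def f_def)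
  have s_le: "(\<integral>x. norm (s i x - s j x) \<partial>M) \<le> l2_norm M (l2_diff M (u i) (u j)) * l2_norm M W" for i j
  proof -
    have "(\<integral>x. norm (s i x - s j x) \<partial>M) = (\<integral>x. cmod (l2_rep (l2_diff M (u i) (u j)) x) * w x \<partial>M)"
    proof (rule integral_cong_AE)
      show "AE x in M. norm (s i x - s j x) = cmod (l2_rep (l2_diff M (u i) (u j)) x) * w x"
        using rep_diff[OF u[of i] u[of j]]
      proof eventually_elim
        case (elim x)
        have "s i x - s j x = (f i x - f j x) * complex_of_real (w x)"
          by (simp add: s_def left_diff_distrib)
        then show ?case using wpos[of x] by (simp add: elim f_def norm_mult)
      qed
    qed (use rep_measurable[OF diff_L2[OF u[of i] u[of j]]] in \<open>auto simp: s_def\<close>)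
    also have "\<dots> \<le> l2_norm M (l2_diff M (u i) (u j)) * l2_norm M W"
      unfolding W_def by (rule L1_weight_le[OF _ wsq wpos]) (simp add: u)
    finally show ?thesis .
  qed
  have s_cauchy: "\<exists>K. \<forall>i\<ge>K. \<forall>j\<ge>K. (\<integral>x. norm (s i x - s j x) \<partial>M) < e" if e: "e > 0" for e
  proof -
    have pos: "0 < l2_norm M W + 1" using norm_nonneg[of M W] by linarith
    obtain K where K: "\<forall>m\<ge>K. \<forall>n\<ge>K. l2_norm M (l2_diff M (u m) (u n)) < e / (l2_norm M W + 1)"
      using cauchy[OF divide_pos_pos[OF e pos]] by blast
    have "(\<integral>x. norm (s i x - s j x) \<partial>M) < e" if ij: "i \<ge> K" "j \<ge> K" for i j
    proof -
      have "(\<integral>x. norm (s i x - s j x) \<partial>M) \<le> l2_norm M (l2_diff M (u i) (u j)) * (l2_norm M W + 1)"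
        using s_le[of i j] by (rule order_trans) (simp add: mult_left_mono)
      also have "\<dots> < e" using K ij pos by (simp add: pos_less_divide_eq)
      finally show ?thesis .
    qed
    then show ?thesis by blast
  qed
  obtain r where r: "strict_mono r" and rC: "AE x in M. Cauchy (\<lambda>i. s (r i) x)"
    using cauchy_L1_AE_cauchy_subseq[OF s_int s_cauchy] by blast
  define p where "p = (\<lambda>x. lim (\<lambda>i. f (r i) x))"
  have pm [measurable]: "p \<in> borel_measurable M" unfolding p_def by measurable
  have conv: "AE x in M. (\<lambda>i. f (r i) x) \<longlonglongrightarrow> p x"
    using rC
  proof eventually_elim
    case (elim x)
    then obtain l where "(\<lambda>i. s (r i) x) \<longlonglongrightarrow> l" by (auto simp: Cauchy_convergent_iff convergent_def)
    then have "(\<lambda>i. s (r i) x / complex_of_real (w x)) \<longlonglongrightarrow> l / complex_of_real (w x)"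
      using wpos[of x] by (intro tendsto_divide) auto
    moreover have "s n x / complex_of_real (w x) = f n x" for n
      using wpos[of x] by (simp add: s_def)
    ultimately show ?case unfolding p_def by (simp add: convergent_LIMSEQ_iff[symmetric] convergentI)
  qed
  have fatou: "(\<integral>\<^sup>+x. ennreal ((cmod (f n x - p x))\<^sup>2) \<partial>M) \<le> ennreal (e\<^sup>2)"
    if e: "0 < e" and K: "\<And>m. m \<ge> K \<Longrightarrow> l2_norm M (l2_diff M (u n) (u m)) < e" for n K e
  proof -
    have "(\<integral>\<^sup>+x. ennreal ((cmod (f n x - p x))\<^sup>2) \<partial>M)
        = (\<integral>\<^sup>+x. liminf (\<lambda>i. ennreal ((cmod (f n x - f (r i) x))\<^sup>2)) \<partial>M)"
    proof (rule nn_integral_cong_AE)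
      show "AE x in M. ennreal ((cmod (f n x - p x))\<^sup>2)
          = liminf (\<lambda>i. ennreal ((cmod (f n x - f (r i) x))\<^sup>2))"
        using conv
      proof eventually_elim
        case (elim x)
        then have "(\<lambda>i. ennreal ((cmod (f n x - f (r i) x))\<^sup>2)) \<longlonglongrightarrow> ennreal ((cmod (f n x - p x))\<^sup>2)"
          by (intro tendsto_intros)
        from lim_imp_Liminf[OF sequentially_bot this] show ?case by (rule sym)
      qed
    qed
    also have "\<dots> \<le> liminf (\<lambda>i. \<integral>\<^sup>+x. ennreal ((cmod (f n x - f (r i) x))\<^sup>2) \<partial>M)"
      by (rule nn_integral_liminf) measurable
    also have "\<dots> \<le> ennreal (e\<^sup>2)"
    proof (rule order_trans[OF Liminf_mono])
      have "r i \<ge> K" if "i \<ge> K" for i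
        using seq_suble[OF r, of i] that by linarith
      then show "\<forall>\<^sub>F i in sequentially. (\<integral>\<^sup>+x. ennreal ((cmod (f n x - f (r i) x))\<^sup>2) \<partial>M) \<le> ennreal (e\<^sup>2)"
        unfolding f_def nn_integral_norm_diff[OF u u]
        by (intro eventually_sequentiallyI[of K] ennreal_leI power_mono less_imp_le[OF K]) auto
    qed (simp add: Liminf_const)
    finally show ?thesis .
  qed
  obtain K0 where "\<forall>m\<ge>K0. \<forall>n\<ge>K0. l2_norm M (l2_diff M (u m) (u n)) < 1"
    using cauchy[of 1] by auto
  then have "(\<integral>\<^sup>+x. ennreal ((cmod (f K0 x - p x))\<^sup>2) \<partial>M) \<le> ennreal (1\<^sup>2)"
    by (intro fatou[of 1 K0 K0]) auto
  then have "integrable M (\<lambda>x. (cmod (f K0 x - p x))\<^sup>2)"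
    by (intro integrableI_bounded) (auto elim: order_le_less_trans)
  then have "(\<lambda>x. - (f K0 x - p x)) \<in> sq_integrable M"
    by (simp add: sq_integrable_def norm_minus_commute)
  from sq_integrable_add[OF this rep_sq_integrable[OF u[of K0]]]
  have psq: "p \<in> sq_integrable M" by (simp add: f_def)
  define P where "P = ae_class M p"
  have P: "P \<in> L2 M" unfolding P_def using psq by (rule ae_class_L2)
  have nd: "ennreal ((l2_norm M (l2_diff M (u n) P))\<^sup>2) = (\<integral>\<^sup>+x. ennreal ((cmod (f n x - p x))\<^sup>2) \<partial>M)" for n
  proof -
    have "AE x in M. l2_rep P x = p x" unfolding P_def using pm by (rule rep_ae_class)
    then show ?thesis
      unfolding nn_integral_norm_diff[OF u P, symmetric]
      by (intro nn_integral_cong_AE) (auto simp: f_def elim!: AE_mp)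
  qed
  have "(\<lambda>n. l2_norm M (l2_diff M (u n) P)) \<longlonglongrightarrow> 0"
  proof (rule LIMSEQ_I)
    fix e :: real assume e: "0 < e"
    obtain K where K: "\<forall>m\<ge>K. \<forall>n\<ge>K. l2_norm M (l2_diff M (u m) (u n)) < e / 2"
      using cauchy[of "e / 2"] e by auto
    have "l2_norm M (l2_diff M (u n) P) \<le> e / 2" if "n \<ge> K" for n
    proof -
      have "ennreal ((l2_norm M (l2_diff M (u n) P))\<^sup>2) \<le> ennreal ((e / 2)\<^sup>2)"
        unfolding nd using K that e by (intro fatou[of _ K]) auto
      then have "(l2_norm M (l2_diff M (u n) P))\<^sup>2 \<le> (e / 2)\<^sup>2" by simp
      then show ?thesis by (rule power2_le_imp_le) (use e in simp)
    qed
    then show "\<exists>K. \<forall>n\<ge>K. norm (l2_norm M (l2_diff M (u n) P) - 0) < e"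
      using e by (intro exI[of _ K]) force
  qed
  with P show ?thesis by blast
qed

definition l2_subspace :: "'a measure \<Rightarrow> 'a l2vec set \<Rightarrow> bool" where
  "l2_subspace M Z \<longleftrightarrow> Z \<subseteq> L2 M \<and> Z \<noteq> {} \<and> (\<forall>u\<in>Z. \<forall>v\<in>Z. l2_add M u v \<in> Z) \<and>
     (\<forall>c. \<forall>u\<in>Z. l2_scale M c u \<in> Z)"

lemma l2_subspace_L2: "l2_subspace M (L2 M)"
proof -
  have "L2 M \<noteq> {}" by (metis empty_iff zero_L2)
  then show ?thesis by (simp add: l2_subspace_def)
qed

text \<open>The quadratic functional \<open>\<parallel>z\<parallel>\<^sup>2 - 2 Re (l z)\<close> is bounded below on a subspace, and by the
  parallelogram law its minimising sequences are Cauchy. Their limit represents the functional \<open>l\<close>,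
  and it lies in the closure of the subspace because the minimising vectors are taken there.\<close>

lemma riesz_on_subspace:
  assumes sf: "sigma_finite_measure M" and Z: "l2_subspace M Z"
    and l_add: "\<And>u v. u \<in> Z \<Longrightarrow> v \<in> Z \<Longrightarrow> l (l2_add M u v) = l u + l v"
    and l_scale: "\<And>c u. u \<in> Z \<Longrightarrow> l (l2_scale M c u) = c * l u"
    and bound: "\<And>u. u \<in> Z \<Longrightarrow> cmod (l u) \<le> K * l2_norm M u"
  obtains p where "p \<in> L2 M" "\<And>e. 0 < e \<Longrightarrow> \<exists>z\<in>Z. l2_norm M (l2_diff M p z) < e"
    "\<And>z. z \<in> Z \<Longrightarrow> l z = l2_inner M z p"
proof -
  have ZL: "z \<in> L2 M" if "z \<in> Z" for z using Z that by (auto simp: l2_subspace_def)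
  have Z_add: "l2_add M u v \<in> Z" if "u \<in> Z" "v \<in> Z" for u v
    using Z that by (auto simp: l2_subspace_def)
  have Z_scale: "l2_scale M c u \<in> Z" if "u \<in> Z" for c u
    using Z that by (auto simp: l2_subspace_def)
  define J where "J z = (l2_norm M z)\<^sup>2 - 2 * Re (l z)" for z
  have J_lower: "- (K\<^sup>2) \<le> J z" if "z \<in> Z" for z
  proof -
    have "Re (l z) \<le> K * l2_norm M z" using bound[OF that] complex_Re_le_cmod order_trans by blast
    moreover have "0 \<le> (l2_norm M z - K)\<^sup>2" by simp
    ultimately show ?thesis unfolding J_def by (simp add: power2_diff algebra_simps)
  qed
  define d where "d = Inf (J ` Z)"
  have bdd: "bdd_below (J ` Z)" using J_lower by (auto simp: bdd_below_def)
  have d_le: "d \<le> J z" if "z \<in> Z" for z unfolding d_def using bdd that by (auto intro: cInf_lower)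
  have "\<exists>z\<in>Z. J z < d + 1 / Suc n" for n
  proof -
    have "J ` Z \<noteq> {}" using Z by (auto simp: l2_subspace_def)
    then have "\<exists>y\<in>J ` Z. y < d + 1 / Suc n"
      using bdd unfolding d_def by (intro cInf_lessD) auto
    then show ?thesis by blast
  qed
  then obtain z where z: "\<And>n. z n \<in> Z" and J_less: "\<And>n. J (z n) < d + 1 / Suc n" by metis
  have parallelogram: "(l2_norm M (l2_diff M u v))\<^sup>2 \<le> 2 * (J u - d) + 2 * (J v - d)"
    if u: "u \<in> Z" and v: "v \<in> Z" for u v
  proof -
    let ?m = "l2_scale M (1/2) (l2_add M u v)"
    have "Re (l ?m) = (Re (l u) + Re (l v)) / 2" by (simp add: l_scale l_add Z_add u v)
    moreover have "l2_norm M ?m = l2_norm M (l2_add M u v) / 2" by (simp add: norm_scale ZL u v)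
    ultimately have "4 * J ?m = (l2_norm M (l2_add M u v))\<^sup>2 - 4 * (Re (l u) + Re (l v))"
      by (simp only: J_def power_divide) (simp add: add_divide_distrib)
    moreover have "(l2_norm M (l2_add M u v))\<^sup>2 + (l2_norm M (l2_diff M u v))\<^sup>2
        = 2 * (l2_norm M u)\<^sup>2 + 2 * (l2_norm M v)\<^sup>2"
      using ZL[OF u] ZL[OF v]
      by (simp add: norm_sq inner_add_left inner_add_right inner_diff_left inner_diff_right)
    moreover have "d \<le> J ?m" by (intro d_le Z_scale Z_add u v)
    ultimately show ?thesis by (simp add: J_def)
  qed
  have z_cauchy: "\<exists>k. \<forall>m\<ge>k. \<forall>n\<ge>k. l2_norm M (l2_diff M (z m) (z n)) < e" if e: "0 < e" for e
  proof -
    obtain k :: nat where k: "4 / e\<^sup>2 < k" using reals_Archimedean2 by blast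
    then have k0: "0 < real k" using e by (meson divide_nonneg_nonneg order_le_less_trans zero_le_numeral zero_le_power2)
    have "l2_norm M (l2_diff M (z m) (z n)) < e" if mn: "m \<ge> k" "n \<ge> k" for m n
    proof (rule power2_less_imp_less)
      have small: "J (z i) - d < 1 / k" if "i \<ge> k" for i
      proof -
        have "1 / real (Suc i) \<le> 1 / k" using that k0 by (intro divide_left_mono) auto
        then show ?thesis using J_less[of i] by linarith
      qed
      define q where "q = 1 / real k"
      have "(l2_norm M (l2_diff M (z m) (z n)))\<^sup>2 < 4 * q"
      proof -
        have "2 * (J (z m) - d) + 2 * (J (z n) - d) < 2 * q + 2 * q"
          using small[OF mn(1)] small[OF mn(2)] unfolding q_def
          by (intro add_strict_mono mult_strict_left_mono) auto
        with parallelogram[OF z[of m] z[of n]] show ?thesis by simp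
      qed
      also have "\<dots> < e\<^sup>2" using k e k0 by (simp add: q_def pos_divide_less_eq mult.commute)
      finally show "(l2_norm M (l2_diff M (z m) (z n)))\<^sup>2 < e\<^sup>2" .
    qed (use e in simp)
    then show ?thesis by blast
  qed
  obtain p where p: "p \<in> L2 M" and lim: "(\<lambda>n. l2_norm M (l2_diff M (z n) p)) \<longlonglongrightarrow> 0"
    using L2_complete[of M z, OF sf ZL[OF z] z_cauchy] by blast
  show thesis
  proof (rule that[OF p])
    fix e :: real assume "0 < e"
    then have "\<forall>\<^sub>F n in sequentially. l2_norm M (l2_diff M (z n) p) < e"
      using order_tendstoD(2)[OF lim] by blast
    then obtain n where "l2_norm M (l2_diff M (z n) p) < e"
      by (auto simp: eventually_sequentially)
    then show "\<exists>z\<in>Z. l2_norm M (l2_diff M p z) < e"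
      using z[of n] norm_diff_commute[OF p ZL[OF z[of n]]] by (metis (no_types))
  next
    fix v assume v: "v \<in> Z"
    have conv: "(\<lambda>n. l2_inner M v (z n)) \<longlonglongrightarrow> l2_inner M v p"
    proof -
      have "(\<lambda>n. l2_inner M v (z n) - l2_inner M v p) \<longlonglongrightarrow> 0"
      proof (rule Lim_null_comparison)
        show "\<forall>\<^sub>F n in sequentially. norm (l2_inner M v (z n) - l2_inner M v p)
            \<le> l2_norm M v * l2_norm M (l2_diff M (z n) p)"
        proof (intro always_eventually allI)
          fix n
          show "norm (l2_inner M v (z n) - l2_inner M v p) \<le> l2_norm M v * l2_norm M (l2_diff M (z n) p)"
            using cauchy_schwarz[OF ZL[OF v] diff_L2[OF ZL[OF z[of n]] p]]
            by (simp add: inner_diff_right ZL z p v)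
        qed
        show "(\<lambda>n. l2_norm M v * l2_norm M (l2_diff M (z n) p)) \<longlonglongrightarrow> 0"
          using tendsto_mult_right_zero[OF lim] by simp
      qed
      then show ?thesis by (simp add: LIM_zero_iff)
    qed
    define r where "r = l v - l2_inner M v p"
    \<comment> \<open>Minimality of the \<open>z n\<close> against the perturbations \<open>z n + c v\<close>, in the limit.\<close>
    have variation: "2 * Re (c * r) \<le> (cmod c)\<^sup>2 * (l2_norm M v)\<^sup>2" for c
    proof -
      have le: "2 * Re (c * (l v - l2_inner M v (z n))) \<le> (cmod c)\<^sup>2 * (l2_norm M v)\<^sup>2 + 1 / Suc n" for n
      proof -
        have "d \<le> J (l2_add M (z n) (l2_scale M c v))" by (intro d_le Z_add Z_scale z v)
        also have "\<dots> = J (z n) + (cmod c)\<^sup>2 * (l2_norm M v)\<^sup>2 + 2 * Re (l2_inner M (z n) (l2_scale M c v))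
            - 2 * Re (c * l v)"
          by (simp add: J_def norm_add_sq ZL z v l_add l_scale Z_scale norm_scale power_mult_distrib)
        also have "Re (l2_inner M (z n) (l2_scale M c v)) = Re (c * l2_inner M v (z n))"
        proof -
          have "cnj (c * l2_inner M v (z n)) = l2_inner M (z n) (l2_scale M c v)"
            by (simp add: inner_scale_right ZL z v inner_cnj)
          from arg_cong[OF this, of Re] show ?thesis by simp
        qed
        finally show ?thesis using J_less[of n] by (simp add: right_diff_distrib)
      qed
      have "(\<lambda>n. 2 * Re (c * (l v - l2_inner M v (z n)))) \<longlonglongrightarrow> 2 * Re (c * r)"
        unfolding r_def by (intro tendsto_intros conv)
      then have "2 * Re (c * r) \<le> (cmod c)\<^sup>2 * (l2_norm M v)\<^sup>2 + 0"
      proof (rule LIMSEQ_le)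
        show "(\<lambda>n. (cmod c)\<^sup>2 * (l2_norm M v)\<^sup>2 + 1 / Suc n) \<longlonglongrightarrow> (cmod c)\<^sup>2 * (l2_norm M v)\<^sup>2 + 0"
          by (intro tendsto_add tendsto_const LIMSEQ_Suc[OF lim_1_over_n])
      qed (use le in blast)
      then show ?thesis by simp
    qed
    have "r = 0"
    proof (rule ccontr)
      assume r0: "r \<noteq> 0"
      \<comment> \<open>For \<open>c = t cnj r\<close> the left side is linear and the right side quadratic in \<open>t\<close>, so a small \<open>t\<close> suffices.\<close>
      define t where "t = 1 / ((l2_norm M v)\<^sup>2 + 1)"
      have t: "0 < t" "t * (l2_norm M v)\<^sup>2 < 1"
      proof -
        have "0 < (l2_norm M v)\<^sup>2 + 1" using zero_le_power2[of "l2_norm M v"] by linarith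
        then show "0 < t" "t * (l2_norm M v)\<^sup>2 < 1" by (simp_all add: t_def)
      qed
      have "Re (complex_of_real t * cnj r * r) = t * (cmod r)\<^sup>2"
      proof -
        have "complex_of_real t * cnj r * r = complex_of_real (t * (cmod r)\<^sup>2)"
          by (simp only: of_real_mult complex_norm_square mult_ac)
        then show ?thesis by (simp only: Re_complex_of_real)
      qed
      then have "2 * (t * (cmod r)\<^sup>2) \<le> (t * cmod r)\<^sup>2 * (l2_norm M v)\<^sup>2"
        using variation[of "complex_of_real t * cnj r"] t by (simp add: norm_mult)
      then have "(t * (cmod r)\<^sup>2) * 2 \<le> (t * (cmod r)\<^sup>2) * (t * (l2_norm M v)\<^sup>2)"
        by (simp add: power2_eq_square algebra_simps)
      then have "2 \<le> t * (l2_norm M v)\<^sup>2" using t r0 by (subst (asm) mult_le_cancel_left_pos) auto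
      then show False using t by linarith
    qed
    then show "l v = l2_inner M v p" by (simp add: r_def)
  qed
qed

text \<open>Let \<open>p\<close> represent the functional \<open>\<langle>\<cdot>, t\<rangle>\<close> on \<open>Z\<close>. Then \<open>t - p\<close> is orthogonal to \<open>Z\<close>, so by assumption to \<open>t\<close>,
  and also to the limit \<open>p\<close> of vectors of \<open>Z\<close>; therefore \<open>t = p\<close> is such a limit itself. The assumption \<open>perp\<close>
  avoids speaking of closures: it holds for all \<open>t\<close> when the orthogonal complement of \<open>Z\<close> is zero.\<close>

lemma approximable_by_subspace:
  assumes sf: "sigma_finite_measure M" and Z: "l2_subspace M Z" and t: "t \<in> L2 M"
    and perp: "\<And>v. v \<in> L2 M \<Longrightarrow> (\<And>z. z \<in> Z \<Longrightarrow> l2_inner M z v = 0) \<Longrightarrow> l2_inner M t v = 0"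
    and e: "0 < e"
  shows "\<exists>z\<in>Z. l2_norm M (l2_diff M t z) < e"
proof -
  have ZL: "z \<in> L2 M" if "z \<in> Z" for z using Z that by (auto simp: l2_subspace_def)
  obtain p where p: "p \<in> L2 M" and close: "\<And>e. 0 < e \<Longrightarrow> \<exists>z\<in>Z. l2_norm M (l2_diff M p z) < e"
    and rep: "\<And>z. z \<in> Z \<Longrightarrow> l2_inner M z t = l2_inner M z p"
  proof (rule riesz_on_subspace[OF sf Z, of "\<lambda>z. l2_inner M z t" "l2_norm M t"])
    show "cmod (l2_inner M u t) \<le> l2_norm M t * l2_norm M u" if "u \<in> Z" for u
      using cauchy_schwarz[OF ZL[OF that] t] by (simp add: mult.commute)
  qed (auto simp: inner_add_left inner_scale_left ZL t)
  define v where "v = l2_diff M t p"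
  have v: "v \<in> L2 M" by (simp add: v_def t p)
  have zv: "l2_inner M z v = 0" if "z \<in> Z" for z
    using rep[OF that] by (simp add: v_def inner_diff_right ZL that t p)
  have tv: "l2_inner M t v = 0" using perp[OF v zv] by blast
  have pv: "l2_inner M p v = 0"
  proof (rule ccontr)
    assume nz: "l2_inner M p v \<noteq> 0"
    define \<delta> where "\<delta> = cmod (l2_inner M p v) / (l2_norm M v + 1)"
    have pos: "0 < l2_norm M v + 1" using norm_nonneg[of M v] by linarith
    then have "0 < \<delta>" using nz by (simp add: \<delta>_def)
    then obtain z where z: "z \<in> Z" "l2_norm M (l2_diff M p z) < \<delta>" using close by blast
    have "cmod (l2_inner M p v) = cmod (l2_inner M (l2_diff M p z) v)"
      using zv[OF z(1)] by (simp add: inner_diff_left p ZL z v)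
    also have "\<dots> \<le> l2_norm M (l2_diff M p z) * l2_norm M v"
      by (intro cauchy_schwarz diff_L2 p ZL z v)
    also have "\<dots> \<le> l2_norm M (l2_diff M p z) * (l2_norm M v + 1)"
      by (simp add: mult_left_mono)
    also have "\<dots> < \<delta> * (l2_norm M v + 1)" using z(2) pos by (rule mult_strict_right_mono)
    finally show False using pos by (simp add: \<delta>_def)
  qed
  have "l2_inner M v v = 0"
    using tv pv v unfolding v_def by (simp add: inner_diff_left t p)
  then have "l2_norm M v = 0" using norm_sq[of M v] by simp
  then have "t = p" unfolding v_def by (rule norm_diff_zero_imp_eq[OF t p])
  then show ?thesis using close[OF e] by simp
qed

section \<open>Bounded operators, adjoints and multiplication operators\<close>

lemma bounded_ops_L2: "T \<in> bounded_ops M N \<Longrightarrow> u \<in> L2 M \<Longrightarrow> T u \<in> L2 N"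
  by (auto simp: bounded_ops_def PiE_def)

lemma bounded_ops_add:
  "T \<in> bounded_ops M N \<Longrightarrow> u \<in> L2 M \<Longrightarrow> v \<in> L2 M \<Longrightarrow> T (l2_add M u v) = l2_add N (T u) (T v)"
  by (auto simp: bounded_ops_def)

lemma bounded_ops_scale:
  "T \<in> bounded_ops M N \<Longrightarrow> u \<in> L2 M \<Longrightarrow> T (l2_scale M c u) = l2_scale N c (T u)"
  by (auto simp: bounded_ops_def)

lemma bounded_ops_diff:
  "T \<in> bounded_ops M N \<Longrightarrow> u \<in> L2 M \<Longrightarrow> v \<in> L2 M \<Longrightarrow> T (l2_diff M u v) = l2_diff N (T u) (T v)"
  by (simp add: l2_diff_def bounded_ops_add bounded_ops_scale)

lemma bounded_ops_bound:
  assumes "T \<in> bounded_ops M N"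
  obtains C where "0 \<le> C" "\<And>u. u \<in> L2 M \<Longrightarrow> l2_norm N (T u) \<le> C * l2_norm M u"
proof -
  obtain C where C: "\<And>u. u \<in> L2 M \<Longrightarrow> l2_norm N (T u) \<le> C * l2_norm M u"
    using assms unfolding bounded_ops_def by blast
  have "l2_norm N (T u) \<le> max 0 C * l2_norm M u" if "u \<in> L2 M" for u
    using C[OF that] by (rule order_trans) (simp add: mult_right_mono)
  then show thesis by (intro that[of "max 0 C"]) auto
qed

lemma bounded_ops_ext:
  assumes "S \<in> bounded_ops M N" "T \<in> bounded_ops M N" "\<And>u. u \<in> L2 M \<Longrightarrow> S u = T u"
  shows "S = T"
  using assms by (intro PiE_ext[of S "L2 M" "\<lambda>_. L2 N" T]) (auto simp: bounded_ops_def)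

lemma op_comp_apply: "u \<in> L2 M \<Longrightarrow> op_comp M S T u = S (T u)"
  by (simp add: op_comp_def compose_def)

lemma op_comp_bounded:
  assumes S: "S \<in> bounded_ops N K" and T: "T \<in> bounded_ops M N"
  shows "op_comp M S T \<in> bounded_ops M K"
proof -
  obtain C where C: "0 \<le> C" "\<And>u. u \<in> L2 N \<Longrightarrow> l2_norm K (S u) \<le> C * l2_norm N u"
    using bounded_ops_bound[OF S] by blast
  obtain D where D: "0 \<le> D" "\<And>u. u \<in> L2 M \<Longrightarrow> l2_norm N (T u) \<le> D * l2_norm M u"
    using bounded_ops_bound[OF T] by blast
  have "l2_norm K (S (T u)) \<le> (C * D) * l2_norm M u" if u: "u \<in> L2 M" for u
  proof -
    have "l2_norm K (S (T u)) \<le> C * l2_norm N (T u)" by (intro C bounded_ops_L2[OF T] u)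
    also have "\<dots> \<le> C * (D * l2_norm M u)" by (intro mult_left_mono D u C)
    finally show ?thesis by (simp add: mult.assoc)
  qed
  then show ?thesis
    unfolding bounded_ops_def op_comp_def compose_def
    by (auto simp: bounded_ops_L2[OF T] bounded_ops_L2[OF S] bounded_ops_add[OF T] bounded_ops_add[OF S]
        bounded_ops_scale[OF T] bounded_ops_scale[OF S])
qed

lemma op_add_bounded:
  assumes S: "S \<in> bounded_ops M N" and T: "T \<in> bounded_ops M N"
  shows "op_add M N S T \<in> bounded_ops M N"
proof -
  obtain C where C: "\<And>u. u \<in> L2 M \<Longrightarrow> l2_norm N (S u) \<le> C * l2_norm M u"
    using bounded_ops_bound[OF S] by blast
  obtain D where D: "\<And>u. u \<in> L2 M \<Longrightarrow> l2_norm N (T u) \<le> D * l2_norm M u"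
    using bounded_ops_bound[OF T] by blast
  have "l2_norm N (l2_add N (S u) (T u)) \<le> (C + D) * l2_norm M u" if u: "u \<in> L2 M" for u
    using norm_triangle[OF bounded_ops_L2[OF S u] bounded_ops_L2[OF T u]] C[OF u] D[OF u]
    by (simp add: distrib_right)
  moreover have "l2_add N (S (l2_add M u v)) (T (l2_add M u v))
      = l2_add N (l2_add N (S u) (T u)) (l2_add N (S v) (T v))" if "u \<in> L2 M" "v \<in> L2 M" for u v
    using that bounded_ops_L2[OF S] bounded_ops_L2[OF T]
    by (intro eqI_inner[of _ N]) (simp_all add: bounded_ops_add[OF S] bounded_ops_add[OF T] inner_add_left)
  moreover have "l2_add N (S (l2_scale M c u)) (T (l2_scale M c u))
      = l2_scale N c (l2_add N (S u) (T u))" if "u \<in> L2 M" for c u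
    using that bounded_ops_L2[OF S] bounded_ops_L2[OF T]
    by (intro eqI_inner[of _ N]) (simp_all add: bounded_ops_scale[OF S] bounded_ops_scale[OF T]
        inner_add_left inner_scale_left distrib_left)
  ultimately show ?thesis
    unfolding bounded_ops_def op_add_def
    by (auto simp: bounded_ops_L2[OF T] bounded_ops_L2[OF S])
qed

lemma norm_le_if_inner_self_eq:
  assumes "t \<in> L2 N" "v \<in> L2 N" "l2_inner M s s = l2_inner N t v"
    "l2_norm N t \<le> C * l2_norm M s" "0 \<le> C"
  shows "l2_norm M s \<le> C * l2_norm N v"
proof (cases "l2_norm M s = 0")
  case False
  have "(l2_norm M s)\<^sup>2 = cmod (l2_inner N t v)"
    by (simp add: assms(3)[symmetric] inner_self norm_power)
  also have "\<dots> \<le> l2_norm N t * l2_norm N v" by (intro cauchy_schwarz assms)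
  also have "\<dots> \<le> (C * l2_norm M s) * l2_norm N v" by (intro mult_right_mono assms) simp
  finally have "l2_norm M s * l2_norm M s \<le> l2_norm M s * (C * l2_norm N v)"
    by (simp add: power2_eq_square mult_ac)
  moreover have "0 < l2_norm M s" using False norm_nonneg[of M s] by linarith
  ultimately show ?thesis by (simp only: mult_le_cancel_left_pos)
qed (simp add: assms)

lemma adjoint_exists:
  assumes sf: "sigma_finite_measure M" and T: "T \<in> bounded_ops M N"
  shows "\<exists>S\<in>bounded_ops N M. \<forall>u\<in>L2 M. \<forall>v\<in>L2 N. l2_inner N (T u) v = l2_inner M u (S v)"
proof -
  obtain C where C: "0 \<le> C" "\<And>u. u \<in> L2 M \<Longrightarrow> l2_norm N (T u) \<le> C * l2_norm M u"
    using bounded_ops_bound[OF T] by blast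
  have "\<exists>p\<in>L2 M. \<forall>u\<in>L2 M. l2_inner N (T u) v = l2_inner M u p" if v: "v \<in> L2 N" for v
  proof (rule riesz_on_subspace[OF sf l2_subspace_L2, of "\<lambda>u. l2_inner N (T u) v" "C * l2_norm N v"])
    fix u assume u: "u \<in> L2 M"
    have "cmod (l2_inner N (T u) v) \<le> l2_norm N (T u) * l2_norm N v"
      by (intro cauchy_schwarz bounded_ops_L2[OF T] u v)
    also have "\<dots> \<le> (C * l2_norm M u) * l2_norm N v" by (intro mult_right_mono C u) simp
    finally show "cmod (l2_inner N (T u) v) \<le> C * l2_norm N v * l2_norm M u" by (simp add: mult_ac)
  qed (auto simp: bounded_ops_add[OF T] bounded_ops_scale[OF T] bounded_ops_L2[OF T] v
      inner_add_left inner_scale_left)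
  then obtain s where s: "\<And>v. v \<in> L2 N \<Longrightarrow> s v \<in> L2 M"
    and s_inner: "\<And>u v. u \<in> L2 M \<Longrightarrow> v \<in> L2 N \<Longrightarrow> l2_inner N (T u) v = l2_inner M u (s v)"
    by metis
  have s_inner': "l2_inner M (s v) u = l2_inner N v (T u)" if "u \<in> L2 M" "v \<in> L2 N" for u v
    using s_inner[OF that] by (metis inner_cnj)
  have "l2_norm M (s v) \<le> C * l2_norm N v" if v: "v \<in> L2 N" for v
    using s[OF v] v C
    by (intro norm_le_if_inner_self_eq[of "T (s v)" N] bounded_ops_L2[OF T] s_inner[symmetric])
  moreover have "s (l2_add N u v) = l2_add M (s u) (s v)" if "u \<in> L2 N" "v \<in> L2 N" for u v
    using that by (intro eqI_inner[of _ M])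
      (simp_all add: s s_inner' inner_add_left bounded_ops_L2[OF T])
  moreover have "s (l2_scale N c u) = l2_scale M c (s u)" if "u \<in> L2 N" for c u
    using that by (intro eqI_inner[of _ M]) (simp_all add: s s_inner' inner_scale_left bounded_ops_L2[OF T])
  ultimately have "restrict s (L2 N) \<in> bounded_ops N M"
    by (auto simp: bounded_ops_def s)
  then show ?thesis by (intro bexI[of _ "restrict s (L2 N)"]) (auto simp: s_inner)
qed

lemma op_adjoint_eqI:
  assumes S: "S \<in> bounded_ops N M"
    and inner: "\<And>u v. u \<in> L2 M \<Longrightarrow> v \<in> L2 N \<Longrightarrow> l2_inner N (T u) v = l2_inner M u (S v)"
  shows "op_adjoint M N T = S"
  unfolding op_adjoint_def
proof (rule the_equality)
  fix R assume R: "R \<in> bounded_ops N M \<and>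
    (\<forall>u\<in>L2 M. \<forall>v\<in>L2 N. l2_inner N (T u) v = l2_inner M u (R v))"
  show "R = S"
  proof (rule bounded_ops_ext)
    fix v assume v: "v \<in> L2 N"
    have "l2_inner M (R v) u = l2_inner M (S v) u" if "u \<in> L2 M" for u
      using R inner[OF that v] that v by (metis inner_cnj)
    then show "R v = S v" using R S v by (intro eqI_inner[of _ M]) (auto intro: bounded_ops_L2)
  qed (use R S in auto)
qed (use assms in auto)

lemma op_adjoint:
  assumes "sigma_finite_measure M" "T \<in> bounded_ops M N"
  shows op_adjoint_bounded: "op_adjoint M N T \<in> bounded_ops N M"
    and op_adjoint_inner: "u \<in> L2 M \<Longrightarrow> v \<in> L2 N \<Longrightarrow>
      l2_inner N (T u) v = l2_inner M u (op_adjoint M N T v)"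
proof -
  obtain S where S: "S \<in> bounded_ops N M"
    and inner: "\<And>u v. u \<in> L2 M \<Longrightarrow> v \<in> L2 N \<Longrightarrow> l2_inner N (T u) v = l2_inner M u (S v)"
    using adjoint_exists[OF assms] by blast
  have "op_adjoint M N T = S" using op_adjoint_eqI[OF S inner] by blast
  then show "op_adjoint M N T \<in> bounded_ops N M"
    "u \<in> L2 M \<Longrightarrow> v \<in> L2 N \<Longrightarrow> l2_inner N (T u) v = l2_inner M u (op_adjoint M N T v)"
    using S inner by auto
qed

lemma op_adjoint_inner':
  assumes "sigma_finite_measure M" "T \<in> bounded_ops M N" "u \<in> L2 M" "v \<in> L2 N"
  shows "l2_inner M (op_adjoint M N T v) u = l2_inner N v (T u)"
  using op_adjoint_inner[OF assms] by (metis inner_cnj)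

lemma op_adjoint_adjoint:
  assumes "sigma_finite_measure M" "T \<in> bounded_ops M N"
  shows "op_adjoint N M (op_adjoint M N T) = T"
  using assms by (intro op_adjoint_eqI) (auto simp: op_adjoint_inner')

lemma op_adjoint_op_add:
  assumes "sigma_finite_measure M" "S \<in> bounded_ops M N" "T \<in> bounded_ops M N"
  shows "op_adjoint M N (op_add M N S T) = op_add N M (op_adjoint M N S) (op_adjoint M N T)"
  using assms by (intro op_adjoint_eqI op_add_bounded op_adjoint_bounded)
    (auto simp: op_add_def inner_add_left inner_add_right op_adjoint_inner bounded_ops_L2
      bounded_ops_L2[OF op_adjoint_bounded])

lemma op_adjoint_norm_le:
  assumes "sigma_finite_measure M" "T \<in> bounded_ops M N"
    and bound: "\<And>u. u \<in> L2 M \<Longrightarrow> l2_norm N (T u) \<le> C * l2_norm M u" and v: "v \<in> L2 N"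
    and C: "0 \<le> C"
  shows "l2_norm M (op_adjoint M N T v) \<le> C * l2_norm N v"
proof (rule norm_le_if_inner_self_eq[of "T (op_adjoint M N T v)" N])
  have s: "op_adjoint M N T v \<in> L2 M" using op_adjoint_bounded[OF assms(1,2)] v by (rule bounded_ops_L2)
  show "T (op_adjoint M N T v) \<in> L2 N" using assms(2) s by (rule bounded_ops_L2)
  show "l2_inner M (op_adjoint M N T v) (op_adjoint M N T v) = l2_inner N (T (op_adjoint M N T v)) v"
    by (rule op_adjoint_inner[OF assms(1,2) s v, symmetric])
  show "l2_norm N (T (op_adjoint M N T v)) \<le> C * l2_norm M (op_adjoint M N T v)" by (rule bound[OF s])
qed (rule v C)+

lemma norm_mult_op_le:
  assumes \<phi>: "\<phi> \<in> ess_bounded M" and u: "u \<in> L2 M" and C: "0 \<le> C" "AE x in M. cmod (\<phi> x) \<le> C"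
  shows "l2_norm M (mult_op M \<phi> u) \<le> C * l2_norm M u"
proof (rule power2_le_imp_le)
  have \<phi>u: "mult_op M \<phi> u \<in> L2 M" using \<phi> u by simp
  have \<phi>m: "\<phi> \<in> borel_measurable M" using \<phi> by (simp add: ess_bounded_def)
  have "(l2_norm M (mult_op M \<phi> u))\<^sup>2 = (\<integral>x. (cmod (l2_rep (mult_op M \<phi> u) x))\<^sup>2 \<partial>M)"
    by (simp add: l2_norm_def)
  also have "\<dots> \<le> (\<integral>x. C\<^sup>2 * (cmod (l2_rep u x))\<^sup>2 \<partial>M)"
  proof (rule integral_mono_AE)
    show "AE x in M. (cmod (l2_rep (mult_op M \<phi> u) x))\<^sup>2 \<le> C\<^sup>2 * (cmod (l2_rep u x))\<^sup>2"
      using rep_mult_op[OF \<phi>m u] C(2)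
    proof eventually_elim
      case (elim x)
      then have "(cmod (\<phi> x))\<^sup>2 \<le> C\<^sup>2" by (intro power_mono) auto
      then show ?case using elim by (simp add: norm_mult power_mult_distrib mult_right_mono)
    qed
  qed (use rep_sq_integrable[OF u] rep_sq_integrable[OF \<phi>u] in \<open>auto simp: sq_integrable_def\<close>)
  also have "\<dots> = (C * l2_norm M u)\<^sup>2" by (simp add: l2_norm_def power_mult_distrib)
  finally show "(l2_norm M (mult_op M \<phi> u))\<^sup>2 \<le> (C * l2_norm M u)\<^sup>2" .
qed (use C in simp)

lemma mult_op_bounded:
  assumes "\<phi> \<in> ess_bounded M"
  shows "mult_op M \<phi> \<in> bounded_ops M M"
proof -
  obtain C where C: "AE x in M. cmod (\<phi> x) \<le> C" using assms by (auto simp: ess_bounded_def)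
  have "l2_norm M (mult_op M \<phi> u) \<le> max 0 C * l2_norm M u" if u: "u \<in> L2 M" for u
    by (rule norm_mult_op_le[OF assms u]) (use C in \<open>auto elim!: AE_mp\<close>)
  moreover have "mult_op M \<phi> (l2_add M u v) = l2_add M (mult_op M \<phi> u) (mult_op M \<phi> v)"
    if "u \<in> L2 M" "v \<in> L2 M" for u v
    using that assms
    by (intro eqI_inner[of _ M]) (simp_all add: mult_op_inner(2) inner_add_left ess_bounded_cnj)
  moreover have "mult_op M \<phi> (l2_scale M c u) = l2_scale M c (mult_op M \<phi> u)" if "u \<in> L2 M" for c u
    using that assms
    by (intro eqI_inner[of _ M]) (simp_all add: mult_op_inner(2) inner_scale_left ess_bounded_cnj)
  moreover have "mult_op M \<phi> \<in> L2 M \<rightarrow>\<^sub>E L2 M"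
    using assms by (auto simp: mult_op_def ae_class_L2 sq_integrable_mult rep_sq_integrable)
  ultimately show ?thesis by (auto simp: bounded_ops_def)
qed

lemma mult_op_one: "u \<in> L2 M \<Longrightarrow> mult_op M (\<lambda>_. 1) u = u"
  by (simp add: mult_op_def rep_class_id)

lemma mult_op_mult:
  assumes "\<phi> \<in> ess_bounded M" "\<psi> \<in> ess_bounded M" "u \<in> L2 M"
  shows "mult_op M \<phi> (mult_op M \<psi> u) = mult_op M (\<lambda>x. \<phi> x * \<psi> x) u"
proof (rule L2_eqI)
  have m: "\<phi> \<in> borel_measurable M" "\<psi> \<in> borel_measurable M" "(\<lambda>x. \<phi> x * \<psi> x) \<in> borel_measurable M"
    using assms by (auto simp: ess_bounded_def)
  show "AE x in M. l2_rep (mult_op M \<phi> (mult_op M \<psi> u)) x = l2_rep (mult_op M (\<lambda>x. \<phi> x * \<psi> x) u) x"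
    using rep_mult_op[OF m(1) mult_op_L2[OF assms(2,3)]] rep_mult_op[OF m(2) assms(3)]
      rep_mult_op[OF m(3) assms(3)]
    by eventually_elim simp
qed (use assms in \<open>auto simp: ess_bounded_mult\<close>)

lemma cnj_indicator [simp]: "cnj (indicator A x) = indicator A x"
  by (simp add: indicator_def)

lemma proj_inner:
  assumes "A \<in> sets M" "u \<in> L2 M" "v \<in> L2 M"
  shows "l2_inner M (set_proj M A u) v = l2_inner M u (set_proj M A v)"
  using mult_op_inner(2)[of "indicator A" M u v] assms by (simp add: set_proj_def)

lemma proj_L2 [simp]: "A \<in> sets M \<Longrightarrow> u \<in> L2 M \<Longrightarrow> set_proj M A u \<in> L2 M"
  by (simp add: set_proj_def)

lemma rep_proj:
  assumes "A \<in> sets M" "u \<in> L2 M"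
  shows "AE x in M. l2_rep (set_proj M A u) x = (if x \<in> A then l2_rep u x else 0)"
proof -
  have "AE x in M. l2_rep (set_proj M A u) x = indicator A x * l2_rep u x"
    unfolding set_proj_def using assms by (intro rep_mult_op) auto
  then show ?thesis by eventually_elim (simp add: indicator_def)
qed

lemma norm_proj_le:
  assumes "A \<in> sets M" "u \<in> L2 M"
  shows "l2_norm M (set_proj M A u) \<le> l2_norm M u"
proof -
  have "l2_norm M (set_proj M A u) \<le> 1 * l2_norm M u"
    unfolding set_proj_def
    using assms by (intro norm_mult_op_le ess_bounded_indicator) (auto simp: indicator_def)
  then show ?thesis by simp
qed

definition sandwich ::
  "'a measure \<Rightarrow> 'b measure \<Rightarrow> ('b \<Rightarrow> complex) \<Rightarrow> ('a, 'b) l2op \<Rightarrow> ('a \<Rightarrow> complex) \<Rightarrow> ('a, 'b) l2op" where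
  "sandwich M N \<psi> T \<phi> = op_comp M (mult_op N \<psi>) (op_comp M T (mult_op M \<phi>))"

lemma sandwich_apply:
  "u \<in> L2 M \<Longrightarrow> sandwich M N \<psi> T \<phi> u = mult_op N \<psi> (T (mult_op M \<phi> u))"
  by (simp add: sandwich_def op_comp_apply)

lemma sandwich_bounded:
  "\<psi> \<in> ess_bounded N \<Longrightarrow> T \<in> bounded_ops M N \<Longrightarrow> \<phi> \<in> ess_bounded M \<Longrightarrow>
    sandwich M N \<psi> T \<phi> \<in> bounded_ops M N"
  unfolding sandwich_def by (meson op_comp_bounded mult_op_bounded)

lemma sandwich_adjoint:
  assumes "sigma_finite_measure M" "T \<in> bounded_ops M N" "\<psi> \<in> ess_bounded N" "\<phi> \<in> ess_bounded M"
  shows "op_adjoint M N (sandwich M N \<psi> T \<phi>)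
    = sandwich N M (\<lambda>x. cnj (\<phi> x)) (op_adjoint M N T) (\<lambda>y. cnj (\<psi> y))"
proof (rule op_adjoint_eqI)
  note adj = op_adjoint_bounded[OF assms(1,2)]
  show "sandwich N M (\<lambda>x. cnj (\<phi> x)) (op_adjoint M N T) (\<lambda>y. cnj (\<psi> y)) \<in> bounded_ops N M"
    by (intro sandwich_bounded adj ess_bounded_cnj assms)
  fix u v assume u: "u \<in> L2 M" and v: "v \<in> L2 N"
  have "l2_inner N (sandwich M N \<psi> T \<phi> u) v = l2_inner N (T (mult_op M \<phi> u)) (mult_op N (\<lambda>y. cnj (\<psi> y)) v)"
    using assms u v by (simp add: sandwich_apply mult_op_inner(2) bounded_ops_L2)
  also have "\<dots> = l2_inner M (mult_op M \<phi> u) (op_adjoint M N T (mult_op N (\<lambda>y. cnj (\<psi> y)) v))"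
    using assms u v by (intro op_adjoint_inner) (auto simp: ess_bounded_cnj)
  also have "\<dots> = l2_inner M u (sandwich N M (\<lambda>x. cnj (\<phi> x)) (op_adjoint M N T) (\<lambda>y. cnj (\<psi> y)) v)"
    using assms u v
    by (simp add: sandwich_apply mult_op_inner(2) bounded_ops_L2[OF adj] ess_bounded_cnj)
  finally show "l2_inner N (sandwich M N \<psi> T \<phi> u) v
    = l2_inner M u (sandwich N M (\<lambda>x. cnj (\<phi> x)) (op_adjoint M N T) (\<lambda>y. cnj (\<psi> y)) v)" .
qed

lemma op_zero_bounded: "op_zero M N \<in> bounded_ops M N"
proof -
  have z: "l2_norm N (l2_zero N) = 0" using norm_zero_iff[of "l2_zero N" N] rep_zero[of N] by simp
  have i: "l2_inner N (l2_zero N) w = 0" if "w \<in> L2 N" for w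
    by (rule inner_zero_AE) (use that rep_zero[of N] in auto)
  have "l2_add N (l2_zero N) (l2_zero N) = l2_zero N"
    by (rule eqI_inner[of _ N]) (simp_all add: inner_add_left i)
  moreover have "l2_scale N c (l2_zero N) = l2_zero N" for c
    by (rule eqI_inner[of _ N]) (simp_all add: inner_scale_left i)
  ultimately show ?thesis
    unfolding bounded_ops_def op_zero_def by (auto simp: z intro!: exI[of _ 0])
qed

lemma op_scale_bounded:
  assumes T: "T \<in> bounded_ops M N"
  shows "op_scale M N c T \<in> bounded_ops M N"
proof -
  obtain C where C: "\<And>u. u \<in> L2 M \<Longrightarrow> l2_norm N (T u) \<le> C * l2_norm M u"
    using bounded_ops_bound[OF T] by blast
  have "l2_norm N (l2_scale N c (T u)) \<le> (cmod c * C) * l2_norm M u" if u: "u \<in> L2 M" for u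
    using mult_left_mono[OF C[OF u], of "cmod c"] bounded_ops_L2[OF T u] by (simp add: norm_scale mult.assoc)
  moreover have "l2_scale N c (T (l2_add M u v)) = l2_add N (l2_scale N c (T u)) (l2_scale N c (T v))"
    if "u \<in> L2 M" "v \<in> L2 M" for u v
    using that bounded_ops_L2[OF T]
    by (intro eqI_inner[of _ N]) (simp_all add: bounded_ops_add[OF T] inner_add_left inner_scale_left distrib_left)
  moreover have "l2_scale N c (T (l2_scale M d u)) = l2_scale N d (l2_scale N c (T u))" if "u \<in> L2 M" for d u
    using that bounded_ops_L2[OF T]
    by (intro eqI_inner[of _ N]) (simp_all add: bounded_ops_scale[OF T] inner_scale_left)
  ultimately show ?thesis
    unfolding bounded_ops_def op_scale_def by (auto simp: bounded_ops_L2[OF T])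
qed

lemma adjoint_subspace:
  assumes sfM: "sigma_finite_measure M" and U: "op_subspace M N \<U>"
  shows "op_subspace N M (op_adjoint M N ` \<U>)"
proof -
  have bdd: "T \<in> bounded_ops M N" if "T \<in> \<U>" for T using U that by (auto simp: op_subspace_def)
  have adj_bdd: "op_adjoint M N T \<in> bounded_ops N M" if "T \<in> \<U>" for T
    using that by (intro op_adjoint_bounded sfM bdd)
  have "op_adjoint M N (op_zero M N) = op_zero N M"
  proof (rule op_adjoint_eqI[OF op_zero_bounded])
    fix u v assume u: "u \<in> L2 M" and v: "v \<in> L2 N"
    have "l2_inner N (l2_zero N) v = 0" by (rule inner_zero_AE) (use v rep_zero[of N] in auto)
    moreover have "l2_inner M u (l2_zero M) = 0" by (rule inner_zero_AE) (use u rep_zero[of M] in auto)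
    ultimately show "l2_inner N (op_zero M N u) v = l2_inner M u (op_zero N M v)"
      using u v by (simp add: op_zero_def)
  qed
  then have "op_zero N M \<in> op_adjoint M N ` \<U>"
    using U by (auto simp: op_subspace_def intro!: image_eqI[of _ _ "op_zero M N"])
  moreover have "op_add N M (op_adjoint M N S) (op_adjoint M N T) \<in> op_adjoint M N ` \<U>"
    if "S \<in> \<U>" "T \<in> \<U>" for S T
  proof (rule image_eqI)
    show "op_add M N S T \<in> \<U>" using U that by (auto simp: op_subspace_def)
    show "op_add N M (op_adjoint M N S) (op_adjoint M N T) = op_adjoint M N (op_add M N S T)"
      using that by (intro op_adjoint_op_add[symmetric] sfM bdd)
  qed
  moreover have "op_scale N M c (op_adjoint M N T) \<in> op_adjoint M N ` \<U>" if T: "T \<in> \<U>" for c T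
  proof (rule image_eqI)
    show "op_scale M N (cnj c) T \<in> \<U>" using U T by (auto simp: op_subspace_def)
    show "op_scale N M c (op_adjoint M N T) = op_adjoint M N (op_scale M N (cnj c) T)"
      using op_adjoint_inner[OF sfM bdd[OF T]] bounded_ops_L2[OF bdd[OF T]] bounded_ops_L2[OF adj_bdd[OF T]]
      by (intro op_adjoint_eqI[symmetric] op_scale_bounded adj_bdd T)
        (simp add: op_scale_def inner_scale_left inner_scale_right)
  qed
  ultimately show ?thesis using adj_bdd unfolding op_subspace_def by auto
qed

lemma op_subspace_orbit:
  assumes V: "op_subspace M N \<V>" and u: "u \<in> L2 M"
  shows "l2_subspace N ((\<lambda>T. T u) ` \<V>)"
proof -
  have "T u \<in> L2 N" if "T \<in> \<V>" for T
    using V that u by (auto simp: op_subspace_def intro: bounded_ops_L2)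
  moreover have "l2_add N (S u) (T u) \<in> (\<lambda>T. T u) ` \<V>" if "S \<in> \<V>" "T \<in> \<V>" for S T
    using V that u by (intro image_eqI[of _ _ "op_add M N S T"]) (auto simp: op_add_def op_subspace_def)
  moreover have "l2_scale N c (T u) \<in> (\<lambda>T. T u) ` \<V>" if "T \<in> \<V>" for c T
    using V that u by (intro image_eqI[of _ _ "op_scale M N c T"]) (auto simp: op_scale_def op_subspace_def)
  ultimately show ?thesis using V unfolding l2_subspace_def op_subspace_def by auto
qed

section \<open>Maximal sets and point realizations of homomorphisms\<close>

text \<open>A countable union of members whose measures, for an equivalent finite measure, approach the
  supremum over \<open>\<Z>\<close> cannot be enlarged by a further member except by a null set.\<close>

lemma exhaustion:
  assumes sf: "sigma_finite_measure M" and sub: "\<Z> \<subseteq> sets M" and ne: "\<Z> \<noteq> {}"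
    and UN: "\<And>A :: nat \<Rightarrow> 'a set. range A \<subseteq> \<Z> \<Longrightarrow> (\<Union>n. A n) \<in> \<Z>"
  obtains Z where "Z \<in> \<Z>" "\<And>A. A \<in> \<Z> \<Longrightarrow> A - Z \<in> null_sets M"
proof -
  interpret sigma_finite_measure M by fact
  obtain f :: "'a \<Rightarrow> real" where f [measurable]: "f \<in> borel_measurable M"
    and pos: "\<And>x. f x > 0"
    and "\<And>x. f x \<le> 1" and int: "integrable M f"
    using obtain_positive_integrable_function by blast
  define m where "m A = (\<integral>x. indicator A x * f x \<partial>M)" for A
  have int': "integrable M (\<lambda>x. indicator A x * f x)" if "A \<in> sets M" for A
    using integrable_mult_indicator[OF that int] by simp
  have m_mono: "m A \<le> m B" if "A \<in> sets M" "B \<in> sets M" "A \<subseteq> B" for A B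
    unfolding m_def using that pos
    by (intro integral_mono int') (auto simp: indicator_def less_imp_le)
  define s where "s = Sup (m ` \<Z>)"
  have bdd: "bdd_above (m ` \<Z>)"
  proof (rule bdd_aboveI[of _ "m (space M)"])
    fix y assume "y \<in> m ` \<Z>"
    then obtain A where A: "A \<in> \<Z>" "y = m A" by blast
    then have "A \<in> sets M" using sub by blast
    then show "y \<le> m (space M)" unfolding A(2) by (intro m_mono sets.top sets.sets_into_space)
  qed
  have le_s: "m A \<le> s" if "A \<in> \<Z>" for A unfolding s_def using that bdd by (intro cSUP_upper)
  have "\<exists>A\<in>\<Z>. s - 1 / Suc n < m A" for n
  proof -
    have "\<exists>y\<in>m ` \<Z>. s - 1 / Suc n < y"
      unfolding s_def using ne by (intro less_cSupD) auto
    then show ?thesis by blast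
  qed
  then obtain A where A: "\<And>n. A n \<in> \<Z>" and less: "\<And>n. s - 1 / Suc n < m (A n)" by metis
  define Z where "Z = (\<Union>n. A n)"
  have Z: "Z \<in> \<Z>" unfolding Z_def using A by (intro UN) auto
  have "s \<le> m Z"
  proof (rule field_le_epsilon)
    fix e :: real assume "0 < e"
    then obtain n where "1 / Suc n < e" by (rule nat_approx_posE)
    moreover have "m (A n) \<le> m Z" using A Z sub by (intro m_mono) (auto simp: Z_def)
    ultimately show "s \<le> m Z + e" using less[of n] by linarith
  qed
  have "B - Z \<in> null_sets M" if B: "B \<in> \<Z>" for B
  proof -
    have sets: "B \<in> sets M" "Z \<in> sets M" using B Z sub by auto
    have "(\<Union>n::nat. if n = 0 then B else Z) \<in> \<Z>" using B Z by (intro UN) auto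
    moreover have "(\<Union>n::nat. if n = 0 then B else Z) = B \<union> Z" by (auto split: if_splits)
    ultimately have BZ: "B \<union> Z \<in> \<Z>" by simp
    have "m (B \<union> Z) = m Z + m (B - Z)"
    proof -
      have "m (B \<union> Z) = (\<integral>x. indicator Z x * f x + indicator (B - Z) x * f x \<partial>M)"
        unfolding m_def by (intro Bochner_Integration.integral_cong) (auto simp: indicator_def)
      then show ?thesis unfolding m_def using sets by (simp add: int')
    qed
    then have "m (B - Z) \<le> 0" using le_s[OF BZ] \<open>s \<le> m Z\<close> by linarith
    moreover have "0 \<le> m (B - Z)" unfolding m_def using pos
      by (intro Bochner_Integration.integral_nonneg) (simp add: less_imp_le)
    ultimately have "m (B - Z) = 0" by simp
    then have "AE x in M. indicator (B - Z) x * f x = 0"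
      unfolding m_def using pos sets
      by (subst (asm) integral_nonneg_eq_0_iff_AE) (auto intro!: int' simp: less_imp_le)
    then have "AE x in M. x \<notin> B - Z"
      by eventually_elim (use pos in \<open>auto simp: indicator_def less_le split: if_splits\<close>)
    then show ?thesis using sets by (subst (asm) AE_iff_null_sets[symmetric]) auto
  qed
  with Z show thesis by (rule that)
qed

text \<open>For each \<open>n\<close> the space is cut into countably many cells of radius \<open>2\<^sup>-\<^sup>n\<close>, and outside one null set every
  point \<open>x\<close> of the image of the whole space lies in the image of exactly one cell of each level. Two cells
  whose images share \<open>x\<close> must intersect, since disjoint sets have disjoint images; hence the centres of the
  cells chosen by \<open>x\<close> form a Cauchy sequence, and \<open>f x\<close> is its limit. The limit may leave the cells, but not
  their closed balls, so that open sets are recovered from the cells whose closed ball they contain.\<close>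

lemma point_realization:
  fixes \<Phi> :: "'b set \<Rightarrow> 'a set"
  assumes N: "standard_borel_space N"
    and \<Phi>_sets: "\<And>B. B \<in> sets N \<Longrightarrow> \<Phi> B \<in> sets M"
    and disj: "\<And>B C. B \<in> sets N \<Longrightarrow> C \<in> sets N \<Longrightarrow> B \<inter> C = {} \<Longrightarrow> \<Phi> B \<inter> \<Phi> C \<in> null_sets M"
    and UN: "\<And>B :: nat \<Rightarrow> 'b set. range B \<subseteq> sets N \<Longrightarrow> AE x in M. x \<in> \<Phi> (\<Union>n. B n) \<longleftrightarrow> (\<exists>n. x \<in> \<Phi> (B n))"
  obtains X f where "X \<in> sets M" "f \<in> restrict_space M X \<rightarrow>\<^sub>M N"
    "\<And>B. B \<in> sets N \<Longrightarrow> AE x in M. x \<in> \<Phi> B \<longleftrightarrow> x \<in> X \<and> f x \<in> B"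
proof -
  obtain \<T> where \<T>: "completely_metrizable_space \<T>" "second_countable \<T>" "topspace \<T> = space N"
    "sets N = sigma_sets (space N) {V. openin \<T> V}"
    using N by (auto simp: standard_borel_space_def polish_topology_def)
  obtain Y d where Y: "Metric_space Y d" "Metric_space.mcomplete Y d" "\<T> = Metric_space.mtopology Y d"
    using \<T>(1) by (auto simp: completely_metrizable_space_def)
  interpret Metric_space Y d by fact
  have YN: "Y = space N" using \<T>(3) Y(3) by simp
  have open_sets: "V \<in> sets N" if "openin mtopology V" for V
    using that \<T>(4) Y(3) by auto
  obtain C where C: "countable C" "C \<subseteq> Y" "mtopology closure_of C = Y"
    using second_countable_imp_separable_space[OF \<T>(2)] Y(3) by (auto simp: separable_space_def)
  define c where "c = from_nat_into C"
  have dense: "\<exists>k. c k \<in> Y \<and> d (c k) y < r" if "y \<in> Y" "0 < r" for y r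
  proof -
    have "\<exists>z\<in>C. z \<in> mball y r" using C(3) that by (auto simp: metric_closure_of)
    then obtain z where z: "z \<in> C" "d y z < r" by auto
    then obtain k where "c k = z" unfolding c_def using C(1) from_nat_into_surj by metis
    then show ?thesis using z C(2) by (auto simp: commute)
  qed
  define r where "r n = (1/2::real) ^ n" for n
  have r_pos: "0 < r n" for n by (simp add: r_def)
  have r_small: "\<exists>n. r n < e" if "0 < e" for e
    unfolding r_def using that by (intro real_arch_pow_inv) auto
  \<comment> \<open>The cells of level \<open>n\<close> partition the space into pieces of radius \<open>r n\<close>.\<close>
  define cell where "cell n k = mball (c k) (r n) - (\<Union>j<k. mball (c j) (r n))" for n k
  have ball_sets [simp]: "mball y e \<in> sets N" for y e by (simp add: open_sets)
  have cell_sets [simp]: "cell n k \<in> sets N" for n k 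
    unfolding cell_def by (intro sets.Diff sets.finite_UN ball_sets) simp
  have cell_cover: "\<exists>k. y \<in> cell n k" if "y \<in> Y" for y n
  proof -
    define k where "k = (LEAST k. y \<in> mball (c k) (r n))"
    have "\<exists>k. y \<in> mball (c k) (r n)" using dense[OF that r_pos[of n]] that by auto
    then have "y \<in> mball (c k) (r n)" unfolding k_def by (rule LeastI_ex)
    moreover have "y \<notin> mball (c j) (r n)" if "j < k" for j
      using that not_less_Least unfolding k_def by blast
    ultimately show ?thesis unfolding cell_def by blast
  qed
  have cell_disj: "cell n j \<inter> cell n k = {}" if "j \<noteq> k" for n j k
    using that unfolding cell_def by (cases "j < k") (auto simp: linorder_neq_iff)
  have cell_Y: "cell n k \<subseteq> Y" for n k unfolding cell_def by auto
  have cell_center: "c k \<in> Y" "d (c k) y < r n" if "y \<in> cell n k" for y n k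
    using that unfolding cell_def by auto
  have UN_cell: "(\<Union>k. cell n k) = Y" for n
  proof
    show "(\<Union>k. cell n k) \<subseteq> Y" using cell_Y by (rule UN_least)
    show "Y \<subseteq> (\<Union>k. cell n k)"
    proof
      fix y assume "y \<in> Y"
      from cell_cover[OF this, of n] show "y \<in> (\<Union>k. cell n k)" by simp
    qed
  qed
  \<comment> \<open>Outside a null set the images of the cells behave like sets of points.\<close>
  have ae_disj: "AE x in M. \<forall>n j m k. cell n j \<inter> cell m k = {} \<longrightarrow> \<not> (x \<in> \<Phi> (cell n j) \<and> x \<in> \<Phi> (cell m k))"
    unfolding AE_all_countable
  proof (intro allI)
    fix n j m k
    show "AE x in M. cell n j \<inter> cell m k = {} \<longrightarrow> \<not> (x \<in> \<Phi> (cell n j) \<and> x \<in> \<Phi> (cell m k))"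
    proof (cases "cell n j \<inter> cell m k = {}")
      case True
      then have "\<Phi> (cell n j) \<inter> \<Phi> (cell m k) \<in> null_sets M" by (intro disj) auto
      then show ?thesis by (auto dest: AE_not_in)
    qed simp
  qed
  have ae_cover: "AE x in M. \<forall>n. x \<in> \<Phi> Y \<longleftrightarrow> (\<exists>k. x \<in> \<Phi> (cell n k))"
    unfolding AE_all_countable
  proof
    fix n show "AE x in M. x \<in> \<Phi> Y \<longleftrightarrow> (\<exists>k. x \<in> \<Phi> (cell n k))"
      using UN[of "cell n"] by (simp add: UN_cell image_subset_iff)
  qed
  define separated where "separated x \<longleftrightarrow>
      (\<forall>n j m k. cell n j \<inter> cell m k = {} \<longrightarrow> \<not> (x \<in> \<Phi> (cell n j) \<and> x \<in> \<Phi> (cell m k))) \<and>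
      (\<forall>n. x \<in> \<Phi> Y \<longleftrightarrow> (\<exists>k. x \<in> \<Phi> (cell n k)))" for x
  have "AE x in M. separated x"
    using ae_disj ae_cover unfolding separated_def by eventually_elim (rule conjI)
  then obtain E where E: "{x \<in> space M. \<not> separated x} \<subseteq> E" "emeasure M E = 0" "E \<in> sets M"
    by (rule AE_E)
  define G where "G = space M - E"
  have G: "G \<in> sets M" "AE x in M. x \<in> G"
  proof -
    show "G \<in> sets M" using E(3) by (simp add: G_def)
    have "E \<in> null_sets M" using E by (simp add: null_sets_def)
    from AE_not_in[OF this] AE_space show "AE x in M. x \<in> G"
      by eventually_elim (simp add: G_def)
  qed
  have sep: "separated x" if "x \<in> G" for x
    using E(1) that unfolding G_def by blast
  have G_disj: "False" if "x \<in> G" "cell n j \<inter> cell m k = {}" "x \<in> \<Phi> (cell n j)" "x \<in> \<Phi> (cell m k)"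
    for x n j m k
    using sep[OF that(1)] that(2-) unfolding separated_def by blast
  have G_cover: "x \<in> \<Phi> Y \<longleftrightarrow> (\<exists>k. x \<in> \<Phi> (cell n k))" if "x \<in> G" for x n
    using sep[OF that] unfolding separated_def by blast
  define X where "X = G \<inter> \<Phi> Y"
  have Y_sets: "Y \<in> sets N" using YN by simp
  have X: "X \<in> sets M" unfolding X_def using G \<Phi>_sets[OF Y_sets] by auto
  define k where "k x n = (SOME k. x \<in> \<Phi> (cell n k))" for x n
  have k: "x \<in> \<Phi> (cell n (k x n))" if "x \<in> X" for x n
    unfolding k_def using that G_cover[of x n] by (intro someI_ex[of "\<lambda>k. x \<in> \<Phi> (cell n k)"]) (auto simp: X_def)
  have k_unique: "j = k x n" if "x \<in> X" "x \<in> \<Phi> (cell n j)" for x n j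
  proof (rule ccontr)
    assume "j \<noteq> k x n"
    moreover have "x \<in> G" using that(1) by (simp add: X_def)
    ultimately show False
      using G_disj[OF _ cell_disj that(2) k[OF that(1)]] by blast
  qed
  have close: "c (k x n) \<in> Y \<and> d (c (k x n)) (c (k x m)) < r n + r m" if x: "x \<in> X" for x n m
  proof -
    have "cell n (k x n) \<inter> cell m (k x m) \<noteq> {}"
      using G_disj[of x n "k x n" m "k x m"] k[OF x] x by (auto simp: X_def)
    then obtain y where y: "y \<in> cell n (k x n)" "y \<in> cell m (k x m)" by blast
    have "d (c (k x n)) (c (k x m)) \<le> d (c (k x n)) y + d (c (k x m)) y"
      using cell_center[OF y(1)] cell_center[OF y(2)] cell_Y y by (metis commute subsetD triangle)
    then show ?thesis using cell_center[OF y(1)] cell_center[OF y(2)] by simp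
  qed
  have "\<exists>y. y \<in> Y \<and> limitin mtopology (\<lambda>n. c (k x n)) y sequentially" if x: "x \<in> X" for x
  proof -
    have "MCauchy (\<lambda>n. c (k x n))"
      unfolding MCauchy_def
    proof (intro conjI allI impI)
      show "range (\<lambda>n. c (k x n)) \<subseteq> Y" using close[OF x] by auto
      fix e :: real assume "0 < e"
      then obtain n0 where n0: "r n0 < e / 2" using r_small[of "e / 2"] by auto
      have "d (c (k x n)) (c (k x n')) < e" if "n0 \<le> n" "n0 \<le> n'" for n n'
      proof -
        have "r n \<le> r n0" "r n' \<le> r n0" unfolding r_def using that by (auto intro: power_decreasing)
        then show ?thesis using close[OF x, of n n'] n0 by linarith
      qed
      then show "\<exists>K. \<forall>n n'. K \<le> n \<longrightarrow> K \<le> n' \<longrightarrow> d (c (k x n)) (c (k x n')) < e" by blast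
    qed
    then obtain y where "limitin mtopology (\<lambda>n. c (k x n)) y sequentially"
      using Y(2) unfolding mcomplete_def by blast
    then show ?thesis using limitin_topspace by fastforce
  qed
  then obtain f where fY: "\<And>x. x \<in> X \<Longrightarrow> f x \<in> Y"
    and f_lim: "\<And>x. x \<in> X \<Longrightarrow> limitin mtopology (\<lambda>n. c (k x n)) (f x) sequentially"
    by metis
  have f_close: "d (c (k x n)) (f x) \<le> r n" if x: "x \<in> X" for x n
  proof (rule field_le_epsilon)
    fix e :: real assume e: "0 < e"
    then obtain n0 where n0: "r n0 < e / 2" using r_small[of "e / 2"] by auto
    obtain n1 where n1: "\<And>n. n \<ge> n1 \<Longrightarrow> d (c (k x n)) (f x) < e / 2"
      using f_lim[OF x] e unfolding limitin_metric eventually_sequentially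
      by (metis half_gt_zero in_mball)
    define m where "m = max n0 n1"
    have "r m \<le> r n0" unfolding r_def m_def by (intro power_decreasing) auto
    moreover have "d (c (k x n)) (f x) \<le> d (c (k x n)) (c (k x m)) + d (c (k x m)) (f x)"
      using close[OF x] fY[OF x] by (intro triangle) auto
    ultimately show "d (c (k x n)) (f x) \<le> r n + e"
      using close[OF x, of n m] n0 n1[of m] by (simp add: m_def)
  qed
  \<comment> \<open>An open set and its preimage are unions over the same countable family of cells.\<close>
  define I where "I V = {(n, j). mcball (c j) (r n) \<subseteq> V}" for V
  have f_open: "x \<in> X \<Longrightarrow> f x \<in> V \<longleftrightarrow> (\<exists>(n, j)\<in>I V. x \<in> \<Phi> (cell n j))" if V: "openin mtopology V" for V x
  proof
    assume x: "x \<in> X"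
    show "f x \<in> V" if ex: "\<exists>(n, j)\<in>I V. x \<in> \<Phi> (cell n j)"
    proof -
      obtain n j where nj: "mcball (c j) (r n) \<subseteq> V" "x \<in> \<Phi> (cell n j)" using ex by (auto simp: I_def)
      have "j = k x n" using k_unique[OF x nj(2)] .
      then show ?thesis using nj(1) f_close[OF x, of n] close[OF x, of n n] fY[OF x] by auto
    qed
    show "\<exists>(n, j)\<in>I V. x \<in> \<Phi> (cell n j)" if fx: "f x \<in> V"
    proof -
      obtain e where e: "0 < e" "mball (f x) e \<subseteq> V" using V fx by (auto simp: openin_mtopology)
      obtain n where n: "r n < e / 2" using r_small[of "e / 2"] e by auto
      have "mcball (c (k x n)) (r n) \<subseteq> V"
      proof
        fix y assume y: "y \<in> mcball (c (k x n)) (r n)"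
        then have "d (f x) y \<le> d (f x) (c (k x n)) + d (c (k x n)) y"
          using fY[OF x] by (intro triangle) auto
        then have "d (f x) y < e" using f_close[OF x, of n] y n by (simp add: commute)
        then show "y \<in> V" using e y fY[OF x] by auto
      qed
      then show ?thesis using k[OF x, of n] by (auto simp: I_def)
    qed
  qed
  have cell_open: "V = (\<Union>(n, j)\<in>I V. cell n j)" if V: "openin mtopology V" for V
  proof (intro equalityI subsetI)
    fix y assume y: "y \<in> V"
    then have yY: "y \<in> Y" using V openin_mtopology by blast
    obtain e where e: "0 < e" "mball y e \<subseteq> V" using V y by (auto simp: openin_mtopology)
    obtain n where n: "r n < e / 2" using r_small[of "e / 2"] e by auto
    obtain j where j: "y \<in> cell n j" using cell_cover[OF yY] by blast
    have "mcball (c j) (r n) \<subseteq> V"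
    proof
      fix z assume z: "z \<in> mcball (c j) (r n)"
      then have "d y z \<le> d y (c j) + d (c j) z" using yY by (intro triangle) auto
      then have "d y z < e" using cell_center[OF j] z n by (simp add: commute)
      then show "z \<in> V" using e z yY by auto
    qed
    then show "y \<in> (\<Union>(n, j)\<in>I V. cell n j)" using j by (auto simp: I_def)
  next
    fix y assume "y \<in> (\<Union>(n, j)\<in>I V. cell n j)"
    then obtain n j where nj: "mcball (c j) (r n) \<subseteq> V" "y \<in> cell n j" by (auto simp: I_def)
    have "y \<in> mcball (c j) (r n)"
      using cell_center[OF nj(2)] subsetD[OF cell_Y nj(2)] by simp
    then show "y \<in> V" using nj(1) by blast
  qed
  have ae_empty: "AE x in M. x \<notin> \<Phi> {}" using AE_not_in[OF disj[of "{}" "{}"]] by simp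
  have ae_UN: "AE x in M. x \<in> \<Phi> (\<Union>i\<in>J. B i) \<longleftrightarrow> (\<exists>i\<in>J. x \<in> \<Phi> (B i))"
    if J: "countable J" and B: "\<And>i. i \<in> J \<Longrightarrow> B i \<in> sets N" for J :: "(nat \<times> nat) set" and B
  proof -
    define B' where "B' n = (if prod_decode n \<in> J then B (prod_decode n) else {})" for n
    have "range B' \<subseteq> sets N" by (rule image_subsetI) (simp add: B'_def B)
    moreover have "(\<Union>n. B' n) = (\<Union>i\<in>J. B i)"
    proof (intro equalityI subsetI)
      fix y assume "y \<in> (\<Union>i\<in>J. B i)"
      then obtain i where "i \<in> J" "y \<in> B i" by blast
      then have "y \<in> B' (prod_encode i)" by (simp add: B'_def)
      then show "y \<in> (\<Union>n. B' n)" by blast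
    qed (auto simp: B'_def split: if_splits)
    ultimately have "AE x in M. x \<in> \<Phi> (\<Union>i\<in>J. B i) \<longleftrightarrow> (\<exists>n. x \<in> \<Phi> (B' n))" using UN[of B'] by simp
    with ae_empty show ?thesis
    proof eventually_elim
      case (elim x)
      have "x \<in> \<Phi> (B' (prod_encode i)) \<longleftrightarrow> x \<in> \<Phi> (B i)" if "i \<in> J" for i using that by (simp add: B'_def)
      moreover have "\<exists>i\<in>J. x \<in> \<Phi> (B i)" if "x \<in> \<Phi> (B' n)" for n
        using that elim(1) by (auto simp: B'_def split: if_splits)
      ultimately show ?case using elim(2) by metis
    qed
  qed
  have real_open: "AE x in M. x \<in> \<Phi> V \<longleftrightarrow> x \<in> X \<and> f x \<in> V" if V: "openin mtopology V" for V
  proof -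
    have "AE x in M. x \<in> \<Phi> V \<longleftrightarrow> (\<exists>(n, j)\<in>I V. x \<in> \<Phi> (cell n j))"
      using ae_UN[of "I V" "\<lambda>(n, j). cell n j"] cell_open[OF V] by (auto simp: case_prod_unfold)
    with G(2) show ?thesis
    proof eventually_elim
      case (elim x)
      have "x \<in> X" if "\<exists>(n, j)\<in>I V. x \<in> \<Phi> (cell n j)"
        using that elim(1) G_cover[OF elim(1)] by (auto simp: X_def)
      then show ?case using elim(2) f_open[OF V, of x] by blast
    qed
  qed
  have f_meas: "f \<in> restrict_space M X \<rightarrow>\<^sub>M N"
  proof (rule measurable_sigma_sets[OF \<T>(4)])
    show "{V. openin \<T> V} \<subseteq> Pow (space N)" using \<T>(3) openin_subset by fastforce
    show "f \<in> space (restrict_space M X) \<rightarrow> space N" using fY YN by (auto simp: space_restrict_space)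
    fix V assume "V \<in> {V. openin \<T> V}"
    then have V: "openin mtopology V" using Y(3) by simp
    have "f -` V \<inter> X = (\<Union>(n, j)\<in>I V. \<Phi> (cell n j) \<inter> X)"
      using f_open[OF V] by auto
    also have "\<dots> \<in> sets M"
      by (intro sets.countable_UN'') (auto intro!: sets.Int X \<Phi>_sets)
    finally have "f -` V \<inter> X \<in> sets M" .
    then show "f -` V \<inter> space (restrict_space M X) \<in> sets (restrict_space M X)"
      using X sets.sets_into_space[OF X]
      by (auto simp: space_restrict_space sets_restrict_space Int_absorb1 intro!: image_eqI[of _ _ "f -` V \<inter> X"])
  qed
  have real: "AE x in M. x \<in> \<Phi> B \<longleftrightarrow> x \<in> X \<and> f x \<in> B" if "B \<in> sets N" for B
    using that unfolding \<T>(4)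
  proof induction
    case (Basic V)
    then show ?case using real_open Y(3) by simp
  next
    case Empty
    show ?case using ae_empty by simp
  next
    case (Compl B)
    then have B: "B \<in> sets N" using \<T>(4) by simp
    have "AE x in M. x \<in> \<Phi> (space N) \<longleftrightarrow> x \<in> X \<and> f x \<in> space N"
    proof -
      have "openin mtopology Y" by (metis openin_topspace topspace_mtopology)
      from real_open[OF this] show ?thesis by (simp only: YN)
    qed
    moreover have "AE x in M. \<not> (x \<in> \<Phi> B \<and> x \<in> \<Phi> (space N - B))"
      using AE_not_in[OF disj[of B "space N - B"]] B by simp
    moreover have "AE x in M. x \<in> \<Phi> (space N) \<longleftrightarrow> x \<in> \<Phi> B \<or> x \<in> \<Phi> (space N - B)"
    proof -
      have *: "AE x in M. x \<in> \<Phi> (\<Union>i\<in>{(0,0), (0,1)::nat\<times>nat}. if i = (0,0) then B else space N - B) \<longleftrightarrow>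
         (\<exists>i\<in>{(0,0), (0,1)::nat\<times>nat}. x \<in> \<Phi> (if i = (0,0) then B else space N - B))"
        by (rule ae_UN) (use B in auto)
      moreover have "(\<Union>i\<in>{(0,0), (0,1)::nat\<times>nat}. if i = (0,0) then B else space N - B) = space N"
        using sets.sets_into_space[OF B] by auto
      ultimately show ?thesis by simp
    qed
    ultimately show ?case using Compl.IH
    proof eventually_elim
      case (elim x)
      then show ?case using fY YN by blast
    qed
  next
    case (Union B)
    then have "range B \<subseteq> sets N" using \<T>(4) by auto
    from UN[OF this] have "AE x in M. x \<in> \<Phi> (\<Union>n. B n) \<longleftrightarrow> (\<exists>n. x \<in> \<Phi> (B n))" .
    moreover have "AE x in M. \<forall>n. x \<in> \<Phi> (B n) \<longleftrightarrow> x \<in> X \<and> f x \<in> B n"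
      unfolding AE_all_countable using Union.IH by blast
    ultimately show ?case by eventually_elim auto
  qed
  from X f_meas real show thesis by (rule that)
qed

section \<open>Rectangles on which an operator vanishes\<close>

lemma perp_proj_iff:
  assumes w: "w \<in> L2 M" and A: "A \<in> sets M"
  shows "(\<forall>v\<in>L2 M. l2_inner M w (set_proj M A v) = 0) \<longleftrightarrow> (AE x in M. x \<in> A \<longrightarrow> l2_rep w x = 0)"
proof
  assume *: "\<forall>v\<in>L2 M. l2_inner M w (set_proj M A v) = 0"
  have "l2_inner M (set_proj M A w) (set_proj M A w) = 0"
    using * A w by (simp add: proj_inner)
  then have "l2_norm M (set_proj M A w) = 0"
    using norm_sq[of M "set_proj M A w"] by simp
  then have "AE x in M. l2_rep (set_proj M A w) x = 0"
    using norm_zero_iff[of "set_proj M A w" M] A w by simp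
  then show "AE x in M. x \<in> A \<longrightarrow> l2_rep w x = 0"
    using rep_proj[OF A w] by eventually_elim (auto split: if_splits)
next
  assume *: "AE x in M. x \<in> A \<longrightarrow> l2_rep w x = 0"
  show "\<forall>v\<in>L2 M. l2_inner M w (set_proj M A v) = 0"
  proof
    fix v assume v: "v \<in> L2 M"
    show "l2_inner M w (set_proj M A v) = 0"
    proof (rule inner_zero_AE)
      show "AE x in M. l2_rep w x = 0 \<or> l2_rep (set_proj M A v) x = 0"
        using * rep_proj[OF A v] by eventually_elim auto
    qed (use A v w in auto)
  qed
qed

text \<open>This is the relation \<open>F(B) T E(A) = 0\<close>, written as a sesquilinear form so that it passes to adjoints.\<close>

definition vanishes_on :: "'a measure \<Rightarrow> 'b measure \<Rightarrow> ('a, 'b) l2op \<Rightarrow> 'a set \<Rightarrow> 'b set \<Rightarrow> bool" where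
  "vanishes_on M N T A B \<longleftrightarrow>
     (\<forall>u\<in>L2 M. \<forall>v\<in>L2 N. l2_inner N (T (set_proj M A u)) (set_proj N B v) = 0)"

lemma vanishes_on_range_iff:
  assumes "T \<in> bounded_ops M N" "A \<in> sets M" "B \<in> sets N"
  shows "vanishes_on M N T A B \<longleftrightarrow>
    (\<forall>u\<in>L2 M. AE y in N. y \<in> B \<longrightarrow> l2_rep (T (set_proj M A u)) y = 0)"
  unfolding vanishes_on_def using assms by (simp add: perp_proj_iff bounded_ops_L2)

lemma vanishes_on_adjoint_iff:
  assumes "sigma_finite_measure M" "T \<in> bounded_ops M N" "A \<in> sets M" "B \<in> sets N"
  shows "vanishes_on N M (op_adjoint M N T) B A \<longleftrightarrow> vanishes_on M N T A B"
  unfolding vanishes_on_def using assms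
  by (auto simp: op_adjoint_inner') (metis complex_cnj_zero inner_cnj)+

lemma vanishes_on_adjoint_range_iff:
  assumes "sigma_finite_measure M" "T \<in> bounded_ops M N" "A \<in> sets M" "B \<in> sets N"
  shows "vanishes_on M N T A B \<longleftrightarrow>
    (\<forall>v\<in>L2 N. AE x in M. x \<in> A \<longrightarrow> l2_rep (op_adjoint M N T (set_proj N B v)) x = 0)"
  using assms vanishes_on_adjoint_iff[OF assms]
    vanishes_on_range_iff[of "op_adjoint M N T" N M B A] op_adjoint_bounded[OF assms(1,2)]
  by simp

lemma vanishes_on_UN_right:
  assumes "T \<in> bounded_ops M N" "A \<in> sets M" "range B \<subseteq> sets N" "\<And>n. vanishes_on M N T A (B n)"
  shows "vanishes_on M N T A (\<Union>n::nat. B n)"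
proof -
  have B: "B n \<in> sets N" for n using assms(3) by blast
  have "AE y in N. y \<in> (\<Union>n. B n) \<longrightarrow> l2_rep (T (set_proj M A u)) y = 0" if "u \<in> L2 M" for u
  proof -
    have "AE y in N. \<forall>n. y \<in> B n \<longrightarrow> l2_rep (T (set_proj M A u)) y = 0"
      unfolding AE_all_countable
      using assms(4) vanishes_on_range_iff[OF assms(1,2) B] that by blast
    then show ?thesis by eventually_elim blast
  qed
  then show ?thesis using assms B by (subst vanishes_on_range_iff) auto
qed

lemma vanishes_on_UN_left:
  assumes "sigma_finite_measure M" "T \<in> bounded_ops M N" "range A \<subseteq> sets M" "B \<in> sets N"
    "\<And>n. vanishes_on M N T (A n) B"
  shows "vanishes_on M N T (\<Union>n::nat. A n) B"
proof -
  have A: "A n \<in> sets M" for n using assms(3) by blast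
  have "vanishes_on N M (op_adjoint M N T) B (\<Union>n. A n)"
    using assms A by (intro vanishes_on_UN_right op_adjoint_bounded) (auto simp: vanishes_on_adjoint_iff)
  then show ?thesis using assms A by (subst (asm) vanishes_on_adjoint_iff) auto
qed

lemma vanishes_on_mono:
  assumes "sigma_finite_measure M" "T \<in> bounded_ops M N" "A \<in> sets M" "B \<in> sets N"
    "vanishes_on M N T A B" "A' \<in> sets M" "B' \<in> sets N" "AE x in M. x \<in> A' \<longrightarrow> x \<in> A" "B' \<subseteq> B"
  shows "vanishes_on M N T A' B'"
proof -
  have "AE x in M. x \<in> A' \<longrightarrow> l2_rep (op_adjoint M N T (set_proj N B v)) x = 0" if "v \<in> L2 N" for v
  proof -
    have "AE x in M. x \<in> A \<longrightarrow> l2_rep (op_adjoint M N T (set_proj N B v)) x = 0"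
      using assms(5) vanishes_on_adjoint_range_iff[OF assms(1-4)] that by blast
    with assms(8) show ?thesis by eventually_elim blast
  qed
  then have "vanishes_on M N T A' B" using assms by (subst vanishes_on_adjoint_range_iff) auto
  then have *: "AE y in N. y \<in> B \<longrightarrow> l2_rep (T (set_proj M A' u)) y = 0" if "u \<in> L2 M" for u
    using vanishes_on_range_iff[OF assms(2,6,4)] that by blast
  have "AE y in N. y \<in> B' \<longrightarrow> l2_rep (T (set_proj M A' u)) y = 0" if "u \<in> L2 M" for u
    using *[OF that] assms(9) by (auto elim!: AE_mp)
  then show ?thesis using assms by (subst vanishes_on_range_iff) auto
qed

lemma vanishes_on_iff_compression_zero:
  assumes "T \<in> bounded_ops M N" "A \<in> sets M" "B \<in> sets N"
  shows "op_comp M (set_proj N B) (op_comp M T (set_proj M A)) = op_zero M N \<longleftrightarrow> vanishes_on M N T A B"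
proof
  assume *: "op_comp M (set_proj N B) (op_comp M T (set_proj M A)) = op_zero M N"
  show "vanishes_on M N T A B" unfolding vanishes_on_def
  proof (intro ballI)
    fix u v assume u: "u \<in> L2 M" and v: "v \<in> L2 N"
    have "set_proj N B (T (set_proj M A u)) = l2_zero N"
      using fun_cong[OF *, of u] u by (simp add: op_comp_apply op_zero_def)
    then have "l2_inner N (T (set_proj M A u)) (set_proj N B v) = l2_inner N (l2_zero N) v"
      using assms u v by (simp add: proj_inner[symmetric] bounded_ops_L2)
    also have "\<dots> = 0" by (rule inner_zero_AE) (use v rep_zero[of N] in auto)
    finally show "l2_inner N (T (set_proj M A u)) (set_proj N B v) = 0" .
  qed
next
  assume *: "vanishes_on M N T A B"
  show "op_comp M (set_proj N B) (op_comp M T (set_proj M A)) = op_zero M N"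
  proof
    fix u
    show "op_comp M (set_proj N B) (op_comp M T (set_proj M A)) u = op_zero M N u"
    proof (cases "u \<in> L2 M")
      case True
      let ?w = "T (set_proj M A u)"
      have w: "?w \<in> L2 N" using assms True by (simp add: bounded_ops_L2)
      have "AE y in N. y \<in> B \<longrightarrow> l2_rep ?w y = 0"
        using * vanishes_on_range_iff[OF assms] True by blast
      then have "AE y in N. l2_rep (set_proj N B ?w) y = l2_rep (l2_zero N) y"
        using rep_proj[OF assms(3) w] rep_zero[of N] by eventually_elim auto
      then have "set_proj N B ?w = l2_zero N" by (intro L2_eqI[of _ N]) (auto simp: assms w)
      then show ?thesis using True by (simp add: op_comp_apply op_zero_def)
    next
      case False
      then show ?thesis by (simp add: op_comp_def op_zero_def compose_def)
    qed
  qed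
qed

text \<open>Closedness in the w*-topology enters the argument through bounded sequences that converge in the
  weak operator topology; in this form it passes to the space of adjoints, which the second half of the
  theorem is about.\<close>

definition bounded_wot_closed :: "'a measure \<Rightarrow> 'b measure \<Rightarrow> ('a, 'b) l2op set \<Rightarrow> bool" where
  "bounded_wot_closed M N \<U> \<longleftrightarrow> (\<forall>S T C. (\<forall>n::nat. S n \<in> \<U>) \<longrightarrow> T \<in> bounded_ops M N \<longrightarrow>
     (\<forall>n. \<forall>u\<in>L2 M. l2_norm N (S n u) \<le> C * l2_norm M u) \<longrightarrow>
     (\<forall>u\<in>L2 M. \<forall>v\<in>L2 N. (\<lambda>n. l2_inner N (S n u) v) \<longlonglongrightarrow> l2_inner N (T u) v) \<longrightarrow> T \<in> \<U>)"

lemma preimage_sets: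
  assumes X: "X \<in> sets M" and f: "f \<in> restrict_space M X \<rightarrow>\<^sub>M N" and B: "B \<in> sets N"
  shows "{x \<in> X. f x \<in> B} \<in> sets M"
proof -
  have "f -` B \<inter> space (restrict_space M X) = {x \<in> X. f x \<in> B}"
    using sets.sets_into_space[OF X] by (auto simp: space_restrict_space)
  moreover have "f -` B \<inter> space (restrict_space M X) \<in> sets (restrict_space M X)"
    using f B by (rule measurable_sets)
  moreover have "X \<inter> space M \<in> sets M" using X by auto
  ultimately show ?thesis by (simp add: sets_restrict_space_iff)
qed

section \<open>Bimodules with abelian range algebra\<close>

text \<open>The assumption \<open>commute\<close> is the commutation of the generators of \<open>[\<U>\<U>*]\<close>.\<close>

locale bimodule_with_abelian_range =
  fixes M :: "'a measure" and N :: "'b measure" and \<U> :: "('a, 'b) l2op set"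
  assumes sfM: "sigma_finite_measure M" and sfN: "sigma_finite_measure N"
    and subspace: "op_subspace M N \<U>"
    and bimodule: "\<And>\<psi> T \<phi>. \<psi> \<in> ess_bounded N \<Longrightarrow> T \<in> \<U> \<Longrightarrow> \<phi> \<in> ess_bounded M \<Longrightarrow> sandwich M N \<psi> T \<phi> \<in> \<U>"
    and closed: "bounded_wot_closed M N \<U>"
    and commute: "\<And>S T S' T' u. S \<in> \<U> \<Longrightarrow> T \<in> \<U> \<Longrightarrow> S' \<in> \<U> \<Longrightarrow> T' \<in> \<U> \<Longrightarrow> u \<in> L2 N \<Longrightarrow>
      S (op_adjoint M N T (S' (op_adjoint M N T' u))) = S' (op_adjoint M N T' (S (op_adjoint M N T u)))"
begin

abbreviation adj :: "('a, 'b) l2op \<Rightarrow> ('b, 'a) l2op" where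
  "adj \<equiv> op_adjoint M N"

lemma U_bounded: "T \<in> \<U> \<Longrightarrow> T \<in> bounded_ops M N"
  using subspace by (auto simp: op_subspace_def)

lemma U_L2 [simp]: "T \<in> \<U> \<Longrightarrow> u \<in> L2 M \<Longrightarrow> T u \<in> L2 N"
  using U_bounded bounded_ops_L2 by blast

lemma adj_bounded: "T \<in> \<U> \<Longrightarrow> adj T \<in> bounded_ops N M"
  by (intro op_adjoint_bounded sfM U_bounded)

lemma adj_L2 [simp]: "T \<in> \<U> \<Longrightarrow> v \<in> L2 N \<Longrightarrow> adj T v \<in> L2 M"
  using adj_bounded bounded_ops_L2 by blast

lemma adj_inner: "T \<in> \<U> \<Longrightarrow> u \<in> L2 M \<Longrightarrow> v \<in> L2 N \<Longrightarrow> l2_inner N (T u) v = l2_inner M u (adj T v)"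
  by (intro op_adjoint_inner sfM U_bounded)

lemma adj_inner': "T \<in> \<U> \<Longrightarrow> u \<in> L2 M \<Longrightarrow> v \<in> L2 N \<Longrightarrow> l2_inner M (adj T v) u = l2_inner N v (T u)"
  by (intro op_adjoint_inner' sfM U_bounded)

lemma left_multiple:
  assumes "\<psi> \<in> ess_bounded N" "T \<in> \<U>"
  shows "sandwich M N \<psi> T (\<lambda>_. 1) \<in> \<U>"
    and "v \<in> L2 N \<Longrightarrow> adj (sandwich M N \<psi> T (\<lambda>_. 1)) v = adj T (mult_op N (\<lambda>y. cnj (\<psi> y)) v)"
proof -
  show "sandwich M N \<psi> T (\<lambda>_. 1) \<in> \<U>" by (intro bimodule assms) simp
  show "adj (sandwich M N \<psi> T (\<lambda>_. 1)) v = adj T (mult_op N (\<lambda>y. cnj (\<psi> y)) v)" if v: "v \<in> L2 N"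
    using assms v
    by (simp add: sandwich_adjoint[OF sfM U_bounded] sandwich_apply mult_op_one ess_bounded_cnj)
qed

text \<open>Write \<open>P\<close> for the multiplication operator and \<open>p\<close>, \<open>q\<close> for the two sides. The bimodule property makes
  \<open>S1 T1* P\<close> another product of this kind, and moving it past \<open>S T*\<close> and back yields \<open>S1 T1* p = S1 T1* q\<close>
  for all \<open>S1\<close>, \<open>T1\<close>. On the other hand \<open>p\<close> and \<open>q\<close> are themselves images of vectors under such products, up
  to a multiplication operator that can be absorbed; moving the products to the other side
  of the inner product shows that \<open>p - q\<close> is orthogonal to \<open>p\<close> and \<open>q\<close>.\<close>

lemma range_commutes_with_mult:
  assumes S: "S \<in> \<U>" and T: "T \<in> \<U>" and \<phi>: "\<phi> \<in> ess_bounded N" and u: "u \<in> L2 N"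
  shows "mult_op N \<phi> (S (adj T u)) = S (adj T (mult_op N \<phi> u))"
proof -
  define p where "p = mult_op N \<phi> (S (adj T u))"
  define q where "q = S (adj T (mult_op N \<phi> u))"
  have p: "p \<in> L2 N" and q: "q \<in> L2 N" using S T \<phi> u by (simp_all add: p_def q_def)
  have eq: "S1 (adj T1 p) = S1 (adj T1 q)" if S1: "S1 \<in> \<U>" and T1: "T1 \<in> \<U>" for S1 T1
  proof -
    define R where "R = sandwich M N (\<lambda>y. cnj (\<phi> y)) T1 (\<lambda>_. 1)"
    have R: "R \<in> \<U>" unfolding R_def by (intro left_multiple ess_bounded_cnj \<phi> T1)
    have R_adj: "adj R v = adj T1 (mult_op N \<phi> v)" if "v \<in> L2 N" for v
      unfolding R_def using left_multiple(2)[OF ess_bounded_cnj[OF \<phi>] T1 that] by simp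
    have "S1 (adj T1 p) = S1 (adj R (S (adj T u)))" using S T u by (simp add: p_def R_adj)
    also have "\<dots> = S (adj T (S1 (adj R u)))" by (rule commute[OF S1 R S T u])
    also have "\<dots> = S (adj T (S1 (adj T1 (mult_op N \<phi> u))))" using u by (simp add: R_adj)
    also have "\<dots> = S1 (adj T1 q)"
      unfolding q_def by (rule commute[OF S T S1 T1]) (simp add: \<phi> u)
    finally show ?thesis .
  qed
  define R where "R = sandwich M N \<phi> S (\<lambda>_. 1)"
  have R: "R \<in> \<U>" unfolding R_def by (intro left_multiple \<phi> S)
  have p_inner: "l2_inner N p x = l2_inner N u (T (adj R x))" if x: "x \<in> L2 N" for x
  proof -
    have "l2_inner N p x = l2_inner N (S (adj T u)) (mult_op N (\<lambda>y. cnj (\<phi> y)) x)"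
      unfolding p_def by (rule mult_op_inner(2)) (simp_all add: S T \<phi> u x)
    also have "\<dots> = l2_inner M (adj T u) (adj R x)"
      using S T \<phi> u x left_multiple(2)[OF \<phi> S x] by (simp add: R_def adj_inner ess_bounded_cnj)
    also have "\<dots> = l2_inner N u (T (adj R x))" using T R u x by (simp add: adj_inner')
    finally show ?thesis .
  qed
  have q_inner: "l2_inner N q x = l2_inner N (mult_op N \<phi> u) (T (adj S x))" if x: "x \<in> L2 N" for x
    using S T \<phi> u x by (simp add: q_def adj_inner adj_inner')
  have "p = q"
    using p q by (intro eq_if_inner_eq[of _ N]) (simp_all add: p_inner q_inner eq[OF T R] eq[OF T S])
  then show ?thesis by (simp add: p_def q_def)
qed

text \<open>Let \<open>z = T* F(B) g\<close>. The bimodule property makes not only \<open>v\<close> but also all its bounded multiples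
  orthogonal to \<open>z\<close>. For the multiple by the conjugate sign of \<open>v cnj z\<close> the inner product is the integral
  of \<open>\<bar>v z\<bar>\<close>, so \<open>z\<close> vanishes where \<open>v\<close> does not.\<close>

lemma annihilated_vector_support:
  assumes v: "v \<in> L2 M" and B: "B \<in> sets N"
    and ann: "\<And>T g. T \<in> \<U> \<Longrightarrow> g \<in> L2 N \<Longrightarrow> l2_inner N (T v) (set_proj N B g) = 0"
    and T: "T \<in> \<U>"
  shows "vanishes_on M N T {x \<in> space M. l2_rep v x \<noteq> 0} B"
proof -
  have vm [measurable]: "l2_rep v \<in> borel_measurable M" using v by (rule rep_measurable)
  have A: "{x \<in> space M. l2_rep v x \<noteq> 0} \<in> sets M" by measurable
  have "AE x in M. x \<in> {x \<in> space M. l2_rep v x \<noteq> 0} \<longrightarrow> l2_rep (adj T (set_proj N B g)) x = 0"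
    if g: "g \<in> L2 N" for g
  proof -
    define z where "z = adj T (set_proj N B g)"
    have z: "z \<in> L2 M" using T B g by (simp add: z_def)
    have zm [measurable]: "l2_rep z \<in> borel_measurable M" using z by (rule rep_measurable)
    define \<phi> where "\<phi> x = cnj (sgn (l2_rep v x * cnj (l2_rep z x)))" for x
    have "\<phi> \<in> borel_measurable M"
      unfolding \<phi>_def sgn_eq by (intro borel_measurable_cnj borel_measurable_divide) measurable
    moreover have "cmod (\<phi> x) \<le> 1" for x by (simp add: \<phi>_def norm_sgn)
    ultimately have \<phi>: "\<phi> \<in> ess_bounded M" by (auto simp: ess_bounded_def)
    have "sandwich M N (\<lambda>_. 1) T \<phi> \<in> \<U>" by (intro bimodule T \<phi>) simp
    from ann[OF this g] have "l2_inner N (T (mult_op M \<phi> v)) (set_proj N B g) = 0"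
      using v \<phi> T by (simp add: sandwich_apply mult_op_one)
    then have "l2_inner M (mult_op M \<phi> v) z = 0"
      using v \<phi> T B g by (simp add: adj_inner z_def)
    then have "(\<integral>x. \<phi> x * l2_rep v x * cnj (l2_rep z x) \<partial>M) = 0"
      using mult_op_inner(1)[OF \<phi> v z] by simp
    moreover have "\<phi> x * l2_rep v x * cnj (l2_rep z x) = complex_of_real (cmod (l2_rep v x * cnj (l2_rep z x)))" for x
    proof -
      have "cnj (sgn a) * a = complex_of_real (cmod a)" for a :: complex
      proof -
        have "cnj (sgn a) * a = (a * cnj a) / complex_of_real (cmod a)" by (simp add: sgn_eq)
        also have "\<dots> = complex_of_real ((cmod a)\<^sup>2) / complex_of_real (cmod a)"
          by (simp only: complex_norm_square)
        finally show ?thesis by (simp add: power2_eq_square)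
      qed
      from this[of "l2_rep v x * cnj (l2_rep z x)"] show ?thesis by (simp add: \<phi>_def mult.assoc)
    qed
    ultimately have "(\<integral>x. cmod (l2_rep v x * cnj (l2_rep z x)) \<partial>M) = 0"
      by (simp del: norm_mult)
    then have "AE x in M. l2_rep v x * cnj (l2_rep z x) = 0"
      using integral_nonneg_eq_0_iff_AE[OF integrable_norm[OF inner_integrable[OF v z]]] by simp
    then show ?thesis unfolding z_def[symmetric] by eventually_elim auto
  qed
  then show ?thesis using vanishes_on_adjoint_range_iff[OF sfM U_bounded[OF T] A B] by blast
qed

lemma vanishing_sets_maximal:
  assumes B: "B \<in> sets N"
  shows "\<exists>Z. Z \<in> sets M \<and> (\<forall>T\<in>\<U>. vanishes_on M N T Z B) \<and>
    (\<forall>A\<in>sets M. (\<forall>T\<in>\<U>. vanishes_on M N T A B) \<longrightarrow> (AE x in M. x \<in> A \<longrightarrow> x \<in> Z))"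
proof -
  define \<Z> where "\<Z> = {A \<in> sets M. \<forall>T\<in>\<U>. vanishes_on M N T A B}"
  have empty: "vanishes_on M N T {} B" if T: "T \<in> \<U>" for T
    using vanishes_on_adjoint_range_iff[OF sfM U_bounded[OF T] sets.empty_sets B] by simp
  obtain Z where Z: "Z \<in> \<Z>" and max: "\<And>A. A \<in> \<Z> \<Longrightarrow> A - Z \<in> null_sets M"
  proof (rule exhaustion[OF sfM, of \<Z>])
    show "\<Z> \<noteq> {}" using empty by (auto simp: \<Z>_def)
    fix A :: "nat \<Rightarrow> 'a set" assume A: "range A \<subseteq> \<Z>"
    have "vanishes_on M N T (\<Union>n. A n) B" if T: "T \<in> \<U>" for T
      using A T B by (intro vanishes_on_UN_left[OF sfM U_bounded[OF T]]) (auto simp: \<Z>_def)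
    moreover have "(\<Union>n. A n) \<in> sets M" using A by (auto simp: \<Z>_def)
    ultimately show "(\<Union>n. A n) \<in> \<Z>" by (simp add: \<Z>_def)
  qed (auto simp: \<Z>_def)
  have "AE x in M. x \<in> A \<longrightarrow> x \<in> Z" if "A \<in> sets M" "\<forall>T\<in>\<U>. vanishes_on M N T A B" for A
  proof -
    have "A - Z \<in> null_sets M" using that by (intro max) (simp add: \<Z>_def)
    from AE_not_in[OF this] show ?thesis by eventually_elim blast
  qed
  then show ?thesis using Z by (intro exI[of _ Z]) (simp add: \<Z>_def)
qed

text \<open>\<open>F(B) T S* F(C) = T S* F(B) F(C) = 0\<close>.\<close>

lemma range_orthogonal:
  assumes S: "S \<in> \<U>" and T: "T \<in> \<U>" and B: "B \<in> sets N" and C: "C \<in> sets N" and "B \<inter> C = {}"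
    and g: "g \<in> L2 N" and h: "h \<in> L2 N"
  shows "l2_inner N (T (adj S (set_proj N C h))) (set_proj N B g) = 0"
proof -
  define z where "z = set_proj N B (set_proj N C h)"
  have z: "z \<in> L2 N" using B C h by (simp add: z_def)
  have "AE y in N. l2_rep z y = 0"
    unfolding z_def using rep_proj[OF B proj_L2[OF C h]] rep_proj[OF C h]
    by eventually_elim (use \<open>B \<inter> C = {}\<close> in auto)
  have "l2_inner N (T (adj S (set_proj N C h))) (set_proj N B g)
      = l2_inner N (set_proj N B (T (adj S (set_proj N C h)))) g"
    using S T B C g h by (simp add: proj_inner)
  also have "\<dots> = l2_inner N (T (adj S z)) g"
    unfolding z_def set_proj_def
    by (subst range_commutes_with_mult) (use S T B C h in \<open>auto simp: set_proj_def[symmetric]\<close>)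
  also have "\<dots> = l2_inner N z (S (adj T g))"
    using S T z g by (simp add: adj_inner adj_inner')
  also have "\<dots> = 0"
    by (rule inner_zero_AE) (use z S T g \<open>AE y in N. l2_rep z y = 0\<close> in auto)
  finally show ?thesis .
qed

text \<open>The complement \<open>\<Phi> B\<close> of the largest set \<open>Z B\<close> with \<open>F(B) \<U> E(Z B) = 0\<close> is the smallest set that
  carries all functions \<open>T* F(B) g\<close>. Disjoint sets have almost disjoint images: a function \<open>S* F(C) h\<close> is
  orthogonal to all \<open>T* F(B) g\<close>, hence vanishes on their supports. Together with countable additivity
  this turns \<open>\<Phi>\<close> into the preimage map of a point map.\<close>

lemma support_map:
  assumes N: "standard_borel_space N"
  obtains X f where "X \<in> sets M" "f \<in> restrict_space M X \<rightarrow>\<^sub>M N"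
    "\<And>T B. T \<in> \<U> \<Longrightarrow> B \<in> sets N \<Longrightarrow> vanishes_on M N T (space M - {x \<in> X. f x \<in> B}) B"
    "\<And>A. A \<in> sets M \<Longrightarrow> (\<And>T. T \<in> \<U> \<Longrightarrow> vanishes_on M N T A (space N)) \<Longrightarrow> AE x in M. x \<in> A \<longrightarrow> x \<notin> X"
proof -
  have "\<forall>B\<in>sets N. \<exists>Z. Z \<in> sets M \<and> (\<forall>T\<in>\<U>. vanishes_on M N T Z B) \<and>
    (\<forall>A\<in>sets M. (\<forall>T\<in>\<U>. vanishes_on M N T A B) \<longrightarrow> (AE x in M. x \<in> A \<longrightarrow> x \<in> Z))"
    using vanishing_sets_maximal by (rule ballI)
  from bchoice[OF this] obtain Z where Z': "\<forall>B\<in>sets N. Z B \<in> sets M \<and> (\<forall>T\<in>\<U>. vanishes_on M N T (Z B) B) \<and>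
    (\<forall>A\<in>sets M. (\<forall>T\<in>\<U>. vanishes_on M N T A B) \<longrightarrow> (AE x in M. x \<in> A \<longrightarrow> x \<in> Z B))" ..
  have Z: "Z B \<in> sets M" if "B \<in> sets N" for B
    using Z' that by simp
  have Z_vanish: "vanishes_on M N T (Z B) B" if "B \<in> sets N" "T \<in> \<U>" for B T
    using Z' that by simp
  have Z_max: "AE x in M. x \<in> A \<longrightarrow> x \<in> Z B"
    if "B \<in> sets N" "A \<in> sets M" "\<And>T. T \<in> \<U> \<Longrightarrow> vanishes_on M N T A B" for A B
    using Z' that by simp
  define \<Phi> where "\<Phi> B = space M - Z B" for B
  have \<Phi>: "\<Phi> B \<in> sets M" if "B \<in> sets N" for B unfolding \<Phi>_def using Z[OF that] by simp
  have disj: "\<Phi> B \<inter> \<Phi> C \<in> null_sets M" if B: "B \<in> sets N" and C: "C \<in> sets N" and BC: "B \<inter> C = {}" for B C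
  proof -
    have "vanishes_on M N S (\<Phi> B) C" if S: "S \<in> \<U>" for S
    proof -
      have "AE x in M. x \<in> \<Phi> B \<longrightarrow> l2_rep (adj S (set_proj N C h)) x = 0" if h: "h \<in> L2 N" for h
      proof -
        define v where "v = adj S (set_proj N C h)"
        have v: "v \<in> L2 M" using S C h by (simp add: v_def)
        have "AE x in M. x \<in> {x \<in> space M. l2_rep v x \<noteq> 0} \<longrightarrow> x \<in> Z B"
        proof (rule Z_max[OF B])
          show "{x \<in> space M. l2_rep v x \<noteq> 0} \<in> sets M" using rep_measurable[OF v] by measurable
          show "vanishes_on M N T {x \<in> space M. l2_rep v x \<noteq> 0} B" if T: "T \<in> \<U>" for T
            using annihilated_vector_support[OF v B _ T] range_orthogonal[OF S _ B C BC _ h]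
            unfolding v_def by blast
        qed
        then show ?thesis unfolding v_def[symmetric] \<Phi>_def by eventually_elim auto
      qed
      then show ?thesis
        using vanishes_on_adjoint_range_iff[OF sfM U_bounded[OF S] \<Phi>[OF B] C] by blast
    qed
    then have "AE x in M. x \<in> \<Phi> B \<longrightarrow> x \<in> Z C" by (rule Z_max[OF C \<Phi>[OF B]])
    then have "AE x in M. x \<notin> \<Phi> B \<inter> \<Phi> C"
      by eventually_elim (auto simp: \<Phi>_def)
    then show ?thesis using \<Phi>[OF B] \<Phi>[OF C] by (subst AE_iff_null_sets) auto
  qed
  have UN: "AE x in M. x \<in> \<Phi> (\<Union>n. B n) \<longleftrightarrow> (\<exists>n. x \<in> \<Phi> (B n))" if B': "range B \<subseteq> sets N" for B :: "nat \<Rightarrow> 'b set"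
  proof -
    have B: "B n \<in> sets N" for n using B' by blast
    have UB: "(\<Union>n. B n) \<in> sets N" using B by auto
    have INT: "(\<Inter>n. Z (B n)) \<in> sets M" using Z[OF B] by auto
    have "AE x in M. x \<in> (\<Inter>n. Z (B n)) \<longrightarrow> x \<in> Z (\<Union>n. B n)"
    proof (rule Z_max[OF UB INT])
      fix T assume T: "T \<in> \<U>"
      show "vanishes_on M N T (\<Inter>n. Z (B n)) (\<Union>n. B n)"
      proof (rule vanishes_on_UN_right[OF U_bounded[OF T] INT B'])
        fix n
        show "vanishes_on M N T (\<Inter>n. Z (B n)) (B n)"
          by (rule vanishes_on_mono[OF sfM U_bounded[OF T] Z[OF B] B Z_vanish[OF B T] INT B]) auto
      qed
    qed
    moreover have "AE x in M. \<forall>n. x \<in> Z (\<Union>n. B n) \<longrightarrow> x \<in> Z (B n)"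
      unfolding AE_all_countable
    proof
      fix n
      show "AE x in M. x \<in> Z (\<Union>n. B n) \<longrightarrow> x \<in> Z (B n)"
      proof (rule Z_max[OF B Z[OF UB]])
        fix T assume T: "T \<in> \<U>"
        show "vanishes_on M N T (Z (\<Union>n. B n)) (B n)"
          by (rule vanishes_on_mono[OF sfM U_bounded[OF T] Z[OF UB] UB Z_vanish[OF UB T] Z[OF UB] B]) auto
      qed
    qed
    ultimately show ?thesis using AE_space
      by eventually_elim (auto simp: \<Phi>_def)
  qed
  obtain X f where X: "X \<in> sets M" and f: "f \<in> restrict_space M X \<rightarrow>\<^sub>M N"
    and real: "\<And>B. B \<in> sets N \<Longrightarrow> AE x in M. x \<in> \<Phi> B \<longleftrightarrow> x \<in> X \<and> f x \<in> B"
    using point_realization[OF N \<Phi> disj UN] by blast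
  show thesis
  proof (rule that[OF X f])
    fix T B assume T: "T \<in> \<U>" and B: "B \<in> sets N"
    have "{x \<in> X. f x \<in> B} \<in> sets M" using X f B by (rule preimage_sets)
    then have PB: "space M - {x \<in> X. f x \<in> B} \<in> sets M" by auto
    show "vanishes_on M N T (space M - {x \<in> X. f x \<in> B}) B"
    proof (rule vanishes_on_mono[OF sfM U_bounded[OF T] Z[OF B] B Z_vanish[OF B T] PB B])
      show "AE x in M. x \<in> space M - {x \<in> X. f x \<in> B} \<longrightarrow> x \<in> Z B"
        using real[OF B] by eventually_elim (auto simp: \<Phi>_def)
    qed simp
  next
    fix A assume A: "A \<in> sets M" and "\<And>T. T \<in> \<U> \<Longrightarrow> vanishes_on M N T A (space N)"
    then have "AE x in M. x \<in> A \<longrightarrow> x \<in> Z (space N)" by (intro Z_max) auto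
    moreover have "AE x in M. x \<in> X \<longrightarrow> f x \<in> space N"
      using measurable_space[OF f] sets.sets_into_space[OF X] by (auto simp: space_restrict_space)
    ultimately show "AE x in M. x \<in> A \<longrightarrow> x \<notin> X"
      using real[OF sets.top] by eventually_elim (auto simp: \<Phi>_def)
  qed
qed

end

section \<open>Operators supported by the graph\<close>

text \<open>Such vectors are cyclic and separating for the multiplication masa.\<close>

definition positive_vector :: "'a measure \<Rightarrow> 'a l2vec \<Rightarrow> bool" where
  "positive_vector M W \<longleftrightarrow> W \<in> L2 M \<and> (AE x in M. 0 < Re (l2_rep W x) \<and> Im (l2_rep W x) = 0)"

lemma positive_vector_exists:
  assumes "sigma_finite_measure M"
  obtains W where "positive_vector M W"
proof -
  obtain w :: "'a \<Rightarrow> real" where w: "w \<in> borel_measurable M" "\<And>x. 0 < w x"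
    "(\<lambda>x. complex_of_real (w x)) \<in> sq_integrable M"
    using positive_sq_integrable[OF assms] by blast
  have "(\<lambda>x. complex_of_real (w x)) \<in> borel_measurable M" using w(1) by measurable
  from rep_ae_class(2)[OF this]
  have "AE x in M. 0 < Re (l2_rep (ae_class M (\<lambda>x. complex_of_real (w x))) x) \<and>
      Im (l2_rep (ae_class M (\<lambda>x. complex_of_real (w x))) x) = 0"
    by eventually_elim (simp add: w)
  then have "positive_vector M (ae_class M (\<lambda>x. complex_of_real (w x)))"
    using ae_class_L2[OF w(3)] by (simp add: positive_vector_def)
  then show thesis by (rule that)
qed

lemma positive_vector_cyclic:
  assumes sf: "sigma_finite_measure M" and W: "positive_vector M W" and z: "z \<in> L2 M"
    and perp: "\<And>A. A \<in> sets M \<Longrightarrow> l2_inner M (set_proj M A W) z = 0"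
  shows "AE x in M. l2_rep z x = 0"
proof -
  interpret sigma_finite_measure M by fact
  have W2: "W \<in> L2 M" using W by (simp add: positive_vector_def)
  have "AE x in M. l2_rep W x * cnj (l2_rep z x) = 0"
  proof (rule density_zero)
    show "integrable M (\<lambda>x. l2_rep W x * cnj (l2_rep z x))" using W2 z by (rule inner_integrable)
    fix A assume A: "A \<in> sets M"
    have "(\<integral>x. indicator A x * l2_rep W x * cnj (l2_rep z x) \<partial>M) = 0"
      using perp[OF A] mult_op_inner(1)[of "indicator A" M W z] A W2 z by (simp add: set_proj_def)
    moreover have "indicat_real A x *\<^sub>R (l2_rep W x * cnj (l2_rep z x))
        = indicator A x * l2_rep W x * cnj (l2_rep z x)" for x
      by (simp add: indicator_def)
    ultimately show "set_lebesgue_integral M A (\<lambda>x. l2_rep W x * cnj (l2_rep z x)) = 0"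
      by (simp only: set_lebesgue_integral_def)
  qed
  moreover have "AE x in M. l2_rep W x \<noteq> 0"
    using W unfolding positive_vector_def by (auto elim!: AE_mp)
  ultimately show ?thesis by eventually_elim simp
qed

lemma proj_compl_decomp:
  assumes A: "A \<in> sets M" and u: "u \<in> L2 M"
  shows "u = l2_add M (set_proj M A u) (set_proj M (space M - A) u)"
proof (rule L2_eqI[OF u])
  have A': "space M - A \<in> sets M" using A by auto
  show "AE x in M. l2_rep u x = l2_rep (l2_add M (set_proj M A u) (set_proj M (space M - A) u)) x"
    using rep_add[OF proj_L2[OF A u] proj_L2[OF A' u]] rep_proj[OF A u] rep_proj[OF A' u] AE_space
    by eventually_elim auto
qed (use assms in auto)

lemma l2_diff_add_left:
  assumes "u \<in> L2 M" "v \<in> L2 M" "w \<in> L2 M" "u = l2_add M v w"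
  shows "l2_diff M u w = v"
proof (rule L2_eqI)
  show "AE x in M. l2_rep (l2_diff M u w) x = l2_rep v x"
    using rep_diff[OF assms(1,3)] rep_add[OF assms(2,3)] unfolding assms(4)[symmetric]
    by eventually_elim simp
qed (use assms(1-3) in auto)

lemma le_if_le_add_multiple:
  fixes x y c :: real
  assumes "\<And>e. 0 < e \<Longrightarrow> x \<le> y + c * e" "0 \<le> c"
  shows "x \<le> y"
proof (rule field_le_epsilon)
  fix e :: real assume e: "0 < e"
  have "x \<le> y + c * (e / (c + 1))" using assms(2) e by (intro assms(1)) auto
  also have "c * (e / (c + 1)) \<le> e" using assms(2) e by (simp add: field_simps)
  finally show "x \<le> y + e" by simp
qed

text \<open>The assumptions on \<open>X\<close> and \<open>f\<close> are the conclusions of \<open>support_map\<close>. By \<open>X_full\<close>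
  no part of \<open>X\<close> of positive measure is annihilated by \<open>\<U>\<close>.\<close>

locale graph_bimodule = bimodule_with_abelian_range M N \<U>
  for M :: "'a measure" and N :: "'b measure" and \<U> +
  fixes X :: "'a set" and f :: "'a \<Rightarrow> 'b" and W :: "'b l2vec"
  assumes X: "X \<in> sets M" and f: "f \<in> restrict_space M X \<rightarrow>\<^sub>M N"
    and U_graph: "\<And>T B. T \<in> \<U> \<Longrightarrow> B \<in> sets N \<Longrightarrow> vanishes_on M N T (space M - {x \<in> X. f x \<in> B}) B"
    and X_full: "\<And>A. A \<in> sets M \<Longrightarrow> (\<And>T. T \<in> \<U> \<Longrightarrow> vanishes_on M N T A (space N)) \<Longrightarrow> AE x in M. x \<in> A \<longrightarrow> x \<notin> X"
    and W: "positive_vector N W"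
begin

abbreviation pre :: "'b set \<Rightarrow> 'a set" where
  "pre B \<equiv> {x \<in> X. f x \<in> B}"

definition on_graph :: "('a, 'b) l2op \<Rightarrow> bool" where
  "on_graph T \<longleftrightarrow> T \<in> bounded_ops M N \<and> (\<forall>B\<in>sets N. vanishes_on M N T (space M - pre B) B)"

lemma W_L2 [simp]: "W \<in> L2 N"
  using W by (simp add: positive_vector_def)

lemma pre_sets [simp]: "B \<in> sets N \<Longrightarrow> pre B \<in> sets M"
  by (rule preimage_sets[OF X f])

lemma pre_space: "pre (space N) = X"
  using measurable_space[OF f] sets.sets_into_space[OF X] by (auto simp: space_restrict_space)

lemma U_on_graph: "T \<in> \<U> \<Longrightarrow> on_graph T"
  by (simp add: on_graph_def U_bounded U_graph)

lemma on_graph_adj: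
  assumes "on_graph T"
  shows "adj T \<in> bounded_ops N M"
  using assms by (intro op_adjoint_bounded sfM) (simp add: on_graph_def)

text \<open>\<open>T* F(B) v\<close> lives on \<open>pre B\<close> and \<open>T* F(- B) v\<close> on the disjoint set \<open>pre (- B)\<close>, and \<open>T* v\<close> is their sum.\<close>

lemma intertwine:
  assumes T: "on_graph T" and B: "B \<in> sets N" and v: "v \<in> L2 N"
  shows "adj T (set_proj N B v) = set_proj M (pre B) (adj T v)"
proof -
  note Tb = on_graph_adj[OF T]
  have off: "AE x in M. x \<notin> pre C \<longrightarrow> l2_rep (adj T (set_proj N C v)) x = 0" if C: "C \<in> sets N" for C
  proof -
    have "vanishes_on M N T (space M - pre C) C" using T C by (simp add: on_graph_def)
    moreover have "space M - pre C \<in> sets M" using pre_sets[OF C] by auto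
    ultimately have "AE x in M. x \<in> space M - pre C \<longrightarrow> l2_rep (adj T (set_proj N C v)) x = 0"
      using vanishes_on_adjoint_range_iff[OF sfM _ _ C, of T] T v by (simp add: on_graph_def)
    with AE_space show ?thesis by eventually_elim auto
  qed
  have B': "space N - B \<in> sets N" using B by auto
  have L2: "adj T (set_proj N B v) \<in> L2 M" "adj T (set_proj N (space N - B) v) \<in> L2 M" "adj T v \<in> L2 M"
    using B B' v by (auto intro!: bounded_ops_L2[OF Tb])
  have sum: "adj T v = l2_add M (adj T (set_proj N B v)) (adj T (set_proj N (space N - B) v))"
    using bounded_ops_add[OF Tb proj_L2[OF B v] proj_L2[OF B' v]] proj_compl_decomp[OF B v] by simp
  show ?thesis
  proof (rule L2_eqI)
    show "AE x in M. l2_rep (adj T (set_proj N B v)) x = l2_rep (set_proj M (pre B) (adj T v)) x"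
      using off[OF B] off[OF B'] rep_proj[OF pre_sets[OF B] L2(3)] rep_add[OF L2(1,2)]
      unfolding sum[symmetric] by eventually_elim auto
  qed (use L2 B in auto)
qed

text \<open>If \<open>v\<close> is orthogonal to all \<open>A* W\<close>, then \<open>A v\<close> is orthogonal to all \<open>F(B) W\<close>, so \<open>\<U>\<close> annihilates \<open>v\<close> because \<open>W\<close>
  is cyclic for the masa. Hence \<open>v\<close> vanishes on \<open>X\<close>, whereas \<open>T* W\<close> vanishes outside of \<open>X\<close>.\<close>

lemma approximable_at_weight:
  assumes T: "on_graph T" and e: "0 < e"
  obtains A where "A \<in> \<U>" "l2_norm M (l2_diff M (adj T W) (adj A W)) < e"
proof -
  note Tb = on_graph_adj[OF T]
  define Z where "Z = (\<lambda>A. adj A W) ` \<U>"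
  have "l2_subspace M Z"
    using op_subspace_orbit[OF adjoint_subspace[OF sfM subspace] W_L2] by (simp add: Z_def image_image)
  moreover have "l2_inner M (adj T W) v = 0"
    if v: "v \<in> L2 M" and perp: "\<And>z. z \<in> Z \<Longrightarrow> l2_inner M z v = 0" for v
  proof -
    have Av: "AE y in N. l2_rep (A v) y = 0" if A: "A \<in> \<U>" for A
    proof (rule positive_vector_cyclic[OF sfN W])
      show "A v \<in> L2 N" using A v by simp
      fix B assume B: "B \<in> sets N"
      let ?A = "sandwich M N (indicator B) A (\<lambda>_. 1)"
      have "adj ?A W = adj A (set_proj N B W)"
        using left_multiple(2)[OF ess_bounded_indicator[OF B] A W_L2] by (simp add: set_proj_def)
      moreover have "?A \<in> \<U>" by (intro left_multiple(1) ess_bounded_indicator B A)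
      ultimately have "l2_inner M (adj A (set_proj N B W)) v = 0"
        using perp[of "adj ?A W"] by (auto simp: Z_def)
      then show "l2_inner N (set_proj N B W) (A v) = 0"
        using adj_inner'[OF A v proj_L2[OF B W_L2]] by simp
    qed
    have "vanishes_on M N A {x \<in> space M. l2_rep v x \<noteq> 0} (space N)" if A: "A \<in> \<U>" for A
    proof (rule annihilated_vector_support[OF v sets.top _ A])
      fix R g assume R: "R \<in> \<U>" and g: "g \<in> L2 N"
      show "l2_inner N (R v) (set_proj N (space N) g) = 0"
        by (rule inner_zero_AE) (use Av[OF R] R g v in auto)
    qed
    moreover have "{x \<in> space M. l2_rep v x \<noteq> 0} \<in> sets M" using rep_measurable[OF v] by measurable
    ultimately have v0: "AE x in M. x \<in> {x \<in> space M. l2_rep v x \<noteq> 0} \<longrightarrow> x \<notin> X" by (rule X_full[rotated])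
    have TW: "adj T W \<in> L2 M" by (intro bounded_ops_L2[OF Tb] W_L2)
    have "set_proj N (space N) W = W"
    proof (rule L2_eqI)
      show "AE y in N. l2_rep (set_proj N (space N) W) y = l2_rep W y"
        using rep_proj[OF sets.top W_L2] AE_space by eventually_elim simp
    qed auto
    then have "adj T W = set_proj M X (adj T W)"
      using intertwine[OF T sets.top W_L2] by (simp only: pre_space)
    with rep_proj[OF X TW] have "AE x in M. x \<notin> X \<longrightarrow> l2_rep (adj T W) x = 0"
      by (auto elim!: AE_mp)
    with v0 AE_space have "AE x in M. l2_rep (adj T W) x = 0 \<or> l2_rep v x = 0"
      by eventually_elim auto
    then show ?thesis by (intro inner_zero_AE TW v)
  qed
  ultimately have "\<exists>z\<in>Z. l2_norm M (l2_diff M (adj T W) z) < e"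
    by (intro approximable_by_subspace[OF sfM] bounded_ops_L2[OF Tb] W_L2 e) auto
  then show thesis using that by (auto simp: Z_def)
qed

text \<open>As \<open>A A*\<close> commutes with the masa, \<open>\<parallel>A* (\<phi> W)\<parallel>\<^sup>2 = \<langle>\<phi> A A* W, \<phi> W\<rangle>\<close>.\<close>

lemma energy:
  assumes A: "A \<in> \<U>" and \<phi>: "\<phi> \<in> ess_bounded N"
  defines "e \<equiv> \<lambda>y. (cmod (\<phi> y))\<^sup>2 * (Re (l2_rep (A (adj A W)) y) * Re (l2_rep W y))"
  shows "integrable N e" "(l2_norm M (adj A (mult_op N \<phi> W)))\<^sup>2 = (\<integral>y. e y \<partial>N)"
proof -
  let ?V = "mult_op N \<phi> W" let ?G = "A (adj A W)"
  have \<phi>m [measurable]: "\<phi> \<in> borel_measurable N" using \<phi> by (simp add: ess_bounded_def)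
  have V: "?V \<in> L2 N" and G: "?G \<in> L2 N" using \<phi> A by simp_all
  have m [measurable]: "l2_rep ?G \<in> borel_measurable N" "l2_rep W \<in> borel_measurable N"
    using G W_L2 by (auto intro: rep_measurable)
  define F where "F = (\<lambda>y. \<phi> y * l2_rep ?G y * cnj (l2_rep ?V y))"
  have F: "integrable N F" unfolding F_def by (rule mult_op_inner(3)[OF \<phi> G V])
  have "AE y in N. Re (F y) = e y"
    using rep_mult_op[OF \<phi>m W_L2] W[unfolded positive_vector_def, THEN conjunct2]
  proof eventually_elim
    case (elim y)
    have "cnj (l2_rep W y) = complex_of_real (Re (l2_rep W y))"
      using elim by (simp add: complex_eq_iff)
    then have "F y = (\<phi> y * cnj (\<phi> y)) * (l2_rep ?G y * complex_of_real (Re (l2_rep W y)))"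
      using elim(1) by (simp add: F_def mult_ac)
    also have "\<phi> y * cnj (\<phi> y) = complex_of_real ((cmod (\<phi> y))\<^sup>2)"
      by (rule complex_norm_square[symmetric])
    finally show "Re (F y) = e y" by (simp add: e_def del: of_real_power)
  qed
  moreover have em: "e \<in> borel_measurable N" unfolding e_def by measurable
  moreover have ReF: "integrable N (\<lambda>y. Re (F y))" using F by simp
  ultimately show "integrable N e" by (subst integrable_cong_AE[of _ _ "\<lambda>y. Re (F y)"]) (auto elim!: AE_mp)
  have "(l2_norm M (adj A ?V))\<^sup>2 = Re (l2_inner N (A (adj A ?V)) ?V)"
    using A V by (simp add: norm_sq adj_inner)
  also have "A (adj A ?V) = mult_op N \<phi> ?G"
    by (rule range_commutes_with_mult[symmetric, OF A A \<phi> W_L2])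
  also have "l2_inner N (mult_op N \<phi> ?G) ?V = (\<integral>y. F y \<partial>N)"
    unfolding F_def by (rule mult_op_inner(1)[OF \<phi> G V])
  also have "Re (\<integral>y. F y \<partial>N) = (\<integral>y. Re (F y) \<partial>N)" using F by (rule integral_Re[symmetric])
  also have "\<dots> = (\<integral>y. e y \<partial>N)"
    using \<open>AE y in N. Re (F y) = e y\<close> em ReF by (intro integral_cong_AE) auto
  finally show "(l2_norm M (adj A ?V))\<^sup>2 = (\<integral>y. e y \<partial>N)" .
qed

lemma weight_norm:
  assumes \<phi>: "\<phi> \<in> ess_bounded N"
  defines "e \<equiv> \<lambda>y. (cmod (\<phi> y))\<^sup>2 * (Re (l2_rep W y))\<^sup>2"
  shows "integrable N e" "(l2_norm N (mult_op N \<phi> W))\<^sup>2 = (\<integral>y. e y \<partial>N)"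
proof -
  let ?V = "mult_op N \<phi> W"
  have \<phi>m [measurable]: "\<phi> \<in> borel_measurable N" using \<phi> by (simp add: ess_bounded_def)
  have V: "?V \<in> L2 N" using \<phi> by simp
  have m [measurable]: "l2_rep W \<in> borel_measurable N" using W_L2 by (rule rep_measurable)
  have *: "integrable N (\<lambda>y. (cmod (l2_rep ?V y))\<^sup>2)"
    using rep_sq_integrable[OF V] by (simp add: sq_integrable_def)
  have em: "e \<in> borel_measurable N" unfolding e_def by measurable
  have ae: "AE y in N. e y = (cmod (l2_rep ?V y))\<^sup>2"
    using rep_mult_op[OF \<phi>m W_L2] W[unfolded positive_vector_def, THEN conjunct2]
    by eventually_elim (simp add: e_def norm_mult power_mult_distrib cmod_power2)
  then show "integrable N e" using * em by (subst integrable_cong_AE[OF _ _ ae]) auto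
  have "(l2_norm N ?V)\<^sup>2 = (\<integral>y. (cmod (l2_rep ?V y))\<^sup>2 \<partial>N)" by (simp add: l2_norm_def)
  also have "\<dots> = (\<integral>y. e y \<partial>N)"
    using ae * em by (intro integral_cong_AE[symmetric]) auto
  finally show "(l2_norm N ?V)\<^sup>2 = (\<integral>y. e y \<partial>N)" .
qed

lemma bounded_multiples_dense:
  assumes u: "u \<in> L2 N" and e: "0 < e"
  obtains \<phi> where "\<phi> \<in> ess_bounded N" "l2_norm N (l2_diff N u (mult_op N \<phi> W)) < e"
proof -
  define Z where "Z = (\<lambda>\<phi>. mult_op N \<phi> W) ` ess_bounded N"
  have "l2_subspace N Z"
    unfolding l2_subspace_def
  proof (intro conjI ballI allI)
    show "Z \<subseteq> L2 N" by (auto simp: Z_def)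
    have "ess_bounded N \<noteq> {}" using ess_bounded_const by (metis empty_iff)
    then show "Z \<noteq> {}" by (simp add: Z_def)
    fix p assume "p \<in> Z"
    then obtain \<phi> where \<phi>: "\<phi> \<in> ess_bounded N" "p = mult_op N \<phi> W" by (auto simp: Z_def)
    then have \<phi>m: "\<phi> \<in> borel_measurable N" by (simp add: ess_bounded_def)
    show "l2_add N p q \<in> Z" if q: "q \<in> Z" for q
    proof -
      obtain \<psi> where \<psi>: "\<psi> \<in> ess_bounded N" "q = mult_op N \<psi> W" using q by (auto simp: Z_def)
      then have \<psi>m: "\<psi> \<in> borel_measurable N" by (simp add: ess_bounded_def)
      have s: "(\<lambda>y. \<phi> y + \<psi> y) \<in> ess_bounded N" by (intro ess_bounded_add \<phi> \<psi>)
      then have sm: "(\<lambda>y. \<phi> y + \<psi> y) \<in> borel_measurable N" by (simp add: ess_bounded_def)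
      have "l2_add N p q = mult_op N (\<lambda>y. \<phi> y + \<psi> y) W"
      proof (rule L2_eqI)
        show "AE y in N. l2_rep (l2_add N p q) y = l2_rep (mult_op N (\<lambda>y. \<phi> y + \<psi> y) W) y"
          using rep_add[of p N q] rep_mult_op[OF \<phi>m W_L2] rep_mult_op[OF \<psi>m W_L2] rep_mult_op[OF sm W_L2]
          unfolding \<phi>(2)[symmetric] \<psi>(2)[symmetric]
          using \<phi> \<psi> by (auto simp: distrib_right elim!: AE_mp)
      qed (use \<phi> \<psi> s in auto)
      then show ?thesis using s by (auto simp: Z_def)
    qed
    show "l2_scale N c p \<in> Z" for c
    proof -
      have s: "(\<lambda>y. c * \<phi> y) \<in> ess_bounded N" by (intro ess_bounded_mult \<phi> ess_bounded_const)
      have "l2_scale N c p = mult_op N (\<lambda>_. c) (mult_op N \<phi> W)"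
        using \<phi> by (simp add: l2_scale_def mult_op_def ae_class_L2 sq_integrable_mult rep_sq_integrable)
      then have "l2_scale N c p = mult_op N (\<lambda>y. c * \<phi> y) W"
        using \<phi> by (simp add: mult_op_mult)
      then show ?thesis using s by (auto simp: Z_def)
    qed
  qed
  moreover have "l2_inner N u v = 0"
    if v: "v \<in> L2 N" and perp: "\<And>z. z \<in> Z \<Longrightarrow> l2_inner N z v = 0" for v
  proof -
    have "AE y in N. l2_rep v y = 0"
      using perp by (intro positive_vector_cyclic[OF sfN W v]) (auto simp: Z_def set_proj_def)
    then show ?thesis by (intro inner_zero_AE u v) auto
  qed
  ultimately have "\<exists>z\<in>Z. l2_norm N (l2_diff N u z) < e"
    by (intro approximable_by_subspace[OF sfN] u e) auto
  then show thesis using that by (auto simp: Z_def)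
qed

text \<open>The operator \<open>A A*\<close> is multiplication by \<open>q / w\<close>, where \<open>q\<close> and \<open>w\<close> are the functions \<open>A A* W\<close> and \<open>W\<close>.
  Cutting \<open>A\<close> down to the set where \<open>q / w \<le> C\<^sup>2\<close> for \<open>C = K + 1\<close> makes it bounded by \<open>C\<close>. The part removed, over
  the complementary set \<open>S\<close>, is small at \<open>W\<close>: on the one hand \<open>\<parallel>A* F(S) W\<parallel> \<ge> C \<parallel>F(S) W\<parallel>\<close>, on the other hand \<open>A* F(S) W\<close>
  is within \<open>e\<close> of \<open>T* F(S) W\<close>, of norm at most \<open>K \<parallel>F(S) W\<parallel>\<close>, and so \<open>\<parallel>F(S) W\<parallel> \<le> e\<close>.\<close>

lemma truncation:
  assumes T: "on_graph T" and K: "0 \<le> K" "\<And>v. v \<in> L2 N \<Longrightarrow> l2_norm M (adj T v) \<le> K * l2_norm N v"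
    and A: "A \<in> \<U>" and close: "l2_norm M (l2_diff M (adj T W) (adj A W)) \<le> e"
  obtains B where "B \<in> \<U>" "\<And>v. v \<in> L2 N \<Longrightarrow> l2_norm M (adj B v) \<le> (K + 1) * l2_norm N v"
    "l2_norm M (l2_diff M (adj T W) (adj B W)) \<le> (K + 2) * e"
proof -
  note Tb = on_graph_adj[OF T]
  define C where "C = K + 1"
  have C: "0 < C" using K by (simp add: C_def)
  define q where "q y = Re (l2_rep (A (adj A W)) y)" for y
  define w where "w y = Re (l2_rep W y)" for y
  have m [measurable]: "q \<in> borel_measurable N" "w \<in> borel_measurable N"
    unfolding q_def w_def using rep_measurable[of "A (adj A W)" N] rep_measurable[OF W_L2] A by auto
  have w_pos: "AE y in N. 0 < w y" using W unfolding positive_vector_def w_def by (auto elim!: AE_mp)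
  define S where "S = {y \<in> space N. C\<^sup>2 * w y < q y}"
  have S: "S \<in> sets N" unfolding S_def by measurable
  have S': "space N - S \<in> sets N" using S by auto
  define B where "B = sandwich M N (indicator (space N - S)) A (\<lambda>_. 1)"
  have B: "B \<in> \<U>" unfolding B_def using S' A by (intro left_multiple(1)) auto
  have B_adj: "adj B v = adj A (set_proj N (space N - S) v)" if "v \<in> L2 N" for v
    unfolding B_def using left_multiple(2)[OF ess_bounded_indicator[OF S'] A that]
    by (simp add: set_proj_def)
  have TW: "adj T W \<in> L2 M" and AW: "adj A W \<in> L2 M" and BW: "adj B W \<in> L2 M"
    using A B by (auto intro!: bounded_ops_L2[OF Tb])
  let ?SW = "set_proj N S W"
  have SW: "?SW \<in> L2 N" using S by simp
  have TSW: "adj T ?SW \<in> L2 M" using SW by (intro bounded_ops_L2[OF Tb])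
  have ASW: "adj A ?SW \<in> L2 M" using SW A by simp
  have large: "C * l2_norm N ?SW \<le> l2_norm M (adj A ?SW)"
  proof (rule power2_le_imp_le)
    have ind: "indicator S \<in> ess_bounded N" using S by simp
    have "(C * l2_norm N ?SW)\<^sup>2 = (\<integral>y. C\<^sup>2 * ((cmod (indicator S y))\<^sup>2 * (w y)\<^sup>2) \<partial>N)"
      using weight_norm(2)[OF ind] by (simp add: set_proj_def w_def power_mult_distrib)
    also have "\<dots> \<le> (\<integral>y. (cmod (indicator S y))\<^sup>2 * (q y * w y) \<partial>N)"
    proof (rule integral_mono_AE)
      show "integrable N (\<lambda>y. C\<^sup>2 * ((cmod (indicator S y))\<^sup>2 * (w y)\<^sup>2))"
        using weight_norm(1)[OF ind] by (simp add: w_def)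
      show "integrable N (\<lambda>y. (cmod (indicator S y))\<^sup>2 * (q y * w y))"
        using energy(1)[OF A ind] by (simp add: w_def q_def)
      show "AE y in N. C\<^sup>2 * ((cmod (indicator S y))\<^sup>2 * (w y)\<^sup>2) \<le> (cmod (indicator S y))\<^sup>2 * (q y * w y)"
        using w_pos
      proof eventually_elim
        case (elim y)
        show ?case
        proof (cases "y \<in> S")
          case True
          then have "(C\<^sup>2 * w y) * w y \<le> q y * w y" using elim by (intro mult_right_mono) (auto simp: S_def)
          then show ?thesis using True by (simp add: power2_eq_square mult_ac)
        qed simp
      qed
    qed
    also have "\<dots> = (l2_norm M (adj A ?SW))\<^sup>2"
      using energy(2)[OF A ind] by (simp add: set_proj_def w_def q_def)
    finally show "(C * l2_norm N ?SW)\<^sup>2 \<le> (l2_norm M (adj A ?SW))\<^sup>2" .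
  qed simp
  have near: "l2_norm M (l2_diff M (adj T ?SW) (adj A ?SW)) \<le> e"
  proof -
    have pb: "set_proj M (pre S) \<in> bounded_ops M M"
      unfolding set_proj_def using pre_sets[OF S] by (intro mult_op_bounded ess_bounded_indicator)
    have "l2_diff M (adj T ?SW) (adj A ?SW) = set_proj M (pre S) (l2_diff M (adj T W) (adj A W))"
      using intertwine[OF T S W_L2] intertwine[OF U_on_graph[OF A] S W_L2] bounded_ops_diff[OF pb TW AW]
      by simp
    then have "l2_norm M (l2_diff M (adj T ?SW) (adj A ?SW)) \<le> l2_norm M (l2_diff M (adj T W) (adj A W))"
      using norm_proj_le[OF pre_sets[OF S], of "l2_diff M (adj T W) (adj A W)"] TW AW by simp
    then show ?thesis using close by linarith
  qed
  have "l2_norm M (adj A ?SW) \<le> K * l2_norm N ?SW + e"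
    using norm_le_diff[OF ASW TSW] norm_diff_commute[OF ASW TSW] near K(2)[OF SW] by linarith
  with large have SW_le: "l2_norm N ?SW \<le> e" by (simp add: C_def distrib_right)
  have cut_small: "l2_norm M (adj A ?SW) \<le> (K + 1) * e"
  proof -
    have "K * l2_norm N ?SW \<le> K * e" using SW_le K(1) by (rule mult_left_mono)
    then show ?thesis using \<open>l2_norm M (adj A ?SW) \<le> K * l2_norm N ?SW + e\<close> by (simp add: distrib_right)
  qed
  have "l2_norm M (l2_diff M (adj T W) (adj B W)) \<le> (K + 2) * e"
  proof -
    have S'W: "set_proj N (space N - S) W \<in> L2 N" using S' by simp
    have "l2_diff M (adj A W) (adj B W) = adj A (l2_diff N W (set_proj N (space N - S) W))"
      using bounded_ops_diff[OF adj_bounded[OF A] W_L2 S'W] by (simp add: B_adj)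
    also have "l2_diff N W (set_proj N (space N - S) W) = ?SW"
      by (rule l2_diff_add_left[OF W_L2 SW S'W proj_compl_decomp[OF S W_L2]])
    finally have "l2_norm M (l2_diff M (adj A W) (adj B W)) \<le> (K + 1) * e" using cut_small by simp
    then show ?thesis using norm_diff_triangle[OF TW AW BW] close by (simp add: algebra_simps)
  qed
  moreover have "l2_norm M (adj B u) \<le> (K + 1) * l2_norm N u" if u: "u \<in> L2 N" for u
  proof -
    obtain D where D: "0 \<le> D" "\<And>v. v \<in> L2 N \<Longrightarrow> l2_norm M (adj B v) \<le> D * l2_norm N v"
      using bounded_ops_bound[OF adj_bounded[OF B]] by blast
    have mult: "l2_norm M (adj B (mult_op N \<phi> W)) \<le> C * l2_norm N (mult_op N \<phi> W)"
      if \<phi>: "\<phi> \<in> ess_bounded N" for \<phi>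
    proof (rule power2_le_imp_le)
      define \<psi> where "\<psi> = (\<lambda>y. indicator (space N - S) y * \<phi> y)"
      have \<psi>: "\<psi> \<in> ess_bounded N"
        unfolding \<psi>_def by (intro ess_bounded_mult ess_bounded_indicator S' \<phi>)
      have "adj B (mult_op N \<phi> W) = adj A (mult_op N \<psi> W)"
        using \<phi> S' by (simp add: B_adj set_proj_def mult_op_mult \<psi>_def)
      then have "(l2_norm M (adj B (mult_op N \<phi> W)))\<^sup>2 = (\<integral>y. (cmod (\<psi> y))\<^sup>2 * (q y * w y) \<partial>N)"
        using energy(2)[OF A \<psi>] by (simp add: q_def w_def)
      also have "\<dots> \<le> (\<integral>y. C\<^sup>2 * ((cmod (\<phi> y))\<^sup>2 * (w y)\<^sup>2) \<partial>N)"
      proof (rule integral_mono_AE)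
        show "integrable N (\<lambda>y. (cmod (\<psi> y))\<^sup>2 * (q y * w y))"
          using energy(1)[OF A \<psi>] by (simp add: q_def w_def)
        show "integrable N (\<lambda>y. C\<^sup>2 * ((cmod (\<phi> y))\<^sup>2 * (w y)\<^sup>2))"
          using weight_norm(1)[OF \<phi>] by (simp add: w_def)
        show "AE y in N. (cmod (\<psi> y))\<^sup>2 * (q y * w y) \<le> C\<^sup>2 * ((cmod (\<phi> y))\<^sup>2 * (w y)\<^sup>2)"
          using w_pos AE_space
        proof eventually_elim
          case (elim y)
          show ?case
          proof (cases "y \<in> S")
            case True
            then show ?thesis by (simp add: \<psi>_def)
          next
            case False
            then have "q y * w y \<le> (C\<^sup>2 * w y) * w y"
              using elim by (intro mult_right_mono) (auto simp: S_def not_less)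
            then have "(cmod (\<phi> y))\<^sup>2 * (q y * w y) \<le> (cmod (\<phi> y))\<^sup>2 * ((C\<^sup>2 * w y) * w y)"
              by (intro mult_left_mono) auto
            then show ?thesis using False elim(2) by (simp add: \<psi>_def power2_eq_square mult_ac)
          qed
        qed
      qed
      also have "\<dots> = (C * l2_norm N (mult_op N \<phi> W))\<^sup>2"
        using weight_norm(2)[OF \<phi>] by (simp add: w_def power_mult_distrib)
      finally show "(l2_norm M (adj B (mult_op N \<phi> W)))\<^sup>2 \<le> (C * l2_norm N (mult_op N \<phi> W))\<^sup>2" .
    qed (use C in simp)
    show ?thesis unfolding C_def[symmetric]
    proof (rule le_if_le_add_multiple[of _ _ "D + C"])
      fix \<epsilon> :: real assume "0 < \<epsilon>"
      then obtain \<phi> where \<phi>: "\<phi> \<in> ess_bounded N" and d: "l2_norm N (l2_diff N u (mult_op N \<phi> W)) < \<epsilon>"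
        using bounded_multiples_dense[OF u] by blast
      let ?z = "mult_op N \<phi> W"
      have z: "?z \<in> L2 N" using \<phi> by simp
      have "l2_norm M (adj B u) \<le> l2_norm M (l2_diff M (adj B u) (adj B ?z)) + l2_norm M (adj B ?z)"
        using B u z by (intro norm_le_diff) auto
      also have "l2_diff M (adj B u) (adj B ?z) = adj B (l2_diff N u ?z)"
        by (rule bounded_ops_diff[OF adj_bounded[OF B] u z, symmetric])
      also have "l2_norm M (adj B (l2_diff N u ?z)) \<le> D * \<epsilon>"
        using D(2)[OF diff_L2[OF u z]] mult_left_mono[OF less_imp_le[OF d] D(1)] by linarith
      also have "l2_norm M (adj B ?z) \<le> C * (l2_norm N u + \<epsilon>)"
      proof -
        have "l2_norm N ?z \<le> l2_norm N u + \<epsilon>"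
          using norm_le_diff[OF z u] norm_diff_commute[OF z u] d by linarith
        then have "C * l2_norm N ?z \<le> C * (l2_norm N u + \<epsilon>)" using C by (intro mult_left_mono) auto
        then show ?thesis using mult[OF \<phi>] by linarith
      qed
      finally show "l2_norm M (adj B u) \<le> C * l2_norm N u + (D + C) * \<epsilon>" by (simp add: algebra_simps)
    qed (use C D in simp)
  qed
  ultimately show thesis using that[OF B] by blast
qed

text \<open>Convergence of \<open>B\<^sub>n* W\<close> propagates to all \<open>B\<^sub>n* F(B) W\<close> by the intertwining relation, and from
  there to the whole space by uniform boundedness.\<close>

lemma on_graph_imp_mem:
  assumes T: "on_graph T"
  shows "T \<in> \<U>"
proof -
  note Tb = on_graph_adj[OF T]
  have T': "T \<in> bounded_ops M N" using T by (simp add: on_graph_def)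
  obtain K where K: "0 \<le> K" "\<And>v. v \<in> L2 N \<Longrightarrow> l2_norm M (adj T v) \<le> K * l2_norm N v"
    using bounded_ops_bound[OF Tb] by blast
  define C where "C = K + 1"
  have C: "0 \<le> C" using K by (simp add: C_def)
  have "\<exists>B. B \<in> \<U> \<and> (\<forall>v\<in>L2 N. l2_norm M (adj B v) \<le> C * l2_norm N v) \<and>
      l2_norm M (l2_diff M (adj T W) (adj B W)) \<le> (K + 2) * (1 / Suc n)" for n
  proof -
    have "0 < 1 / real (Suc n)" by simp
    from approximable_at_weight[OF T this] obtain A where A: "A \<in> \<U>"
      "l2_norm M (l2_diff M (adj T W) (adj A W)) < 1 / Suc n" .
    show ?thesis
    proof (rule truncation[OF T K A(1) less_imp_le[OF A(2)]])
      fix B assume "B \<in> \<U>" "\<And>v. v \<in> L2 N \<Longrightarrow> l2_norm M (adj B v) \<le> (K + 1) * l2_norm N v"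
        "l2_norm M (l2_diff M (adj T W) (adj B W)) \<le> (K + 2) * (1 / Suc n)"
      then show ?thesis by (intro exI[of _ B]) (simp add: C_def)
    qed
  qed
  then obtain B where B: "\<And>n. B n \<in> \<U>"
    and B_le: "\<And>n v. v \<in> L2 N \<Longrightarrow> l2_norm M (adj (B n) v) \<le> C * l2_norm N v"
    and B_W: "\<And>n. l2_norm M (l2_diff M (adj T W) (adj (B n) W)) \<le> (K + 2) * (1 / Suc n)"
    by metis
  define d where "d n v = l2_norm M (l2_diff M (adj T v) (adj (B n) v))" for n v
  have norm_d: "norm (d n v) = d n v" for n v by (simp add: d_def)
  have T_L2: "adj T v \<in> L2 M" if "v \<in> L2 N" for v using that by (rule bounded_ops_L2[OF Tb])
  have d_W: "(\<lambda>n. d n W) \<longlonglongrightarrow> 0"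
  proof (rule Lim_null_comparison)
    show "\<forall>\<^sub>F n in sequentially. norm (d n W) \<le> (K + 2) * (1 / Suc n)"
      unfolding norm_d unfolding d_def using B_W by (intro always_eventually allI)
    show "(\<lambda>n. (K + 2) * (1 / Suc n)) \<longlonglongrightarrow> 0"
      by (intro tendsto_mult_right_zero LIMSEQ_Suc[OF lim_1_over_n])
  qed
  define Z where "Z = {z \<in> L2 N. (\<lambda>n. d n z) \<longlonglongrightarrow> 0}"
  have "l2_subspace N Z"
    unfolding l2_subspace_def
  proof (intro conjI ballI allI)
    show "Z \<subseteq> L2 N" by (auto simp: Z_def)
    have "W \<in> Z" using d_W by (simp add: Z_def)
    then show "Z \<noteq> {}" by blast
    fix u assume "u \<in> Z"
    then have u: "u \<in> L2 N" "(\<lambda>n. d n u) \<longlonglongrightarrow> 0" by (auto simp: Z_def)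
    show "l2_add N u v \<in> Z" if "v \<in> Z" for v
    proof -
      have v: "v \<in> L2 N" "(\<lambda>n. d n v) \<longlonglongrightarrow> 0" using that by (auto simp: Z_def)
      have le: "d n (l2_add N u v) \<le> d n u + d n v" for n
      proof -
        have "l2_diff M (adj T (l2_add N u v)) (adj (B n) (l2_add N u v))
            = l2_add M (l2_diff M (adj T u) (adj (B n) u)) (l2_diff M (adj T v) (adj (B n) v))"
          using u v B T_L2
          by (intro eqI_inner[of _ M]) (simp_all add: bounded_ops_add[OF Tb] bounded_ops_add[OF adj_bounded]
              inner_add_left inner_diff_left)
        then show ?thesis unfolding d_def using u v B T_L2 by (simp add: norm_triangle)
      qed
      have "(\<lambda>n. d n (l2_add N u v)) \<longlonglongrightarrow> 0"
      proof (rule Lim_null_comparison)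
        show "\<forall>\<^sub>F n in sequentially. norm (d n (l2_add N u v)) \<le> d n u + d n v"
          unfolding norm_d using le by (intro always_eventually allI)
        show "(\<lambda>n. d n u + d n v) \<longlonglongrightarrow> 0" using tendsto_add[OF u(2) v(2)] by simp
      qed
      then show ?thesis using u v by (simp add: Z_def)
    qed
    show "l2_scale N c u \<in> Z" for c
    proof -
      have "d n (l2_scale N c u) = cmod c * d n u" for n
      proof -
        have "l2_diff M (adj T (l2_scale N c u)) (adj (B n) (l2_scale N c u))
            = l2_scale M c (l2_diff M (adj T u) (adj (B n) u))"
          using u B T_L2
          by (intro eqI_inner[of _ M]) (simp_all add: bounded_ops_scale[OF Tb] bounded_ops_scale[OF adj_bounded]
              inner_scale_left inner_diff_left right_diff_distrib)
        then show ?thesis unfolding d_def using u B T_L2 by (simp add: norm_scale)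
      qed
      then show ?thesis using u tendsto_mult_right_zero[OF u(2), of "cmod c"] by (simp add: Z_def)
    qed
  qed
  have Z_proj: "set_proj N S W \<in> Z" if S: "S \<in> sets N" for S
  proof -
    have pb: "set_proj M (pre S) \<in> bounded_ops M M"
      unfolding set_proj_def using pre_sets[OF S] by (intro mult_op_bounded ess_bounded_indicator)
    have "d n (set_proj N S W) \<le> d n W" for n
    proof -
      have "l2_diff M (adj T (set_proj N S W)) (adj (B n) (set_proj N S W))
          = set_proj M (pre S) (l2_diff M (adj T W) (adj (B n) W))"
        using intertwine[OF T S W_L2] intertwine[OF U_on_graph[OF B] S W_L2]
          bounded_ops_diff[OF pb T_L2[OF W_L2] adj_L2[OF B W_L2]] by simp
      then show ?thesis unfolding d_def
        using norm_proj_le[OF pre_sets[OF S] diff_L2[OF T_L2[OF W_L2] adj_L2[OF B W_L2]]] by simp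
    qed
    then have "\<forall>\<^sub>F n in sequentially. norm (d n (set_proj N S W)) \<le> d n W"
      unfolding norm_d by (intro always_eventually allI)
    from Lim_null_comparison[OF this d_W] have "(\<lambda>n. d n (set_proj N S W)) \<longlonglongrightarrow> 0" .
    then show ?thesis using S by (simp add: Z_def)
  qed
  have d_lim: "(\<lambda>n. d n v) \<longlonglongrightarrow> 0" if v: "v \<in> L2 N" for v
  proof (rule LIMSEQ_I)
    fix e :: real assume e: "0 < e"
    define \<delta> where "\<delta> = e / (2 * (K + C + 1))"
    have pos: "0 < K + C + 1" using K C by linarith
    then have \<delta>: "0 < \<delta>" using e by (simp add: \<delta>_def)
    have "\<exists>z\<in>Z. l2_norm N (l2_diff N v z) < \<delta>"
    proof (rule approximable_by_subspace[OF sfN \<open>l2_subspace N Z\<close> v _ \<delta>])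
      fix x assume x: "x \<in> L2 N" and perp: "\<And>z. z \<in> Z \<Longrightarrow> l2_inner N z x = 0"
      have "AE y in N. l2_rep x y = 0"
        using perp[OF Z_proj] by (intro positive_vector_cyclic[OF sfN W x])
      then show "l2_inner N v x = 0" by (intro inner_zero_AE v x) auto
    qed
    then obtain z where z: "z \<in> L2 N" "(\<lambda>n. d n z) \<longlonglongrightarrow> 0" and vz: "l2_norm N (l2_diff N v z) < \<delta>"
      by (auto simp: Z_def)
    have le: "d n v \<le> d n z + (K + C) * \<delta>" for n
    proof -
      have vzL: "l2_diff N v z \<in> L2 N" using v z by simp
      have 1: "l2_norm M (l2_diff M (adj T v) (adj T z)) \<le> K * \<delta>"
        using K(2)[OF vzL] mult_left_mono[OF less_imp_le[OF vz] K(1)] bounded_ops_diff[OF Tb v z(1)] by simp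
      have 2: "l2_norm M (l2_diff M (adj (B n) z) (adj (B n) v)) \<le> C * \<delta>"
        using B_le[OF vzL, of n] mult_left_mono[OF less_imp_le[OF vz] C]
          bounded_ops_diff[OF adj_bounded[OF B] v z(1), of n]
          norm_diff_commute[OF adj_L2[OF B z(1)] adj_L2[OF B v], of n n] by simp
      have "d n v \<le> l2_norm M (l2_diff M (adj T v) (adj T z)) + l2_norm M (l2_diff M (adj T z) (adj (B n) v))"
        unfolding d_def using v z B T_L2 by (intro norm_diff_triangle) auto
      moreover have "l2_norm M (l2_diff M (adj T z) (adj (B n) v))
          \<le> d n z + l2_norm M (l2_diff M (adj (B n) z) (adj (B n) v))"
        unfolding d_def using v z B T_L2 by (intro norm_diff_triangle) auto
      ultimately show ?thesis using 1 2 by (simp add: distrib_right)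
    qed
    have "(K + C) * \<delta> < e / 2"
    proof -
      have "(K + C) * \<delta> < (K + C + 1) * \<delta>" using \<delta> by (intro mult_strict_right_mono) auto
      also have "\<dots> = e / 2" using pos by (simp add: \<delta>_def field_simps)
      finally show ?thesis .
    qed
    moreover have "\<forall>\<^sub>F n in sequentially. d n z < e / 2"
      using order_tendstoD(2)[OF z(2), of "e / 2"] e by simp
    then obtain n0 where "\<And>n. n \<ge> n0 \<Longrightarrow> d n z < e / 2" by (auto simp: eventually_sequentially)
    moreover have "0 \<le> d n v" for n by (simp add: d_def)
    ultimately have "norm (d n v - 0) < e" if "n \<ge> n0" for n
      using le[of n] that by fastforce
    then show "\<exists>n0. \<forall>n\<ge>n0. norm (d n v - 0) < e" by blast
  qed
  show ?thesis
  proof (rule closed[unfolded bounded_wot_closed_def, rule_format, of B T C])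
    show "B n \<in> \<U>" for n by (rule B)
    show "T \<in> bounded_ops M N" by (rule T')
    show "l2_norm N (B n u) \<le> C * l2_norm M u" if "u \<in> L2 M" for n u
      using op_adjoint_norm_le[OF sfN adj_bounded[OF B] B_le that C, of n]
      by (simp add: op_adjoint_adjoint[OF sfM U_bounded[OF B]])
    fix u v assume u: "u \<in> L2 M" and v: "v \<in> L2 N"
    have "(\<lambda>n. l2_inner N (B n u) v - l2_inner N (T u) v) \<longlonglongrightarrow> 0"
    proof (rule Lim_null_comparison)
      show "\<forall>\<^sub>F n in sequentially. norm (l2_inner N (B n u) v - l2_inner N (T u) v) \<le> l2_norm M u * d n v"
      proof (intro always_eventually allI)
        fix n
        have "l2_inner N (T u) v - l2_inner N (B n u) v = l2_inner M u (l2_diff M (adj T v) (adj (B n) v))"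
          using u v B T_L2 by (simp add: inner_diff_right adj_inner op_adjoint_inner[OF sfM T'])
        then have "norm (l2_inner N (B n u) v - l2_inner N (T u) v)
            = cmod (l2_inner M u (l2_diff M (adj T v) (adj (B n) v)))"
          by (metis norm_minus_commute)
        also have "\<dots> \<le> l2_norm M u * d n v"
          unfolding d_def using u v B T_L2 by (intro cauchy_schwarz) auto
        finally show "norm (l2_inner N (B n u) v - l2_inner N (T u) v) \<le> l2_norm M u * d n v" .
      qed
      show "(\<lambda>n. l2_norm M u * d n v) \<longlonglongrightarrow> 0" by (intro tendsto_mult_right_zero d_lim v)
    qed
    then show "(\<lambda>n. l2_inner N (B n u) v) \<longlonglongrightarrow> l2_inner N (T u) v" by (simp add: LIM_zero_iff)
  qed
qed

end

section \<open>Supports and closedness under adjoints\<close>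

lemma supported_by_iff:
  assumes "T \<in> bounded_ops M N"
  shows "supported_by M N T \<kappa> \<longleftrightarrow>
    (\<forall>A\<in>sets M. \<forall>B\<in>sets N. (A \<times> B) \<inter> \<kappa> = {} \<longrightarrow> vanishes_on M N T A B)"
  unfolding supported_by_def using vanishes_on_iff_compression_zero[OF assms] by simp

lemma standard_borel_separating:
  fixes N :: "'b measure"
  assumes "standard_borel_space N"
  obtains E :: "nat \<Rightarrow> 'b set" where "\<And>n. E n \<in> sets N"
    "\<And>y z. y \<in> space N \<Longrightarrow> z \<in> space N \<Longrightarrow> y \<noteq> z \<Longrightarrow> \<exists>n. y \<in> E n \<and> z \<notin> E n"
proof -
  obtain \<T> where \<T>: "completely_metrizable_space \<T>" "second_countable \<T>" "topspace \<T> = space N"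
    "sets N = sigma_sets (space N) {V. openin \<T> V}"
    using assms by (auto simp: standard_borel_space_def polish_topology_def)
  obtain \<B> where \<B>: "countable \<B>" "\<And>V. V \<in> \<B> \<Longrightarrow> openin \<T> V"
    and base: "\<And>U x. openin \<T> U \<Longrightarrow> x \<in> U \<Longrightarrow> \<exists>V\<in>\<B>. x \<in> V \<and> V \<subseteq> U"
    using \<T>(2) unfolding second_countable_def by metis
  have t1: "t1_space \<T>"
    using \<T>(1) by (intro Hausdorff_imp_t1_space metrizable_imp_Hausdorff_space
        completely_metrizable_imp_metrizable_space)
  define E where "E = from_nat_into (insert {} \<B>)"
  have E: "E n \<in> insert {} \<B>" for n unfolding E_def by (rule from_nat_into) simp
  show thesis
  proof (rule that[of E])
    show "E n \<in> sets N" for n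
      using E[of n] \<B>(2) \<T>(4) by auto
    fix y z assume yz: "y \<in> space N" "z \<in> space N" "y \<noteq> z"
    obtain U where U: "openin \<T> U" "y \<in> U" "z \<notin> U"
      using t1 yz \<T>(3) unfolding t1_space_def by blast
    obtain V where V: "V \<in> \<B>" "y \<in> V" "V \<subseteq> U" using base[OF U(1,2)] by blast
    have "countable (insert {} \<B>)" using \<B>(1) by simp
    from from_nat_into_surj[OF this] V(1) obtain n where "E n = V" unfolding E_def by blast
    then show "\<exists>n. y \<in> E n \<and> z \<notin> E n" using V U by blast
  qed
qed

text \<open>Off the graph, either \<open>x\<close> lies outside of \<open>X\<close>, or a member \<open>E k\<close> of a countable separating family
  contains \<open>f x\<close> but not \<open>y\<close>; the rectangle with index \<open>0\<close> covers the first case, that with index \<open>k + 1\<close> the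
  second.\<close>

lemma graph_complement_rectangles:
  fixes M :: "'a measure" and N :: "'b measure"
  assumes N: "standard_borel_space N" and X: "X \<in> sets M" and f: "f \<in> restrict_space M X \<rightarrow>\<^sub>M N"
  shows "\<exists>A B. (\<forall>n::nat. A n \<in> sets M \<and> B n \<in> sets N) \<and>
    space M \<times> space N - {(x, y). x \<in> X \<and> y \<in> space N \<and> f x = y} = (\<Union>n. A n \<times> B n)"
proof -
  obtain E :: "nat \<Rightarrow> 'b set" where E: "\<And>n. E n \<in> sets N"
    and sep: "\<And>y z. y \<in> space N \<Longrightarrow> z \<in> space N \<Longrightarrow> y \<noteq> z \<Longrightarrow> \<exists>n. y \<in> E n \<and> z \<notin> E n"
    using standard_borel_separating[OF N] by blast
  define A where "A n = (case n of 0 \<Rightarrow> space M - X | Suc k \<Rightarrow> {x \<in> X. f x \<in> E k})" for n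
  define B where "B n = (case n of 0 \<Rightarrow> space N | Suc k \<Rightarrow> space N - E k)" for n
  have XM: "X \<subseteq> space M" using X by (rule sets.sets_into_space)
  have fN: "f x \<in> space N" if "x \<in> X" for x
    using measurable_space[OF f] that XM by (auto simp: space_restrict_space)
  have "A n \<in> sets M \<and> B n \<in> sets N" for n
    using X E preimage_sets[OF X f E] by (cases n) (auto simp: A_def B_def)
  moreover have "space M \<times> space N - {(x, y). x \<in> X \<and> y \<in> space N \<and> f x = y} = (\<Union>n. A n \<times> B n)"
  proof (intro equalityI subrelI)
    fix x y assume "(x, y) \<in> space M \<times> space N - {(x, y). x \<in> X \<and> y \<in> space N \<and> f x = y}"
    then have xy: "x \<in> space M" "y \<in> space N" "x \<in> X \<Longrightarrow> f x \<noteq> y" by auto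
    show "(x, y) \<in> (\<Union>n. A n \<times> B n)"
    proof (cases "x \<in> X")
      case True
      then obtain k where "f x \<in> E k" "y \<notin> E k" using sep[OF fN xy(2)] xy(3) by blast
      then have "(x, y) \<in> A (Suc k) \<times> B (Suc k)" using True xy by (simp add: A_def B_def)
      then show ?thesis by blast
    next
      case False
      then have "(x, y) \<in> A 0 \<times> B 0" using xy by (simp add: A_def B_def)
      then show ?thesis by blast
    qed
  next
    fix x y assume "(x, y) \<in> (\<Union>n. A n \<times> B n)"
    then obtain n where "x \<in> A n" "y \<in> B n" by blast
    then show "(x, y) \<in> space M \<times> space N - {(x, y). x \<in> X \<and> y \<in> space N \<and> f x = y}"
      using XM by (cases n) (auto simp: A_def B_def)
  qed
  ultimately show ?thesis by blast
qed

lemma marginally_equivalent_refl: "marginally_equivalent M N \<kappa> \<kappa>"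
  unfolding marginally_equivalent_def by auto

theorem (in bimodule_with_abelian_range) omega_support_graph:
  assumes N: "standard_borel_space N"
  shows "\<exists>X\<in>sets M. \<exists>f\<in>restrict_space M X \<rightarrow>\<^sub>M N.
    is_omega_support M N \<U> {(x, y). x \<in> X \<and> y \<in> space N \<and> f x = y}"
proof (rule support_map[OF N])
  fix X f assume X: "X \<in> sets M" and f: "f \<in> restrict_space M X \<rightarrow>\<^sub>M N"
    and graph: "\<And>T B. T \<in> \<U> \<Longrightarrow> B \<in> sets N \<Longrightarrow> vanishes_on M N T (space M - {x \<in> X. f x \<in> B}) B"
    and full: "\<And>A. A \<in> sets M \<Longrightarrow> (\<And>T. T \<in> \<U> \<Longrightarrow> vanishes_on M N T A (space N)) \<Longrightarrow> AE x in M. x \<in> A \<longrightarrow> x \<notin> X"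
  obtain W where W: "positive_vector N W" using positive_vector_exists[OF sfN] .
  interpret graph_bimodule M N \<U> X f W
  proof
    show "vanishes_on M N T (space M - {x \<in> X. f x \<in> B}) B" if "T \<in> \<U>" "B \<in> sets N" for T B
      using that by (rule graph)
    show "AE x in M. x \<in> A \<longrightarrow> x \<notin> X"
      if "A \<in> sets M" "\<And>T. T \<in> \<U> \<Longrightarrow> vanishes_on M N T A (space N)" for A
      using that by (rule full)
  qed (rule X f W)+
  let ?\<kappa> = "{(x, y). x \<in> X \<and> y \<in> space N \<and> f x = y}"
  have XM: "X \<subseteq> space M" using X by (rule sets.sets_into_space)
  have "\<U> = {T \<in> bounded_ops M N. supported_by M N T ?\<kappa>}"
  proof (intro equalityI subsetI)
    fix T assume T: "T \<in> \<U>"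
    have "vanishes_on M N T A B" if A: "A \<in> sets M" and B: "B \<in> sets N" and AB: "(A \<times> B) \<inter> ?\<kappa> = {}" for A B
    proof (rule vanishes_on_mono[OF sfM U_bounded[OF T] _ B graph[OF T B] A B])
      show "space M - pre B \<in> sets M" using pre_sets[OF B] by auto
      have "A \<subseteq> space M - pre B"
        using AB sets.sets_into_space[OF A] sets.sets_into_space[OF B] by blast
      then show "AE x in M. x \<in> A \<longrightarrow> x \<in> space M - pre B" by auto
    qed simp
    then show "T \<in> {T \<in> bounded_ops M N. supported_by M N T ?\<kappa>}"
      using U_bounded[OF T] by (simp add: supported_by_iff)
  next
    fix T assume T: "T \<in> {T \<in> bounded_ops M N. supported_by M N T ?\<kappa>}"
    have "vanishes_on M N T (space M - pre B) B" if B: "B \<in> sets N" for B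
    proof -
      have "space M - pre B \<in> sets M" using pre_sets[OF B] by auto
      moreover have "((space M - pre B) \<times> B) \<inter> ?\<kappa> = {}" by auto
      ultimately show ?thesis using T B supported_by_iff[of T M N ?\<kappa>] by blast
    qed
    then have "on_graph T" using T by (simp add: on_graph_def)
    then show "T \<in> \<U>" by (rule on_graph_imp_mem)
  qed
  moreover have "?\<kappa> \<subseteq> space M \<times> space N" using XM by auto
  moreover have "\<exists>A B. (\<forall>n::nat. A n \<in> sets M \<and> B n \<in> sets N) \<and>
      marginally_equivalent M N (space M \<times> space N - ?\<kappa>) (\<Union>n. A n \<times> B n)"
  proof -
    obtain A B where AB: "\<forall>n::nat. A n \<in> sets M \<and> B n \<in> sets N"
      and eq: "space M \<times> space N - ?\<kappa> = (\<Union>n. A n \<times> B n)"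
      using graph_complement_rectangles[OF N X f] by blast
    show ?thesis
    proof (intro exI conjI)
      show "marginally_equivalent M N (space M \<times> space N - ?\<kappa>) (\<Union>n. A n \<times> B n)"
        unfolding eq by (rule marginally_equivalent_refl)
    qed (rule AB)
  qed
  ultimately have "is_omega_support M N \<U> ?\<kappa>" unfolding is_omega_support_def by (intro conjI)
  then show ?thesis using X f by blast
qed

lemma omega_support_transpose:
  assumes sfM: "sigma_finite_measure M" and sfN: "sigma_finite_measure N" and U: "\<U> \<subseteq> bounded_ops M N"
    and supp: "is_omega_support N M (op_adjoint M N ` \<U>) \<kappa>"
  shows "is_omega_support M N \<U> {(x, y). (y, x) \<in> \<kappa>}"
proof -
  let ?\<kappa> = "{(x, y). (y, x) \<in> \<kappa>}"
  have sub: "\<kappa> \<subseteq> space N \<times> space M" using supp by (simp add: is_omega_support_def)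
  obtain A B where AB: "\<And>n::nat. A n \<in> sets N \<and> B n \<in> sets M"
    and eqv: "marginally_equivalent N M (space N \<times> space M - \<kappa>) (\<Union>n. A n \<times> B n)"
    using supp unfolding is_omega_support_def by blast
  have "marginally_equivalent M N (space M \<times> space N - ?\<kappa>) (\<Union>n. B n \<times> A n)"
  proof -
    obtain P Q where PQ: "P \<in> null_sets N" "Q \<in> null_sets M"
      "((space N \<times> space M - \<kappa>) - (\<Union>n. A n \<times> B n)) \<union> ((\<Union>n. A n \<times> B n) - (space N \<times> space M - \<kappa>))
        \<subseteq> P \<times> space M \<union> space N \<times> Q"
      using eqv unfolding marginally_equivalent_def by blast
    have "((space M \<times> space N - ?\<kappa>) - (\<Union>n. B n \<times> A n)) \<union> ((\<Union>n. B n \<times> A n) - (space M \<times> space N - ?\<kappa>))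
        \<subseteq> Q \<times> space N \<union> space M \<times> P"
    proof (rule subrelI)
      fix x y
      assume "(x, y) \<in> ((space M \<times> space N - ?\<kappa>) - (\<Union>n. B n \<times> A n)) \<union>
        ((\<Union>n. B n \<times> A n) - (space M \<times> space N - ?\<kappa>))"
      then have "(y, x) \<in> ((space N \<times> space M - \<kappa>) - (\<Union>n. A n \<times> B n)) \<union>
        ((\<Union>n. A n \<times> B n) - (space N \<times> space M - \<kappa>))"
        by simp blast
      then have "(y, x) \<in> P \<times> space M \<union> space N \<times> Q" by (rule subsetD[OF PQ(3)])
      then show "(x, y) \<in> Q \<times> space N \<union> space M \<times> P" by simp blast
    qed
    then show ?thesis unfolding marginally_equivalent_def using PQ(1,2) by blast
  qed
  moreover have supp_iff: "supported_by M N T ?\<kappa> \<longleftrightarrow> supported_by N M (op_adjoint M N T) \<kappa>"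
    if T: "T \<in> bounded_ops M N" for T
  proof -
    have "(A \<times> B) \<inter> ?\<kappa> = {} \<longleftrightarrow> (B \<times> A) \<inter> \<kappa> = {}" for A B by auto
    then show ?thesis
      using vanishes_on_adjoint_iff[OF sfM T]
      by (auto simp: supported_by_iff[OF T] supported_by_iff[OF op_adjoint_bounded[OF sfM T]])
  qed
  moreover have "\<U> = {T \<in> bounded_ops M N. supported_by M N T ?\<kappa>}"
  proof -
    have eq: "op_adjoint M N ` \<U> = {T \<in> bounded_ops N M. supported_by N M T \<kappa>}"
      using supp by (simp add: is_omega_support_def)
    have "T \<in> \<U> \<longleftrightarrow> op_adjoint M N T \<in> op_adjoint M N ` \<U>" if "T \<in> bounded_ops M N" for T
    proof
      assume "op_adjoint M N T \<in> op_adjoint M N ` \<U>"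
      then obtain S where S: "S \<in> \<U>" "op_adjoint M N T = op_adjoint M N S" by blast
      then have "T = S" using op_adjoint_adjoint[OF sfM that] op_adjoint_adjoint[OF sfM, of S N] U by auto
      then show "T \<in> \<U>" using S by simp
    qed simp
    then show ?thesis using U eq supp_iff op_adjoint_bounded[OF sfM] by auto
  qed
  moreover have "?\<kappa> \<subseteq> space M \<times> space N" using sub by auto
  moreover have "\<forall>n. B n \<in> sets M \<and> A n \<in> sets N" using AB by simp
  ultimately show ?thesis unfolding is_omega_support_def by (intro conjI exI[of _ B] exI[of _ A])
qed

lemma zero_sq_summable: "l2_sq_summable M (\<lambda>_. l2_zero M)"
  using norm_zero_iff[of "l2_zero M" M] rep_zero[of M] by (simp add: l2_sq_summable_def)

text \<open>On a bounded sequence convergence in the weak operator topology is w*-convergence, by dominated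
  convergence of the series that define the w*-continuous functionals.\<close>

lemma weak_star_closed_imp_bounded_wot_closed:
  fixes M :: "'a measure" and N :: "'b measure"
  assumes closed: "closedin (weak_star_topology M N) \<U>"
  shows "bounded_wot_closed M N \<U>"
  unfolding bounded_wot_closed_def
proof (intro allI impI, rule ccontr)
  fix S :: "nat \<Rightarrow> ('a, 'b) l2op" and T C
  assume "\<forall>n. S n \<in> \<U>" and T: "T \<in> bounded_ops M N"
    and "\<forall>n. \<forall>u\<in>L2 M. l2_norm N (S n u) \<le> C * l2_norm M u"
    and "\<forall>u\<in>L2 M. \<forall>v\<in>L2 N. (\<lambda>n. l2_inner N (S n u) v) \<longlonglongrightarrow> l2_inner N (T u) v"
  note S = this(1)[rule_format] and bound = this(3)[rule_format] and lim = this(4)[rule_format]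
  assume TU: "T \<notin> \<U>"
  define \<S> where "\<S> = {{T \<in> bounded_ops M N. (\<Sum>n. l2_inner N (T (\<xi> n)) (\<eta> n)) \<in> V} | \<xi> \<eta> V.
        l2_sq_summable M \<xi> \<and> l2_sq_summable N \<eta> \<and> open V}"
  have top: "weak_star_topology M N = topology_generated_by \<S>"
    by (simp add: weak_star_topology_def \<S>_def)
  have "bounded_ops M N \<in> \<S>"
    unfolding \<S>_def using zero_sq_summable[of M] zero_sq_summable[of N]
    by (intro CollectI exI[of _ "\<lambda>_. l2_zero M"] exI[of _ "\<lambda>_. l2_zero N"] exI[of _ UNIV]) auto
  then have bt: "bounded_ops M N \<subseteq> topspace (weak_star_topology M N)"
    unfolding top topology_generated_by_topspace by blast
  have Sb: "S n \<in> bounded_ops M N" for n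
  proof -
    have "\<U> \<subseteq> \<Union>\<S>" using closedin_subset[OF closed] unfolding top topology_generated_by_topspace .
    also have "\<dots> \<subseteq> bounded_ops M N" by (auto simp: \<S>_def)
    finally show ?thesis using S by blast
  qed
  have ev: "\<forall>\<^sub>F n in sequentially. S n \<in> G" if "generate_topology_on \<S> G" "T \<in> G" for G
    using that
  proof induction
    case Empty
    then show ?case by simp
  next
    case (Int a b)
    then show ?case by (auto intro: eventually_conj)
  next
    case (UN K)
    then obtain k where "k \<in> K" "T \<in> k" by blast
    then show ?case using UN.IH[of k] by (auto elim: eventually_mono)
  next
    case (Basis s)
    then obtain \<xi> \<eta> V where s: "s = {T \<in> bounded_ops M N. (\<Sum>n. l2_inner N (T (\<xi> n)) (\<eta> n)) \<in> V}"
      and \<xi>: "l2_sq_summable M \<xi>" and \<eta>: "l2_sq_summable N \<eta>" and V: "open V"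
      unfolding \<S>_def by blast
    have \<xi>L: "\<xi> k \<in> L2 M" and \<eta>L: "\<eta> k \<in> L2 N" for k using \<xi> \<eta> by (auto simp: l2_sq_summable_def)
    define b where "b k = C\<^sup>2 * (l2_norm M (\<xi> k))\<^sup>2 + (l2_norm N (\<eta> k))\<^sup>2" for k
    have "(\<lambda>n. \<Sum>k. l2_inner N (S n (\<xi> k)) (\<eta> k)) \<longlonglongrightarrow> (\<Sum>k. l2_inner N (T (\<xi> k)) (\<eta> k))"
    proof (rule tannerys_theorem[THEN conjunct2, THEN conjunct2])
      show "(\<lambda>n. l2_inner N (S n (\<xi> k)) (\<eta> k)) \<longlonglongrightarrow> l2_inner N (T (\<xi> k)) (\<eta> k)" for k
        by (rule lim[OF \<xi>L \<eta>L])
      show "summable b"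
        unfolding b_def using \<xi> \<eta> by (intro summable_add summable_mult) (auto simp: l2_sq_summable_def)
      have "norm (l2_inner N (S n (\<xi> k)) (\<eta> k)) \<le> b k" for n k
      proof -
        have "norm (l2_inner N (S n (\<xi> k)) (\<eta> k)) \<le> l2_norm N (S n (\<xi> k)) * l2_norm N (\<eta> k)"
          by (intro cauchy_schwarz \<eta>L bounded_ops_L2[OF Sb] \<xi>L)
        also have "\<dots> \<le> (C * l2_norm M (\<xi> k)) * l2_norm N (\<eta> k)"
          by (intro mult_right_mono bound \<xi>L) simp
        also have "\<dots> \<le> (C * l2_norm M (\<xi> k))\<^sup>2 + (l2_norm N (\<eta> k))\<^sup>2" by (rule mult_le_sum_squares)
        finally show ?thesis by (simp add: b_def power_mult_distrib)
      qed
      then show "\<forall>\<^sub>F (k, n) in sequentially \<times>\<^sub>F sequentially. norm (l2_inner N (S n (\<xi> k)) (\<eta> k)) \<le> b k"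
        by (intro always_eventually) auto
    qed simp
    moreover have "(\<Sum>k. l2_inner N (T (\<xi> k)) (\<eta> k)) \<in> V" using Basis s by simp
    ultimately have "\<forall>\<^sub>F n in sequentially. (\<Sum>k. l2_inner N (S n (\<xi> k)) (\<eta> k)) \<in> V"
      using V by (intro topological_tendstoD)
    then show ?case by eventually_elim (simp add: s Sb)
  qed
  have "openin (weak_star_topology M N) (topspace (weak_star_topology M N) - \<U>)"
    using closed by (simp add: closedin_def)
  then have "generate_topology_on \<S> (topspace (weak_star_topology M N) - \<U>)"
    unfolding top by (simp only: openin_topology_generated_by_iff)
  then have "\<forall>\<^sub>F n in sequentially. S n \<in> topspace (weak_star_topology M N) - \<U>"
    by (rule ev) (use T TU bt in blast)
  then have "\<forall>\<^sub>F n::nat in sequentially. False" by eventually_elim (use S in blast)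
  then show False by simp
qed

lemma masa_bimodule_sandwich:
  assumes "masa_bimodule M N \<U>" "\<psi> \<in> ess_bounded N" "T \<in> \<U>" "\<phi> \<in> ess_bounded M"
  shows "sandwich M N \<psi> T \<phi> \<in> \<U>"
  using assms unfolding masa_bimodule_def mult_masa_def sandwich_def by blast

lemma op_span_superset: "T \<in> \<S> \<Longrightarrow> T \<in> op_span M N \<S>"
  unfolding op_span_def by (rule hull_inc)

lemma abelian_ops_apply:
  assumes "abelian_ops M \<A>" "S \<in> \<A>" "T \<in> \<A>" "u \<in> L2 M"
  shows "S (T u) = T (S u)"
  using assms op_comp_apply[of u M S T] op_comp_apply[of u M T S] by (simp add: abelian_ops_def)

lemma adjoint_bounded_wot_closed:
  fixes M :: "'a measure" and N :: "'b measure"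
  assumes sfM: "sigma_finite_measure M" and sfN: "sigma_finite_measure N" and U: "\<U> \<subseteq> bounded_ops M N"
    and closed: "bounded_wot_closed M N \<U>"
  shows "bounded_wot_closed N M (op_adjoint M N ` \<U>)"
  unfolding bounded_wot_closed_def
proof (intro allI impI, rule image_eqI)
  fix P :: "nat \<Rightarrow> ('b, 'a) l2op" and R C
  assume "\<forall>n. P n \<in> op_adjoint M N ` \<U>" and R: "R \<in> bounded_ops N M"
    and "\<forall>n. \<forall>u\<in>L2 N. l2_norm M (P n u) \<le> C * l2_norm N u"
    and "\<forall>u\<in>L2 N. \<forall>v\<in>L2 M. (\<lambda>n. l2_inner M (P n u) v) \<longlonglongrightarrow> l2_inner M (R u) v"
  note P = this(1)[rule_format] and bound = this(3)[rule_format] and lim = this(4)[rule_format]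
  define S where "S n = op_adjoint N M (P n)" for n
  have SP: "S n \<in> \<U> \<and> P n \<in> bounded_ops N M" for n
  proof -
    obtain S' where S': "S' \<in> \<U>" "P n = op_adjoint M N S'" using P[of n] by blast
    have "S' \<in> bounded_ops M N" using S'(1) U by blast
    then show ?thesis
      using S' op_adjoint_adjoint[OF sfM, of S' N] op_adjoint_bounded[OF sfM, of S' N] by (simp add: S_def)
  qed
  show "R = op_adjoint M N (op_adjoint N M R)" using op_adjoint_adjoint[OF sfN R] by simp
  show "op_adjoint N M R \<in> \<U>"
  proof (rule closed[unfolded bounded_wot_closed_def, rule_format, of S _ "max 0 C"])
    show "S n \<in> \<U>" for n using SP by blast
    show "op_adjoint N M R \<in> bounded_ops M N" by (rule op_adjoint_bounded[OF sfN R])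
    show "l2_norm N (S n u) \<le> max 0 C * l2_norm M u" if u: "u \<in> L2 M" for n u
    proof -
      have "P n \<in> bounded_ops N M" using SP by blast
      then show ?thesis unfolding S_def
      proof (rule op_adjoint_norm_le[OF sfN _ _ u])
        show "l2_norm M (P n v) \<le> max 0 C * l2_norm N v" if "v \<in> L2 N" for v
          using bound[OF that] by (rule order_trans) (simp add: mult_right_mono)
      qed simp
    qed
    fix u v assume u: "u \<in> L2 M" and v: "v \<in> L2 N"
    have "l2_inner N (op_adjoint N M Q u) v = cnj (l2_inner M (Q v) u)" if "Q \<in> bounded_ops N M" for Q
      using op_adjoint_inner[OF sfN that v u] by (simp add: inner_cnj)
    then show "(\<lambda>n. l2_inner N (S n u) v) \<longlonglongrightarrow> l2_inner N (op_adjoint N M R u) v"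
      using tendsto_cnj[OF lim[OF v u]] SP R by (simp add: S_def)
  qed
qed

theorem corollary3p3:
  fixes M :: "'a measure" and N :: "'b measure" and \<U> :: "('a, 'b) l2op set"
  assumes "standard_borel_space M" and "sigma_finite_measure M"
    and "standard_borel_space N" and "sigma_finite_measure N"
    and "normalizing M N \<U>"
    and "closedin (weak_star_topology M N) \<U>"
    and "masa_bimodule M N \<U>"
  shows "(abelian_ops N (left_algebra M N \<U>) \<longrightarrow>
            (\<exists>X\<^sub>o\<in>sets M. \<exists>f\<in>restrict_space M X\<^sub>o \<rightarrow>\<^sub>M N.
               is_omega_support M N \<U> {(x, y). x \<in> X\<^sub>o \<and> y \<in> space N \<and> f x = y})) \<and>
         (abelian_ops M (right_algebra M N \<U>) \<longrightarrow>
            (\<exists>Y\<^sub>o\<in>sets N. \<exists>g\<in>restrict_space N Y\<^sub>o \<rightarrow>\<^sub>M M.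
               is_omega_support M N \<U> {(x, y). x \<in> space M \<and> y \<in> Y\<^sub>o \<and> x = g y}))"
proof (intro conjI impI)
  note sfM = assms(2) and sfN = assms(4)
  have sub: "op_subspace M N \<U>" using assms(5) by (simp add: normalizing_def)
  have bdd: "T \<in> bounded_ops M N" if "T \<in> \<U>" for T using sub that by (auto simp: op_subspace_def)
  have U_sub: "\<U> \<subseteq> bounded_ops M N" using bdd by blast
  have adj_bdd: "op_adjoint M N T \<in> bounded_ops N M" if "T \<in> \<U>" for T
    using that by (intro op_adjoint_bounded sfM bdd)
  have adj_adj: "op_adjoint N M (op_adjoint M N T) = T" if "T \<in> \<U>" for T
    using that by (intro op_adjoint_adjoint sfM bdd)
  note mem_bimodule = masa_bimodule_sandwich[OF assms(7)]
  note mem_closed = weak_star_closed_imp_bounded_wot_closed[OF assms(6)]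
  {
    assume ab: "abelian_ops N (left_algebra M N \<U>)"
    have "bimodule_with_abelian_range M N \<U>"
    proof (rule bimodule_with_abelian_range.intro)
      show "S (op_adjoint M N T (S' (op_adjoint M N T' u))) = S' (op_adjoint M N T' (S (op_adjoint M N T u)))"
        if mem: "S \<in> \<U>" "T \<in> \<U>" "S' \<in> \<U>" "T' \<in> \<U>" and u: "u \<in> L2 N" for S T S' T' u
      proof -
        have "op_comp N S (op_adjoint M N T) \<in> left_algebra M N \<U>"
          "op_comp N S' (op_adjoint M N T') \<in> left_algebra M N \<U>"
          unfolding left_algebra_def using mem by (auto intro!: op_span_superset)
        from abelian_ops_apply[OF ab this u] show ?thesis
          using u mem by (simp add: op_comp_apply bounded_ops_L2[OF bdd] bounded_ops_L2[OF adj_bdd])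
      qed
    qed (rule sfM sfN sub mem_closed | erule (2) mem_bimodule)+
    from bimodule_with_abelian_range.omega_support_graph[OF this assms(3)]
    show "\<exists>X\<^sub>o\<in>sets M. \<exists>f\<in>restrict_space M X\<^sub>o \<rightarrow>\<^sub>M N.
      is_omega_support M N \<U> {(x, y). x \<in> X\<^sub>o \<and> y \<in> space N \<and> f x = y}" .
  }
  assume ab: "abelian_ops M (right_algebra M N \<U>)"
  let ?V = "op_adjoint M N ` \<U>"
  have "bimodule_with_abelian_range N M ?V"
  proof (rule bimodule_with_abelian_range.intro)
    fix \<psi> P \<phi> assume \<psi>: "\<psi> \<in> ess_bounded M" and P: "P \<in> ?V" and \<phi>: "\<phi> \<in> ess_bounded N"
    obtain T where T: "T \<in> \<U>" "P = op_adjoint M N T" using P by blast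
    show "sandwich N M \<psi> P \<phi> \<in> ?V"
    proof (rule image_eqI)
      show "sandwich M N (\<lambda>y. cnj (\<phi> y)) T (\<lambda>x. cnj (\<psi> x)) \<in> \<U>"
        by (intro mem_bimodule ess_bounded_cnj \<psi> \<phi> T)
      show "sandwich N M \<psi> P \<phi> = op_adjoint M N (sandwich M N (\<lambda>y. cnj (\<phi> y)) T (\<lambda>x. cnj (\<psi> x)))"
        using sandwich_adjoint[OF sfM bdd[OF T(1)] ess_bounded_cnj[OF \<phi>] ess_bounded_cnj[OF \<psi>]] T(2) by simp
    qed
  next
    fix P Q P' Q' u assume mem: "P \<in> ?V" "Q \<in> ?V" "P' \<in> ?V" "Q' \<in> ?V" and u: "u \<in> L2 M"
    obtain S T where ST: "S \<in> \<U>" "T \<in> \<U>" "P = op_adjoint M N S" "Q = op_adjoint M N T"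
      using mem(1,2) by blast
    obtain S' T' where ST': "S' \<in> \<U>" "T' \<in> \<U>" "P' = op_adjoint M N S'" "Q' = op_adjoint M N T'"
      using mem(3,4) by blast
    note mem' = ST(1,2) ST'(1,2) and eq = ST(3,4) ST'(3,4)
    have "op_comp M (op_adjoint M N S) T \<in> right_algebra M N \<U>"
      "op_comp M (op_adjoint M N S') T' \<in> right_algebra M N \<U>"
      unfolding right_algebra_def using mem' by (auto intro!: op_span_superset)
    from abelian_ops_apply[OF ab this u]
    show "P (op_adjoint N M Q (P' (op_adjoint N M Q' u))) = P' (op_adjoint N M Q' (P (op_adjoint N M Q u)))"
      using u mem' by (simp add: eq adj_adj op_comp_apply bounded_ops_L2[OF bdd] bounded_ops_L2[OF adj_bdd])
  qed (rule sfN sfM adjoint_subspace[OF sfM sub] adjoint_bounded_wot_closed[OF sfM sfN U_sub mem_closed])+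
  from bimodule_with_abelian_range.omega_support_graph[OF this assms(1)]
  obtain Y g where Y: "Y \<in> sets N" and g: "g \<in> restrict_space N Y \<rightarrow>\<^sub>M M"
    and supp: "is_omega_support N M ?V {(y, x). y \<in> Y \<and> x \<in> space M \<and> g y = x}" by blast
  from omega_support_transpose[OF sfM sfN U_sub supp]
  have "is_omega_support M N \<U> {(x, y). x \<in> space M \<and> y \<in> Y \<and> x = g y}"
    by (rule back_subst[of "is_omega_support M N \<U>"]) auto
  then show "\<exists>Y\<^sub>o\<in>sets N. \<exists>g\<in>restrict_space N Y\<^sub>o \<rightarrow>\<^sub>M M.
      is_omega_support M N \<U> {(x, y). x \<in> space M \<and> y \<in> Y\<^sub>o \<and> x = g y}"
    using Y g by blast
qed

end
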